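(* Let $n\ge1$, $\omega\in[0,2]$, and $$\Omega_n=\Bigl\{(\xi_1,\dots,\xi_n)\in\mathbb{T}^n:\tfrac2n\sum_{j=1}^n\sin^2(\pi\xi_j)\le\omega\Bigr\}.$$ Let $P:\mathbb{T}^n\to\mathbb{T}^n$ be a bijection that maps $\Omega_n$ onto a domain $D\subset\mathbb{T}^n$, is piecewise $\mathcal{C}^1$ on $\Omega_n$, and whose Jacobian $J_P$ satisfies $0<c\le|J_P|\le C<\infty$ on $\Omega_n$. Define $S:L^2(\Omega_n)\to L^2(D)$ by $Sg=g\circ P^{-1}|_D$. Let $\{\psi_j\}_{j\ge0}$ be an orthonormal basis of $L^2(D)$, let $(\lambda_j)_{j\ge0}$ be a uniformly separated sequence in the open unit disc, let $T=\sum_{j=0}^\infty\lambda_j\langle\cdot,\psi_j\rangle\psi_j$ on $L^2(D)$, and let $h_0\in L^2(D)$ satisfy $|\langle h_0,\psi_j\rangle|^2\sim1-|\lambda_j|^2$. Set $$f_0=\mathcal{F}^{-1}S^{-1}h_0\in\ell^2(\mathbb{Z}^n),\qquad R=\mathcal{F}^{-1}S^{-1}TS\mathcal{F}.$$ Then $R(GPW_\omega(\mathbb{Z}^n))\subset GPW_\omega(\mathbb{Z}^n)$, and the sequence $(R^kf_0)_{k\ge0}$ is a frame for $GPW_\omega(\mathbb{Z}^n)$.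
   Context: $\mathbb{T}^n$ is identified with $[-\frac12,\frac12)^n$ with addition modulo $\mathbb{Z}^n$ and Lebesgue measure. $\mathcal{F}:\ell^2(\mathbb{Z}^n)\to L^2(\mathbb{T}^n)$ is the unitary Fourier transform $\mathcal{F}f(\xi)=\sum_{k\in\mathbb{Z}^n}f(k)e^{2\pi i k\cdot\xi}$. For measurable $E\subset\mathbb{T}^n$, $L^2(E)$ is the space of $g\in L^2(\mathbb{T}^n)$ vanishing a.e. outside $E$. $GPW_\omega(\mathbb{Z}^n)=\{f\in\ell^2(\mathbb{Z}^n):\mathcal{F}f\in L^2(\Omega_n)\}$; this is the spectral subspace for $[0,\omega]$ of the normalized Laplacian of the lattice graph $\mathbb{Z}^n$, whose Fourier symbol is $\frac2n\sum_{j=1}^n\sin^2(\pi\xi_j)$. "Piecewise $\mathcal{C}^1$ on $\Omega_n$" means: there are finitely many pairwise disjoint open sets contained in $\Omega_n$, covering $\Omega_n$ up to a null set whose image under $P$ is also null, on each of which $P$ is $\mathcal{C}^1$; the Jacobian bounds are required on these open sets. In the definition of $R$, the operator $S$ (defined on $L^2(\Omega_n)$) is applied to the restriction $\chi_{\Omega_n}\mathcal{F}f$, so that $R$ acts on all of $\ell^2(\mathbb{Z}^n)$; on $GPW_\omega(\mathbb{Z}^n)$ this restriction is vacuous. A sequence $(\lambda_j)_{j\ge0}$ in the open unit disc is uniformly separated if $\inf_{j}\prod_{k\ne j}\left|\frac{\lambda_j-\lambda_k}{1-\overline{\lambda_k}\lambda_j}\right|>0$. For nonnegative sequences, $a_j\sim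 b_j$ means there exist $c,C>0$ with $c\,a_j\le b_j\le C\,a_j$ for all $j$. A sequence $(f_k)$ in a Hilbert space $\mathcal{H}$ is a frame for $\mathcal{H}$ if there are $A,B>0$ with $A\|f\|^2\le\sum_k|\langle f,f_k\rangle|^2\le B\|f\|^2$ for all $f\in\mathcal{H}$. *)

theory Defs
  imports "HOL-Analysis.Analysis"
begin

section \<open>The torus\<close>

definition torus :: "(real ^ 'n) set" where
  "torus = {\<xi>. \<forall>j. - 1 / 2 \<le> \<xi> $ j \<and> \<xi> $ j < 1 / 2}"

text \<open>The representative in \<open>torus\<close> of the class of a point modulo the integer lattice.\<close>

definition torus_wrap :: "real ^ 'n \<Rightarrow> real ^ 'n" where
  "torus_wrap x = (\<chi> j. frac (x $ j + 1 / 2) - 1 / 2)"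

text \<open>Openness refers to the quotient topology, so that opposite faces of the cube are glued.\<close>

definition torus_open :: "(real ^ 'n) set \<Rightarrow> bool" where
  "torus_open U \<longleftrightarrow> U \<subseteq> torus \<and> open (torus_wrap -` U)"

text \<open>A self-map \<open>P\<close> of the torus, read near a point \<open>\<xi>\<close> in the chart \<open>torus_wrap\<close> of the
  source and in the chart of the target centred at \<open>P \<xi>\<close>, i.e. the inverse of
  \<open>v \<mapsto> P \<xi> + v\<close> modulo the lattice.  Its derivative at \<open>\<xi>\<close> is the derivative of \<open>P\<close> as a map
  of manifolds; where \<open>P\<close> does not jump across the faces of the cube, it is that of \<open>P\<close> itself.\<close>

definition torus_chart_rep ::
    "(real ^ 'n \<Rightarrow> real ^ 'n) \<Rightarrow> real ^ 'n \<Rightarrow> real ^ 'n \<Rightarrow> real ^ 'n" where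
  "torus_chart_rep P \<xi> = (\<lambda>x. torus_wrap (P (torus_wrap x) - P \<xi>))"

definition torus_derivative :: "(real ^ 'n \<Rightarrow> real ^ 'n) \<Rightarrow> real ^ 'n \<Rightarrow> real ^ 'n ^ 'n" where
  "torus_derivative P \<xi> = jacobian (torus_chart_rep P \<xi>) (at \<xi>)"

definition torus_jacobian_det :: "(real ^ 'n \<Rightarrow> real ^ 'n) \<Rightarrow> real ^ 'n \<Rightarrow> real" where
  "torus_jacobian_det P \<xi> = det (torus_derivative P \<xi>)"

definition torus_C1_on :: "(real ^ 'n \<Rightarrow> real ^ 'n) \<Rightarrow> (real ^ 'n) set \<Rightarrow> bool" where
  "torus_C1_on P U \<longleftrightarrow>
     (\<forall>\<xi>\<in>U. torus_chart_rep P \<xi> differentiable (at \<xi>)) \<and>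
     continuous_on (torus_wrap -` U) (\<lambda>x. torus_derivative P (torus_wrap x))"

text \<open>The pieces \<open>\<U>\<close> are a parameter because the Jacobian bounds refer to the same pieces.\<close>

definition torus_piecewise_C1_on ::
    "(real ^ 'n \<Rightarrow> real ^ 'n) \<Rightarrow> (real ^ 'n) set \<Rightarrow> (real ^ 'n) set set \<Rightarrow> bool" where
  "torus_piecewise_C1_on P \<Omega> \<U> \<longleftrightarrow>
     finite \<U> \<and> pairwise disjnt \<U> \<and>
     (\<forall>U\<in>\<U>. torus_open U \<and> U \<subseteq> \<Omega> \<and> torus_C1_on P U) \<and>
     negligible (\<Omega> - \<Union>\<U>) \<and> negligible (P ` (\<Omega> - \<Union>\<U>))"


section \<open>Square-integrable functions on the torus\<close>

text \<open>Elements of \<open>L\<^sup>2\<close> are represented by functions, equality being equality almost everywhere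
  on the torus; values outside \<open>torus\<close> are irrelevant.\<close>

abbreviation torus_measure :: "(real ^ 'n) measure" where
  "torus_measure \<equiv> lebesgue_on torus"

definition L2 :: "(real ^ 'n) set \<Rightarrow> (real ^ 'n \<Rightarrow> complex) set" where
  "L2 E = {g. g \<in> borel_measurable torus_measure \<and>
              integrable torus_measure (\<lambda>\<xi>. (cmod (g \<xi>))\<^sup>2) \<and>
              (AE \<xi> in torus_measure. \<xi> \<notin> E \<longrightarrow> g \<xi> = 0)}"

definition L2_eq :: "(real ^ 'n \<Rightarrow> complex) \<Rightarrow> (real ^ 'n \<Rightarrow> complex) \<Rightarrow> bool" where
  "L2_eq g h \<longleftrightarrow> (AE \<xi> in torus_measure. g \<xi> = h \<xi>)"

definition L2_inner :: "(real ^ 'n \<Rightarrow> complex) \<Rightarrow> (real ^ 'n \<Rightarrow> complex) \<Rightarrow> complex" where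
  "L2_inner g h = (LINT \<xi>|torus_measure. g \<xi> * cnj (h \<xi>))"

definition L2_norm :: "(real ^ 'n \<Rightarrow> complex) \<Rightarrow> real" where
  "L2_norm g = sqrt (LINT \<xi>|torus_measure. (cmod (g \<xi>))\<^sup>2)"

definition L2_tendsto ::
    "('i \<Rightarrow> real ^ 'n \<Rightarrow> complex) \<Rightarrow> (real ^ 'n \<Rightarrow> complex) \<Rightarrow> 'i filter \<Rightarrow> bool" where
  "L2_tendsto u g F \<longleftrightarrow> ((\<lambda>i. L2_norm (\<lambda>\<xi>. u i \<xi> - g \<xi>)) \<longlongrightarrow> 0) F"

definition L2_orthonormal_basis ::
    "(real ^ 'n) set \<Rightarrow> (nat \<Rightarrow> real ^ 'n \<Rightarrow> complex) \<Rightarrow> bool" where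
  "L2_orthonormal_basis E \<psi> \<longleftrightarrow>
     (\<forall>j. \<psi> j \<in> L2 E) \<and>
     (\<forall>i j. L2_inner (\<psi> i) (\<psi> j) = (if i = j then 1 else 0)) \<and>
     (\<forall>g\<in>L2 E. L2_tendsto (\<lambda>N \<xi>. \<Sum>j<N. L2_inner g (\<psi> j) * \<psi> j \<xi>) g sequentially)"

text \<open>The operator \<open>\<Sum>\<^sub>j \<lambda>\<^sub>j \<langle>\<cdot>, \<psi>\<^sub>j\<rangle> \<psi>\<^sub>j\<close> on \<open>L\<^sup>2(E)\<close>.\<close>

definition diagonal_op ::
    "(real ^ 'n) set \<Rightarrow> (nat \<Rightarrow> real ^ 'n \<Rightarrow> complex) \<Rightarrow> (nat \<Rightarrow> complex) \<Rightarrow>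
     (real ^ 'n \<Rightarrow> complex) \<Rightarrow> (real ^ 'n \<Rightarrow> complex)" where
  "diagonal_op E \<psi> lam g =
     (SOME u. u \<in> L2 E \<and>
        L2_tendsto (\<lambda>N \<xi>. \<Sum>j<N. lam j * L2_inner g (\<psi> j) * \<psi> j \<xi>) u sequentially)"

definition restrict_to :: "(real ^ 'n) set \<Rightarrow> (real ^ 'n \<Rightarrow> complex) \<Rightarrow> (real ^ 'n \<Rightarrow> complex)" where
  "restrict_to E g = (\<lambda>\<xi>. if \<xi> \<in> E then g \<xi> else 0)"

text \<open>The operator \<open>S g = g \<circ> P\<^sup>-\<^sup>1\<close> restricted to \<open>D\<close>, with \<open>P\<close> a bijection of the torus, and its
  inverse as an operator from \<open>L\<^sup>2(D)\<close> to \<open>L\<^sup>2(\<Omega>)\<close>.\<close>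

definition transport_op ::
    "(real ^ 'n \<Rightarrow> real ^ 'n) \<Rightarrow> (real ^ 'n) set \<Rightarrow> (real ^ 'n \<Rightarrow> complex) \<Rightarrow> (real ^ 'n \<Rightarrow> complex)"
  where "transport_op P D g = restrict_to D (g \<circ> inv_into torus P)"

definition transport_op_inv ::
    "(real ^ 'n \<Rightarrow> real ^ 'n) \<Rightarrow> (real ^ 'n) set \<Rightarrow> (real ^ 'n) set \<Rightarrow>
     (real ^ 'n \<Rightarrow> complex) \<Rightarrow> (real ^ 'n \<Rightarrow> complex)" where
  "transport_op_inv P \<Omega> D h = (SOME g. g \<in> L2 \<Omega> \<and> L2_eq (transport_op P D g) h)"


section \<open>Square-summable functions on the integer lattice and the Fourier transform\<close>

definition ell2 :: "(int ^ 'n \<Rightarrow> complex) set" where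
  "ell2 = {f. (\<lambda>k. (cmod (f k))\<^sup>2) summable_on UNIV}"

definition ell2_inner :: "(int ^ 'n \<Rightarrow> complex) \<Rightarrow> (int ^ 'n \<Rightarrow> complex) \<Rightarrow> complex" where
  "ell2_inner f g = (\<Sum>\<^sub>\<infinity>k\<in>UNIV. f k * cnj (g k))"

definition ell2_norm :: "(int ^ 'n \<Rightarrow> complex) \<Rightarrow> real" where
  "ell2_norm f = sqrt (\<Sum>\<^sub>\<infinity>k\<in>UNIV. (cmod (f k))\<^sup>2)"

definition torus_character :: "int ^ 'n \<Rightarrow> real ^ 'n \<Rightarrow> complex" where
  "torus_character k \<xi> = exp (2 * of_real pi * \<i> * of_real (\<Sum>j\<in>UNIV. of_int (k $ j) * \<xi> $ j))"

definition fourier :: "(int ^ 'n \<Rightarrow> complex) \<Rightarrow> (real ^ 'n \<Rightarrow> complex)" where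
  "fourier f =
     (SOME g. g \<in> L2 torus \<and>
        L2_tendsto (\<lambda>K \<xi>. \<Sum>k\<in>K. f k * torus_character k \<xi>) g (finite_subsets_at_top UNIV))"

definition fourier_inv :: "(real ^ 'n \<Rightarrow> complex) \<Rightarrow> (int ^ 'n \<Rightarrow> complex)" where
  "fourier_inv g = (THE f. f \<in> ell2 \<and> L2_eq (fourier f) g)"


section \<open>Paley--Wiener spaces of the lattice graph\<close>

definition laplacian_symbol :: "real ^ 'n \<Rightarrow> real" where
  "laplacian_symbol \<xi> = 2 / real CARD('n) * (\<Sum>j\<in>UNIV. (sin (pi * \<xi> $ j))\<^sup>2)"

definition Omega :: "real \<Rightarrow> (real ^ 'n) set" where
  "Omega \<omega> = {\<xi> \<in> torus. laplacian_symbol \<xi> \<le> \<omega>}"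

definition GPW :: "real \<Rightarrow> (int ^ 'n \<Rightarrow> complex) set" where
  "GPW \<omega> = {f \<in> ell2. fourier f \<in> L2 (Omega \<omega>)}"


section \<open>Frames and uniformly separated sequences\<close>

text \<open>Frames for a closed subspace \<open>H\<close> of \<open>\<ell>\<^sup>2\<close>.\<close>

definition ell2_frame_for ::
    "(int ^ 'n \<Rightarrow> complex) set \<Rightarrow> (nat \<Rightarrow> int ^ 'n \<Rightarrow> complex) \<Rightarrow> bool" where
  "ell2_frame_for H v \<longleftrightarrow>
     (\<forall>k. v k \<in> H) \<and>
     (\<exists>A>0. \<exists>B>0. \<forall>f\<in>H.
        summable (\<lambda>k. (cmod (ell2_inner f (v k)))\<^sup>2) \<and>
        A * (ell2_norm f)\<^sup>2 \<le> (\<Sum>k. (cmod (ell2_inner f (v k)))\<^sup>2) \<and>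
        (\<Sum>k. (cmod (ell2_inner f (v k)))\<^sup>2) \<le> B * (ell2_norm f)\<^sup>2)"

text \<open>For points of the unit disc the partial products below decrease, so the limit exists.
  It is used in place of \<open>prodinf\<close>, which is not the limit for products diverging to \<open>0\<close>.\<close>

definition uniformly_separated :: "(nat \<Rightarrow> complex) \<Rightarrow> bool" where
  "uniformly_separated lam \<longleftrightarrow>
     (\<forall>j. cmod (lam j) < 1) \<and>
     (INF j. lim (\<lambda>N. \<Prod>k\<in>{..<N} - {j}. cmod ((lam j - lam k) / (1 - cnj (lam k) * lam j)))) > 0"

definition comparable_seq :: "(nat \<Rightarrow> real) \<Rightarrow> (nat \<Rightarrow> real) \<Rightarrow> bool" where
  "comparable_seq a b \<longleftrightarrow> (\<exists>c>0. \<exists>C>0. \<forall>j. c * a j \<le> b j \<and> b j \<le> C * a j)"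

end

theory Submission
  imports Defs "HOL-Complex_Analysis.Complex_Analysis"
begin

text \<open>
  Let \<open>\<Omega>\<close> be the frequency set of the Paley--Wiener space. The Fourier transform identifies that
  space with \<open>L\<^sup>2(\<Omega>)\<close>, and \<open>S\<close> is a bounded bijection from \<open>L\<^sup>2(\<Omega>)\<close> onto \<open>L\<^sup>2(D)\<close> because the Jacobian of
  \<open>P\<close> is bounded above and below. These maps turn the orbit \<open>R\<^sup>k f\<^sub>0\<close> into \<open>S\<^sup>-\<^sup>1 T\<^sup>k h\<^sub>0\<close>, and
  \<open>\<langle>f, R\<^sup>k f\<^sub>0\<rangle> = \<langle>G, T\<^sup>k h\<^sub>0\<rangle>\<close>, where \<open>G\<close> is the image of the Fourier transform of \<open>f\<close> under the adjoint
  of \<open>S\<^sup>-\<^sup>1\<close> and has comparable norm (\<open>adjoint_exists\<close>). So only the frame property of \<open>T\<^sup>k h\<^sub>0\<close> in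
  \<open>L\<^sup>2(D)\<close> is at stake. In the coordinates of the basis \<open>\<psi>\<close>, with \<open>G\<^sub>j\<close> and \<open>h\<^sub>j\<close> the coefficients of \<open>G\<close> and
  \<open>h\<^sub>0\<close>, it says that
  \<open>\<Sum>\<^sub>k \<bar>\<Sum>\<^sub>j cnj G\<^sub>j h\<^sub>j \<lambda>\<^sub>j\<^sup>k\<bar>\<^sup>2\<close> is comparable to \<open>\<Sum>\<^sub>j \<bar>G\<^sub>j\<bar>\<^sup>2\<close>: since \<open>\<bar>h\<^sub>j\<bar>\<^sup>2\<close> is comparable to
  \<open>1 - \<bar>\<lambda>\<^sub>j\<bar>\<^sup>2\<close>, the normalized reproducing kernels of the Hardy space at the points \<open>\<lambda>\<^sub>j\<close> have to form
  a Riesz sequence (\<open>Carleson_frame_bounds\<close>).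

  For uniformly separated points this is the theorem of Carleson and of Shapiro and Shields. Peter
  Jones's explicit formula gives, for finitely many of the points and any values of modulus at most
  one, an analytic function with these values at the points and a bound depending only on the
  separation constant (\<open>interpolation_bounded\<close>). Multiplication by a bounded analytic function is
  bounded on the Hardy space, and its adjoint multiplies each reproducing kernel by the conjugate
  of the value there (\<open>multiplier_bound\<close>). Hence the kernels are an unconditional sequence: changing
  signs of coefficients changes norms only by a bounded factor. By the parallelogram law some
  choices of signs make the norm at most, and others at least, what it would be for orthogonal
  vectors, and so both Riesz bounds follow at once (\<open>finite_Riesz_bounds\<close>).

  That the Fourier transform is onto \<open>L\<^sup>2\<close> rests on the Riesz--Fischer theorem (\<open>L2_complete\<close>) and on the
  completeness of the characters (\<open>characters_total\<close>), which comes from the Stone--Weierstrass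
  theorem. The transformation formula for \<open>P\<close> (\<open>torus_change_of_variables\<close>) is obtained by cutting the
  smooth pieces once more, according to which faces of the cube the image point lies on: on such a
  piece \<open>P\<close> has no jumps and the formula in Euclidean space applies.
\<close>

no_notation fps_nth (infixl \<open>$\<close> 75)

section \<open>Square-integrable functions: algebra and completeness\<close>

lemma torus_measurable [measurable]: "torus \<in> sets (borel :: (real ^ 'n) measure)"
proof -
  have "torus = (\<Inter>j. {\<xi> :: real ^ 'n. - 1 / 2 \<le> \<xi> $ j} \<inter> {\<xi>. \<xi> $ j < 1 / 2})"
    by (auto simp: torus_def)
  also have "\<dots> \<in> sets borel"
    by (intro sets.countable_INT'' sets.Int) (auto intro!: borel_closed borel_open closed_Collect_le open_Collect_less continuous_intros)
  finally show ?thesis .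
qed

lemma torus_lebesgue: "(torus :: (real ^ 'n) set) \<in> sets lebesgue"
  using torus_measurable by auto

lemma bounded_torus: "bounded (torus :: (real ^ 'n) set)"
proof (rule bounded_subset)
  show "bounded (cbox (\<chi> j. - 1 / 2) (\<chi> j. 1 / 2) :: (real ^ 'n) set)" by simp
  show "(torus :: (real ^ 'n) set) \<subseteq> cbox (\<chi> j. - 1 / 2) (\<chi> j. 1 / 2)"
    by (auto simp: torus_def mem_box_cart less_imp_le)
qed

lemma torus_lmeasurable: "(torus :: (real ^ 'n) set) \<in> lmeasurable"
  by (simp add: bounded_set_imp_lmeasurable bounded_torus torus_lebesgue)

lemma finite_measure_torus: "finite_measure (torus_measure :: (real ^ 'n) measure)"
  by (rule finite_measure_lebesgue_on) (rule torus_lmeasurable)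

lemma L2_torus_iff:
  "g \<in> L2 torus \<longleftrightarrow> g \<in> borel_measurable torus_measure \<and> integrable torus_measure (\<lambda>\<xi>. (cmod (g \<xi>))\<^sup>2)"
  by (auto simp: L2_def)

lemma L2_subset_torus: "g \<in> L2 E \<Longrightarrow> g \<in> L2 torus"
  by (auto simp: L2_def)

lemma L2_measurable: "g \<in> L2 E \<Longrightarrow> g \<in> borel_measurable torus_measure"
  by (auto simp: L2_def)

lemma L2_integrable_sq: "g \<in> L2 E \<Longrightarrow> integrable torus_measure (\<lambda>\<xi>. (cmod (g \<xi>))\<^sup>2)"
  by (auto simp: L2_def)

lemma L2_AE_zero: "g \<in> L2 E \<Longrightarrow> AE \<xi> in torus_measure. \<xi> \<notin> E \<longrightarrow> g \<xi> = 0"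
  by (auto simp: L2_def)

lemma L2_scale: assumes "g \<in> L2 E" shows "(\<lambda>\<xi>. a * g \<xi>) \<in> L2 E"
proof -
  have "integrable torus_measure (\<lambda>\<xi>. (cmod a)\<^sup>2 * (cmod (g \<xi>))\<^sup>2)"
    using L2_integrable_sq[OF assms] by simp
  moreover have "AE \<xi> in torus_measure. \<xi> \<notin> E \<longrightarrow> a * g \<xi> = 0"
    using L2_AE_zero[OF assms] by eventually_elim auto
  ultimately show ?thesis
    using L2_measurable[OF assms] by (simp add: L2_def norm_mult power_mult_distrib)
qed

lemma L2_add: assumes g: "g \<in> L2 E" and h: "h \<in> L2 E" shows "(\<lambda>\<xi>. g \<xi> + h \<xi>) \<in> L2 E"
proof -
  note [measurable] = L2_measurable[OF g] L2_measurable[OF h]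
  have int: "integrable torus_measure (\<lambda>\<xi>. 2 * (cmod (g \<xi>))\<^sup>2 + 2 * (cmod (h \<xi>))\<^sup>2)"
    using L2_integrable_sq[OF g] L2_integrable_sq[OF h] by simp
  have *: "(cmod (a + b))\<^sup>2 \<le> 2 * (cmod a)\<^sup>2 + 2 * (cmod b)\<^sup>2" for a b
  proof -
    have "(cmod (a + b))\<^sup>2 \<le> (cmod a + cmod b)\<^sup>2"
      by (intro power_mono norm_triangle_ineq) auto
    also have "\<dots> \<le> 2 * (cmod a)\<^sup>2 + 2 * (cmod b)\<^sup>2"
      using sum_squares_bound[of "cmod a" "cmod b"] by (simp add: power2_sum)
    finally show ?thesis .
  qed
  have "integrable torus_measure (\<lambda>\<xi>. (cmod (g \<xi> + h \<xi>))\<^sup>2)"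
    by (rule Bochner_Integration.integrable_bound[OF int]) (auto intro!: AE_I2 order_trans[OF *])
  moreover have "AE \<xi> in torus_measure. \<xi> \<notin> E \<longrightarrow> g \<xi> + h \<xi> = 0"
    using L2_AE_zero[OF g] L2_AE_zero[OF h] by eventually_elim auto
  ultimately show ?thesis by (simp add: L2_def)
qed

lemma L2_uminus: "g \<in> L2 E \<Longrightarrow> (\<lambda>\<xi>. - g \<xi>) \<in> L2 E"
  using L2_scale[of g E "-1"] by simp

lemma L2_diff: "g \<in> L2 E \<Longrightarrow> h \<in> L2 E \<Longrightarrow> (\<lambda>\<xi>. g \<xi> - h \<xi>) \<in> L2 E"
  using L2_add[OF _ L2_uminus, of g E h] by simp

lemma L2_zero: "(\<lambda>\<xi>. 0) \<in> L2 E"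
  by (simp add: L2_def)

lemma L2_sum: "(\<And>i. i \<in> I \<Longrightarrow> g i \<in> L2 E) \<Longrightarrow> (\<lambda>\<xi>. \<Sum>i\<in>I. g i \<xi>) \<in> L2 E"
  by (induction I rule: infinite_finite_induct) (auto intro: L2_zero L2_add)

lemma L2_one: "(\<lambda>\<xi>. 1) \<in> L2 torus"
  using finite_measure.integrable_const[OF finite_measure_torus] by (simp add: L2_torus_iff)

lemma L2_support_cong:
  assumes "g \<in> L2 E" "L2_eq h g" "h \<in> L2 torus" shows "h \<in> L2 E"
proof -
  have "AE \<xi> in torus_measure. \<xi> \<notin> E \<longrightarrow> h \<xi> = 0"
    using L2_AE_zero[OF assms(1)] assms(2)[unfolded L2_eq_def] by eventually_elim auto
  then show ?thesis using assms(3) by (simp add: L2_def)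
qed

lemma L2_eq_trans: assumes "L2_eq f g" "L2_eq g h" shows "L2_eq f h"
  using assms[unfolded L2_eq_def] unfolding L2_eq_def by eventually_elim simp

lemma borel_measurable_cnj [measurable]: "cnj \<in> borel_measurable borel"
  by (intro borel_measurable_continuous_onI continuous_intros)

lemma L2_integrable_product:
  assumes g: "g \<in> L2 E" and h: "h \<in> L2 F"
  shows "integrable torus_measure (\<lambda>\<xi>. g \<xi> * cnj (h \<xi>))"
    and "integrable torus_measure (\<lambda>\<xi>. cmod (g \<xi>) * cmod (h \<xi>))"
proof -
  note [measurable] = L2_measurable[OF g] L2_measurable[OF h]
  have i: "integrable torus_measure (\<lambda>\<xi>. (cmod (g \<xi>))\<^sup>2 + (cmod (h \<xi>))\<^sup>2)"
    using L2_integrable_sq[OF g] L2_integrable_sq[OF h] by simp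
  have *: "cmod a * cmod b \<le> (cmod a)\<^sup>2 + (cmod b)\<^sup>2" for a b
    using sum_squares_bound[of "cmod a" "cmod b"] mult_nonneg_nonneg[of "cmod a" "cmod b", OF norm_ge_zero norm_ge_zero]
    unfolding mult.assoc by linarith
  show "integrable torus_measure (\<lambda>\<xi>. g \<xi> * cnj (h \<xi>))"
    by (rule Bochner_Integration.integrable_bound[OF i]) (auto simp: norm_mult intro!: AE_I2 order_trans[OF *])
  show "integrable torus_measure (\<lambda>\<xi>. cmod (g \<xi>) * cmod (h \<xi>))"
    by (rule Bochner_Integration.integrable_bound[OF i]) (auto simp: norm_mult intro!: AE_I2 order_trans[OF *])
qed

lemma L2_inner_add_left:
  "g \<in> L2 E \<Longrightarrow> g' \<in> L2 E' \<Longrightarrow> h \<in> L2 F \<Longrightarrow> L2_inner (\<lambda>\<xi>. g \<xi> + g' \<xi>) h = L2_inner g h + L2_inner g' h"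
  by (simp add: L2_inner_def ring_distribs Bochner_Integration.integral_add[OF L2_integrable_product(1) L2_integrable_product(1)])

lemma L2_inner_diff_left:
  "g \<in> L2 E \<Longrightarrow> g' \<in> L2 E' \<Longrightarrow> h \<in> L2 F \<Longrightarrow> L2_inner (\<lambda>\<xi>. g \<xi> - g' \<xi>) h = L2_inner g h - L2_inner g' h"
  by (simp add: L2_inner_def ring_distribs Bochner_Integration.integral_diff[OF L2_integrable_product(1) L2_integrable_product(1)])

lemma L2_inner_scale_left: "L2_inner (\<lambda>\<xi>. a * g \<xi>) h = a * L2_inner g h"
  by (simp add: L2_inner_def mult.assoc)

lemma L2_inner_commute: "L2_inner g h = cnj (L2_inner h g)"
  by (simp add: L2_inner_def mult.commute flip: Bochner_Integration.integral_cnj)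

lemma L2_inner_sum_left:
  "(\<And>i. i \<in> I \<Longrightarrow> g i \<in> L2 E) \<Longrightarrow> h \<in> L2 F \<Longrightarrow>
     L2_inner (\<lambda>\<xi>. \<Sum>i\<in>I. a i * g i \<xi>) h = (\<Sum>i\<in>I. a i * L2_inner (g i) h)"
  unfolding L2_inner_def sum_distrib_right mult.assoc
  by (subst Bochner_Integration.integral_sum) (auto intro!: integrable_mult_right L2_integrable_product(1))

lemma L2_inner_cong_left:
  assumes "L2_eq g g'" "g \<in> L2 E" "g' \<in> L2 E'" "h \<in> L2 F" shows "L2_inner g h = L2_inner g' h"
proof -
  note [measurable] = L2_measurable[OF assms(2)] L2_measurable[OF assms(3)] L2_measurable[OF assms(4)]
  show ?thesis
    unfolding L2_inner_def
    by (rule integral_cong_AE) (use assms(1) in \<open>auto simp: L2_eq_def elim: eventually_mono\<close>)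
qed

lemma L2_norm_nonneg [simp]: "0 \<le> L2_norm g"
  by (simp add: L2_norm_def)

lemma L2_norm_sq: "(L2_norm g)\<^sup>2 = (LINT \<xi>|torus_measure. (cmod (g \<xi>))\<^sup>2)"
  by (simp add: L2_norm_def)

lemma L2_inner_self: "L2_inner g g = of_real ((L2_norm g)\<^sup>2)"
  unfolding L2_norm_sq L2_inner_def complex_norm_square[symmetric]
  by (simp flip: Bochner_Integration.integral_complex_of_real of_real_power)

lemma L2_norm_cong:
  assumes "L2_eq g g'" "g \<in> L2 E" "g' \<in> L2 E'" shows "L2_norm g = L2_norm g'"
proof -
  note [measurable] = L2_measurable[OF assms(2)] L2_measurable[OF assms(3)]
  show ?thesis
    unfolding L2_norm_def
    by (rule arg_cong[where f = sqrt], rule integral_cong_AE)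
      (use assms(1) in \<open>auto simp: L2_eq_def elim: eventually_mono\<close>)
qed

lemma L2_norm_minus_commute: "L2_norm (\<lambda>\<xi>. g \<xi> - h \<xi>) = L2_norm (\<lambda>\<xi>. h \<xi> - g \<xi>)"
  by (simp add: L2_norm_def norm_minus_commute)

lemma L2_norm_eq_0:
  assumes "g \<in> L2 E" "L2_norm g = 0" shows "L2_eq g (\<lambda>\<xi>. 0)"
proof -
  have "(LINT \<xi>|torus_measure. (cmod (g \<xi>))\<^sup>2) = 0" using assms(2) L2_norm_sq[of g] by simp
  then have "AE \<xi> in torus_measure. (cmod (g \<xi>))\<^sup>2 = 0"
    using integral_nonneg_eq_0_iff_AE[OF L2_integrable_sq[OF assms(1)]] by auto
  then show ?thesis by (auto simp: L2_eq_def elim: eventually_mono)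
qed

text \<open>Integrating \<open>2 a b \<le> t a\<^sup>2 + b\<^sup>2 / t\<close> and choosing \<open>t\<close> as the quotient of the two norms gives the
  inequality; each norm is first increased by a small \<open>e\<close>, as it may vanish.\<close>

lemma L2_Cauchy_Schwarz_abs:
  assumes g: "g \<in> L2 E" and h: "h \<in> L2 F"
  shows "(LINT \<xi>|torus_measure. cmod (g \<xi>) * cmod (h \<xi>)) \<le> L2_norm g * L2_norm h"
proof -
  define X where "X = (LINT \<xi>|torus_measure. cmod (g \<xi>) * cmod (h \<xi>))"
  define G H where "G = L2_norm g" and "H = L2_norm h"
  have GH: "G \<ge> 0" "H \<ge> 0" by (auto simp: G_def H_def)
  have X: "2 * X \<le> t * G\<^sup>2 + H\<^sup>2 / t" if "t > 0" for t
  proof -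
    have "2 * X = (LINT \<xi>|torus_measure. 2 * (cmod (g \<xi>) * cmod (h \<xi>)))"
      by (simp add: X_def)
    also have "\<dots> \<le> (LINT \<xi>|torus_measure. t * (cmod (g \<xi>))\<^sup>2 + (cmod (h \<xi>))\<^sup>2 / t)"
    proof (rule integral_mono)
      show "integrable torus_measure (\<lambda>\<xi>. 2 * (cmod (g \<xi>) * cmod (h \<xi>)))"
        using L2_integrable_product(2)[OF g h] by simp
      show "integrable torus_measure (\<lambda>\<xi>. t * (cmod (g \<xi>))\<^sup>2 + (cmod (h \<xi>))\<^sup>2 / t)"
        using L2_integrable_sq[OF g] L2_integrable_sq[OF h] by simp
      show "2 * (cmod (g \<xi>) * cmod (h \<xi>)) \<le> t * (cmod (g \<xi>))\<^sup>2 + (cmod (h \<xi>))\<^sup>2 / t" for \<xi>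
      proof -
        have "0 \<le> (sqrt t * cmod (g \<xi>) - cmod (h \<xi>) / sqrt t)\<^sup>2" by simp
        also have "\<dots> = t * (cmod (g \<xi>))\<^sup>2 + (cmod (h \<xi>))\<^sup>2 / t - 2 * (cmod (g \<xi>) * cmod (h \<xi>))"
          using that by (simp add: power2_diff power_mult_distrib power_divide)
        finally show ?thesis by simp
      qed
    qed
    also have "\<dots> = t * G\<^sup>2 + H\<^sup>2 / t"
      using L2_integrable_sq[OF g] L2_integrable_sq[OF h] by (simp add: G_def H_def L2_norm_sq)
    finally show ?thesis .
  qed
  have ub: "2 * X \<le> (H + e) * G + H * (G + e)" if e: "e > 0" for e
  proof -
    have "2 * X \<le> (H + e) / (G + e) * G\<^sup>2 + H\<^sup>2 / ((H + e) / (G + e))"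
      using GH e by (intro X) (simp add: add_nonneg_pos)
    also have "(H + e) / (G + e) * G\<^sup>2 = (H + e) * G * (G / (G + e))" by (simp add: power2_eq_square)
    also have "\<dots> \<le> (H + e) * G * 1"
      using GH e by (intro mult_left_mono) (auto simp: divide_le_eq_1)
    also have "H\<^sup>2 / ((H + e) / (G + e)) = H * (G + e) * (H / (H + e))" by (simp add: power2_eq_square)
    also have "\<dots> \<le> H * (G + e) * 1"
      using GH e by (intro mult_left_mono) (auto simp: divide_le_eq_1)
    finally show ?thesis by simp
  qed
  have "((\<lambda>e. (H + e) * G + H * (G + e)) \<longlongrightarrow> (H + 0) * G + H * (G + 0)) (at_right 0)"
    by (intro tendsto_intros)
  moreover have "\<forall>\<^sub>F e in at_right 0. 2 * X \<le> (H + e) * G + H * (G + e)"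
    using eventually_at_right_less by eventually_elim (rule ub)
  ultimately have "2 * X \<le> (H + 0) * G + H * (G + 0)"
    by (rule tendsto_lowerbound) simp
  then show ?thesis unfolding X_def[symmetric] G_def[symmetric] H_def[symmetric] by (simp add: mult.commute)
qed

lemma L2_Cauchy_Schwarz:
  assumes g: "g \<in> L2 E" and h: "h \<in> L2 F"
  shows "cmod (L2_inner g h) \<le> L2_norm g * L2_norm h"
proof -
  have "cmod (L2_inner g h) \<le> (LINT \<xi>|torus_measure. cmod (g \<xi> * cnj (h \<xi>)))"
    unfolding L2_inner_def by (rule integral_norm_bound)
  then show ?thesis using L2_Cauchy_Schwarz_abs[OF g h] by (simp add: norm_mult)
qed

lemma L2_norm_add_sq:
  assumes g: "g \<in> L2 E" and h: "h \<in> L2 E"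
  shows "(L2_norm (\<lambda>\<xi>. g \<xi> + h \<xi>))\<^sup>2 = (L2_norm g)\<^sup>2 + (L2_norm h)\<^sup>2 + 2 * Re (L2_inner g h)"
proof -
  have "complex_of_real ((L2_norm (\<lambda>\<xi>. g \<xi> + h \<xi>))\<^sup>2) = L2_inner (\<lambda>\<xi>. g \<xi> + h \<xi>) (\<lambda>\<xi>. g \<xi> + h \<xi>)"
    by (simp add: L2_inner_self)
  also have "\<dots> = L2_inner g (\<lambda>\<xi>. g \<xi> + h \<xi>) + L2_inner h (\<lambda>\<xi>. g \<xi> + h \<xi>)"
    by (rule L2_inner_add_left[OF g h L2_add[OF g h]])
  also have "\<dots> = cnj (L2_inner g g + L2_inner h g) + cnj (L2_inner g h + L2_inner h h)"
    by (subst (1 2) L2_inner_commute) (simp add: L2_inner_add_left[OF g h g] L2_inner_add_left[OF g h h])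
  also have "\<dots> = of_real ((L2_norm g)\<^sup>2 + (L2_norm h)\<^sup>2 + 2 * Re (L2_inner g h))"
    using L2_inner_commute[of h g] by (simp add: L2_inner_self complex_eq_iff)
  finally show ?thesis by (simp only: of_real_eq_iff)
qed

lemma L2_norm_triangle:
  assumes g: "g \<in> L2 E" and h: "h \<in> L2 E"
  shows "L2_norm (\<lambda>\<xi>. g \<xi> + h \<xi>) \<le> L2_norm g + L2_norm h"
proof (rule power2_le_imp_le)
  have "Re (L2_inner g h) \<le> L2_norm g * L2_norm h"
    using L2_Cauchy_Schwarz[OF g h] complex_Re_le_cmod[of "L2_inner g h"] by linarith
  then show "(L2_norm (\<lambda>\<xi>. g \<xi> + h \<xi>))\<^sup>2 \<le> (L2_norm g + L2_norm h)\<^sup>2"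
    by (simp add: L2_norm_add_sq[OF g h] power2_sum)
qed simp

lemma L2_norm_triangle_diff:
  assumes "f \<in> L2 E" "g \<in> L2 E" "h \<in> L2 E"
  shows "L2_norm (\<lambda>\<xi>. f \<xi> - h \<xi>) \<le> L2_norm (\<lambda>\<xi>. f \<xi> - g \<xi>) + L2_norm (\<lambda>\<xi>. g \<xi> - h \<xi>)"
  using L2_norm_triangle[OF L2_diff[OF assms(1,2)] L2_diff[OF assms(2,3)]] by simp

lemma L2_tendsto_inner:
  assumes t: "L2_tendsto u g F" and u: "\<And>i. u i \<in> L2 E" and g: "g \<in> L2 E" and h: "h \<in> L2 E'"
  shows "((\<lambda>i. L2_inner (u i) h) \<longlongrightarrow> L2_inner g h) F"
proof (rule Lim_null_comparison[THEN LIM_zero_cancel])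
  show "\<forall>\<^sub>F i in F. cmod (L2_inner (u i) h - L2_inner g h) \<le> L2_norm (\<lambda>\<xi>. u i \<xi> - g \<xi>) * L2_norm h"
    using L2_Cauchy_Schwarz[OF L2_diff[OF u g] h] by (simp add: L2_inner_diff_left[OF u g h])
  show "((\<lambda>i. L2_norm (\<lambda>\<xi>. u i \<xi> - g \<xi>) * L2_norm h) \<longlongrightarrow> 0) F"
    using tendsto_mult_left_zero[OF t[unfolded L2_tendsto_def]] .
qed

text \<open>Riesz--Fischer, for Cauchy families along an arbitrary filter: a subsequence converging fast in
  \<open>L\<^sup>1\<close> converges almost everywhere, and Fatou's lemma identifies its limit in \<open>L\<^sup>2\<close>.\<close>

lemma L2_complete:
  fixes u :: "'i \<Rightarrow> real ^ 'n \<Rightarrow> complex"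
  assumes F: "F \<noteq> bot" and u: "\<And>i. u i \<in> L2 E"
    and Cauchy: "\<And>e. e > 0 \<Longrightarrow> \<exists>P. eventually P F \<and> (\<forall>i j. P i \<longrightarrow> P j \<longrightarrow> L2_norm (\<lambda>\<xi>. u i \<xi> - u j \<xi>) \<le> e)"
  obtains g where "g \<in> L2 E" "L2_tendsto u g F"
proof -
  define e where "e n = (1 / 2 :: real) ^ n" for n
  have e: "e n > 0" for n by (simp add: e_def)
  from Cauchy[OF e] obtain P where P: "\<And>n. eventually (P n) F"
    "\<And>n i j. P n i \<Longrightarrow> P n j \<Longrightarrow> L2_norm (\<lambda>\<xi>. u i \<xi> - u j \<xi>) \<le> e n" by metis
  have "eventually (\<lambda>i. \<forall>m\<in>{..n}. P m i) F" for n
    using P(1) by (intro eventually_ball_finite) auto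
  then have "\<exists>i. \<forall>m\<in>{..n}. P m i" for n
    using F by (auto dest!: eventually_happens)
  then obtain \<iota> where \<iota>: "\<And>n m. m \<le> n \<Longrightarrow> P m (\<iota> n)" by (metis atMost_iff)
  define v where "v n = u (\<iota> n)" for n
  have v: "v n \<in> L2 E" for n by (simp add: v_def u)
  have v_dist: "L2_norm (\<lambda>\<xi>. v n \<xi> - v m \<xi>) \<le> e n" if "n \<le> m" for n m
    unfolding v_def by (rule P(2)) (auto intro: \<iota> that)
  note [measurable] = L2_measurable[OF v]
  define K where "K = L2_norm (\<lambda>\<xi> :: real ^ 'n. 1)"
  have step: "(\<integral>\<^sup>+ \<xi>. ennreal (cmod (v (Suc n) \<xi> - v n \<xi>)) \<partial>torus_measure) \<le> ennreal (e n * K)" for n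
  proof -
    have d: "(\<lambda>\<xi>. v (Suc n) \<xi> - v n \<xi>) \<in> L2 E" by (rule L2_diff[OF v v])
    have int: "integrable torus_measure (\<lambda>\<xi>. cmod (v (Suc n) \<xi> - v n \<xi>))"
      using L2_integrable_product(2)[OF d L2_one] by simp
    have "(LINT \<xi>|torus_measure. cmod (v (Suc n) \<xi> - v n \<xi>)) \<le> L2_norm (\<lambda>\<xi>. v (Suc n) \<xi> - v n \<xi>) * K"
      using L2_Cauchy_Schwarz_abs[OF d L2_one] by (simp add: K_def)
    also have "\<dots> \<le> e n * K"
      using v_dist[of n "Suc n"] by (intro mult_right_mono) (auto simp: K_def L2_norm_minus_commute)
    finally show ?thesis by (subst nn_integral_eq_integral[OF int]) (auto simp: ennreal_leI)
  qed
  have "(\<integral>\<^sup>+ \<xi>. (\<Sum>n. ennreal (cmod (v (Suc n) \<xi> - v n \<xi>))) \<partial>torus_measure)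
      = (\<Sum>n. \<integral>\<^sup>+ \<xi>. ennreal (cmod (v (Suc n) \<xi> - v n \<xi>)) \<partial>torus_measure)"
    by (rule nn_integral_suminf) measurable
  also have "\<dots> \<le> (\<Sum>n. ennreal (e n * K))"
    by (intro suminf_le step) auto
  also have "\<dots> < \<infinity>"
  proof -
    have "summable (\<lambda>n. e n * K)" unfolding e_def by (intro summable_mult2 summable_geometric) auto
    then have "(\<Sum>n. ennreal (e n * K)) = ennreal (\<Sum>n. e n * K)"
      by (intro suminf_ennreal2) (auto simp: K_def e_def)
    then show ?thesis by simp
  qed
  finally have "AE \<xi> in torus_measure. (\<Sum>n. ennreal (cmod (v (Suc n) \<xi> - v n \<xi>))) \<noteq> \<infinity>"
    by (intro nn_integral_PInf_AE) auto
  then have AE_conv: "AE \<xi> in torus_measure. convergent (\<lambda>n. v n \<xi>)"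
  proof eventually_elim
    case (elim \<xi>)
    have "summable (\<lambda>n. cmod (v (Suc n) \<xi> - v n \<xi>))"
      by (rule summable_suminf_not_top) (use elim in auto)
    then have "summable (\<lambda>n. v (Suc n) \<xi> - v n \<xi>)" by (rule summable_norm_cancel)
    then have "convergent (\<lambda>n. \<Sum>i<n. v (Suc i) \<xi> - v i \<xi>)" by (simp add: summable_iff_convergent)
    then have "convergent (\<lambda>n. v n \<xi> - v 0 \<xi>)"
      using sum_lessThan_telescope[of "\<lambda>i. v i \<xi>"] by simp
    from convergent_add[OF this convergent_const[of "v 0 \<xi>"]] show ?case by simp
  qed
  define g where "g \<xi> = lim (\<lambda>n. v n \<xi>)" for \<xi>
  have g_meas [measurable]: "g \<in> borel_measurable torus_measure"
    unfolding g_def by measurable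
  have v_g: "(LINT \<xi>|torus_measure. (cmod (v n \<xi> - g \<xi>))\<^sup>2) \<le> (e n)\<^sup>2 \<and>
      integrable torus_measure (\<lambda>\<xi>. (cmod (v n \<xi> - g \<xi>))\<^sup>2)" for n
  proof -
    have "(\<integral>\<^sup>+ \<xi>. ennreal ((cmod (v n \<xi> - g \<xi>))\<^sup>2) \<partial>torus_measure)
        = (\<integral>\<^sup>+ \<xi>. liminf (\<lambda>m. ennreal ((cmod (v n \<xi> - v m \<xi>))\<^sup>2)) \<partial>torus_measure)"
    proof (rule nn_integral_cong_AE)
      show "AE \<xi> in torus_measure. ennreal ((cmod (v n \<xi> - g \<xi>))\<^sup>2) = liminf (\<lambda>m. ennreal ((cmod (v n \<xi> - v m \<xi>))\<^sup>2))"
        using AE_conv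
      proof eventually_elim
        case (elim \<xi>)
        then have "(\<lambda>m. v m \<xi>) \<longlonglongrightarrow> g \<xi>" by (simp add: g_def convergent_LIMSEQ_iff)
        then have "(\<lambda>m. ennreal ((cmod (v n \<xi> - v m \<xi>))\<^sup>2)) \<longlonglongrightarrow> ennreal ((cmod (v n \<xi> - g \<xi>))\<^sup>2)"
          by (intro tendsto_ennrealI tendsto_intros)
        from lim_imp_Liminf[OF sequentially_bot this] show ?case by (rule sym)
      qed
    qed
    also have "\<dots> \<le> liminf (\<lambda>m. \<integral>\<^sup>+ \<xi>. ennreal ((cmod (v n \<xi> - v m \<xi>))\<^sup>2) \<partial>torus_measure)"
      by (rule nn_integral_liminf) measurable
    also have "\<dots> \<le> liminf (\<lambda>m :: nat. ennreal ((e n)\<^sup>2))"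
    proof (rule Liminf_mono)
      show "\<forall>\<^sub>F m in sequentially. (\<integral>\<^sup>+ \<xi>. ennreal ((cmod (v n \<xi> - v m \<xi>))\<^sup>2) \<partial>torus_measure) \<le> ennreal ((e n)\<^sup>2)"
        using eventually_ge_at_top[of n]
      proof eventually_elim
        case (elim m)
        have "(LINT \<xi>|torus_measure. (cmod (v n \<xi> - v m \<xi>))\<^sup>2) \<le> (e n)\<^sup>2"
          unfolding L2_norm_sq[symmetric] by (intro power_mono v_dist elim) simp
        then show ?case
          by (subst nn_integral_eq_integral[OF L2_integrable_sq[OF L2_diff[OF v v]]]) (auto simp: ennreal_leI)
      qed
    qed
    also have "\<dots> = ennreal ((e n)\<^sup>2)" by (simp add: Liminf_const)
    finally have fin: "(\<integral>\<^sup>+ \<xi>. ennreal ((cmod (v n \<xi> - g \<xi>))\<^sup>2) \<partial>torus_measure) \<le> ennreal ((e n)\<^sup>2)" .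
    have int: "integrable torus_measure (\<lambda>\<xi>. (cmod (v n \<xi> - g \<xi>))\<^sup>2)"
    proof (rule integrableI_bounded)
      show "(\<integral>\<^sup>+ \<xi>. ennreal (norm ((cmod (v n \<xi> - g \<xi>))\<^sup>2)) \<partial>torus_measure) < \<infinity>"
        using le_less_trans[OF fin ennreal_less_top] by simp
    qed measurable
    have "ennreal (LINT \<xi>|torus_measure. (cmod (v n \<xi> - g \<xi>))\<^sup>2) \<le> ennreal ((e n)\<^sup>2)"
      using fin by (subst (asm) nn_integral_eq_integral[OF int]) simp_all
    then show ?thesis
      using int by (subst (asm) ennreal_le_iff) simp_all
  qed
  have d_L2: "(\<lambda>\<xi>. v n \<xi> - g \<xi>) \<in> L2 torus" for n
    using v_g[of n] by (simp add: L2_torus_iff)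
  have "(\<lambda>\<xi>. v 0 \<xi> - (v 0 \<xi> - g \<xi>)) \<in> L2 torus"
    by (rule L2_diff[OF L2_subset_torus[OF v] d_L2])
  then have g_L2T: "g \<in> L2 torus" by simp
  have "AE \<xi> in torus_measure. \<forall>n. \<xi> \<notin> E \<longrightarrow> v n \<xi> = 0"
    using L2_AE_zero[OF v] by (subst AE_all_countable) auto
  then have "AE \<xi> in torus_measure. \<xi> \<notin> E \<longrightarrow> g \<xi> = 0"
    by eventually_elim (simp add: g_def)
  with g_L2T have g: "g \<in> L2 E" by (simp add: L2_def)
  have vg: "L2_norm (\<lambda>\<xi>. v n \<xi> - g \<xi>) \<le> e n" for n
  proof (rule power2_le_imp_le)
    show "(L2_norm (\<lambda>\<xi>. v n \<xi> - g \<xi>))\<^sup>2 \<le> (e n)\<^sup>2" using v_g[of n] by (simp add: L2_norm_sq)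
  qed (use e[of n] in simp)
  have "((\<lambda>i. L2_norm (\<lambda>\<xi>. u i \<xi> - g \<xi>)) \<longlongrightarrow> 0) F"
  proof (rule order_tendstoI)
    fix a :: real assume "a < 0"
    then show "\<forall>\<^sub>F i in F. a < L2_norm (\<lambda>\<xi>. u i \<xi> - g \<xi>)"
      by (intro always_eventually allI) (rule less_le_trans[OF _ L2_norm_nonneg])
  next
    fix a :: real assume "0 < a"
    then obtain n where n: "e n < a / 2"
      using real_arch_pow_inv[of "a / 2" "1 / 2"] by (auto simp: e_def)
    show "\<forall>\<^sub>F i in F. L2_norm (\<lambda>\<xi>. u i \<xi> - g \<xi>) < a"
      using P(1)[of n]
    proof eventually_elim
      case (elim i)
      have "L2_norm (\<lambda>\<xi>. u i \<xi> - g \<xi>) \<le> L2_norm (\<lambda>\<xi>. u i \<xi> - v n \<xi>) + L2_norm (\<lambda>\<xi>. v n \<xi> - g \<xi>)"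
        by (rule L2_norm_triangle_diff[OF u v g])
      also have "\<dots> \<le> e n + e n"
        using P(2)[OF elim \<iota>[OF order_refl, of n]] vg[of n] by (simp add: v_def)
      finally show ?case using n by simp
    qed
  qed
  then show ?thesis using that[OF g] by (simp add: L2_tendsto_def)
qed


section \<open>Orthonormal families\<close>

text \<open>The index type is arbitrary: the family is the basis \<open>\<psi>\<close>, indexed by the naturals, or the
  characters, indexed by the lattice.\<close>

definition L2_orthonormal :: "(real ^ 'n) set \<Rightarrow> ('i \<Rightarrow> real ^ 'n \<Rightarrow> complex) \<Rightarrow> bool" where
  "L2_orthonormal E e \<longleftrightarrow> (\<forall>i. e i \<in> L2 E) \<and> (\<forall>i j. L2_inner (e i) (e j) = (if i = j then 1 else 0))"

lemma L2_orthonormal_in: "L2_orthonormal E e \<Longrightarrow> e i \<in> L2 E"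
  by (simp add: L2_orthonormal_def)

lemma L2_orthonormal_sum_in: "L2_orthonormal E e \<Longrightarrow> (\<lambda>\<xi>. \<Sum>i\<in>K. a i * e i \<xi>) \<in> L2 E"
  by (intro L2_sum L2_scale L2_orthonormal_in)

lemma L2_orthonormal_sum_inner:
  assumes "L2_orthonormal E e" "finite K"
  shows "L2_inner (\<lambda>\<xi>. \<Sum>i\<in>K. a i * e i \<xi>) (e j) = (if j \<in> K then a j else 0)"
proof -
  have "L2_inner (\<lambda>\<xi>. \<Sum>i\<in>K. a i * e i \<xi>) (e j) = (\<Sum>i\<in>K. a i * L2_inner (e i) (e j))"
    using L2_orthonormal_in[OF assms(1)] by (intro L2_inner_sum_left)
  also have "\<dots> = (\<Sum>i\<in>K. if i = j then a i else 0)"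
    using assms(1) by (intro sum.cong) (auto simp: L2_orthonormal_def)
  finally show ?thesis using assms(2) by simp
qed

lemma L2_orthonormal_sum_norm:
  assumes "L2_orthonormal E e" "finite K"
  shows "(L2_norm (\<lambda>\<xi>. \<Sum>i\<in>K. a i * e i \<xi>))\<^sup>2 = (\<Sum>i\<in>K. (cmod (a i))\<^sup>2)"
proof -
  let ?s = "\<lambda>\<xi>. \<Sum>i\<in>K. a i * e i \<xi>"
  have "of_real ((L2_norm ?s)\<^sup>2) = (\<Sum>i\<in>K. a i * L2_inner (e i) ?s)"
    unfolding L2_inner_self[symmetric]
    using L2_orthonormal_in[OF assms(1)] L2_orthonormal_sum_in[OF assms(1)] by (intro L2_inner_sum_left)
  also have "\<dots> = (\<Sum>i\<in>K. a i * cnj (a i))"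
    by (intro sum.cong refl) (subst L2_inner_commute, simp add: L2_orthonormal_sum_inner[OF assms])
  also have "\<dots> = of_real (\<Sum>i\<in>K. (cmod (a i))\<^sup>2)"
    by (simp only: of_real_sum complex_norm_square)
  finally show ?thesis by (simp only: of_real_eq_iff)
qed

text \<open>The squared distance from \<open>g\<close> to its partial expansion is the difference of the two sides.\<close>

lemma L2_Bessel:
  assumes e: "L2_orthonormal E e" and K: "finite K" and g: "g \<in> L2 torus"
  shows "(\<Sum>i\<in>K. (cmod (L2_inner g (e i)))\<^sup>2) \<le> (L2_norm g)\<^sup>2"
proof -
  let ?s = "\<lambda>\<xi>. \<Sum>i\<in>K. L2_inner g (e i) * e i \<xi>"
  have s: "?s \<in> L2 torus" by (rule L2_subset_torus, rule L2_orthonormal_sum_in[OF e])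
  have m: "(\<lambda>\<xi>. - ?s \<xi>) \<in> L2 torus" by (rule L2_uminus[OF s])
  have "L2_inner ?s g = (\<Sum>i\<in>K. L2_inner g (e i) * L2_inner (e i) g)"
    using L2_orthonormal_in[OF e] g by (intro L2_inner_sum_left)
  also have "\<dots> = (\<Sum>i\<in>K. L2_inner g (e i) * cnj (L2_inner g (e i)))"
    by (intro sum.cong refl) (subst (2) L2_inner_commute, simp)
  also have "\<dots> = of_real (\<Sum>i\<in>K. (cmod (L2_inner g (e i)))\<^sup>2)"
    by (simp only: of_real_sum complex_norm_square)
  finally have si: "L2_inner ?s g = of_real (\<Sum>i\<in>K. (cmod (L2_inner g (e i)))\<^sup>2)" .
  have "0 \<le> (L2_norm (\<lambda>\<xi>. - ?s \<xi> + g \<xi>))\<^sup>2" by simp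
  also have "\<dots> = (L2_norm (\<lambda>\<xi>. - ?s \<xi>))\<^sup>2 + (L2_norm g)\<^sup>2 + 2 * Re (L2_inner (\<lambda>\<xi>. - ?s \<xi>) g)"
    by (rule L2_norm_add_sq[OF m g])
  also have "L2_inner (\<lambda>\<xi>. - ?s \<xi>) g = - L2_inner ?s g"
    using L2_inner_scale_left[of "-1" ?s g] by simp
  also have "L2_norm (\<lambda>\<xi>. - ?s \<xi>) = L2_norm ?s"
    by (simp add: L2_norm_def)
  finally show ?thesis
    by (simp add: si L2_orthonormal_sum_norm[OF e K])
qed

lemma L2_series_exists:
  assumes e: "L2_orthonormal E e" and a: "(\<lambda>i. (cmod (a i))\<^sup>2) summable_on UNIV"
  obtains u where "u \<in> L2 E" "L2_tendsto (\<lambda>K \<xi>. \<Sum>i\<in>K. a i * e i \<xi>) u (finite_subsets_at_top UNIV)"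
proof (rule L2_complete)
  show "finite_subsets_at_top (UNIV :: 'b set) \<noteq> bot" by simp
  show "(\<lambda>\<xi>. \<Sum>i\<in>K. a i * e i \<xi>) \<in> L2 E" for K by (rule L2_orthonormal_sum_in[OF e])
next
  fix \<epsilon> :: real assume \<epsilon>: "\<epsilon> > 0"
  let ?S = "\<lambda>K \<xi>. \<Sum>i\<in>K. a i * e i \<xi>"
  obtain s where "((\<lambda>i. (cmod (a i))\<^sup>2) has_sum s) UNIV" using a by (auto simp: summable_on_def)
  then have lim: "(sum (\<lambda>i. (cmod (a i))\<^sup>2) \<longlongrightarrow> s) (finite_subsets_at_top UNIV)" by (simp add: has_sum_def)
  have "eventually (\<lambda>K. dist (sum (\<lambda>i. (cmod (a i))\<^sup>2) K) s < \<epsilon>\<^sup>2 / 8) (finite_subsets_at_top UNIV)"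
    using \<epsilon> by (intro tendstoD[OF lim]) simp
  then obtain X where X: "finite X"
    "\<And>Y. finite Y \<Longrightarrow> X \<subseteq> Y \<Longrightarrow> \<bar>sum (\<lambda>i. (cmod (a i))\<^sup>2) Y - s\<bar> < \<epsilon>\<^sup>2 / 8"
    by (auto simp: eventually_finite_subsets_at_top dist_real_def)
  have near: "L2_norm (\<lambda>\<xi>. ?S Y \<xi> - ?S X \<xi>) \<le> \<epsilon> / 2" if Y: "finite Y" "X \<subseteq> Y" for Y
  proof (rule power2_le_imp_le)
    have "(\<lambda>\<xi>. ?S Y \<xi> - ?S X \<xi>) = ?S (Y - X)"
      by (simp add: sum_diff Y)
    then have "(L2_norm (\<lambda>\<xi>. ?S Y \<xi> - ?S X \<xi>))\<^sup>2 = sum (\<lambda>i. (cmod (a i))\<^sup>2) (Y - X)"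
      using L2_orthonormal_sum_norm[OF e] Y by simp
    also have "\<dots> = sum (\<lambda>i. (cmod (a i))\<^sup>2) Y - sum (\<lambda>i. (cmod (a i))\<^sup>2) X"
      by (simp add: sum_diff Y)
    also have "\<dots> \<le> \<epsilon>\<^sup>2 / 4" using X(2)[OF Y] X(2)[OF X(1) order_refl] by linarith
    finally show "(L2_norm (\<lambda>\<xi>. ?S Y \<xi> - ?S X \<xi>))\<^sup>2 \<le> (\<epsilon> / 2)\<^sup>2" by (simp add: power_divide)
  qed (use \<epsilon> in simp)
  show "\<exists>P. eventually P (finite_subsets_at_top UNIV) \<and>
      (\<forall>Y Z. P Y \<longrightarrow> P Z \<longrightarrow> L2_norm (\<lambda>\<xi>. ?S Y \<xi> - ?S Z \<xi>) \<le> \<epsilon>)"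
  proof (intro exI[of _ "\<lambda>Y. finite Y \<and> X \<subseteq> Y"] conjI allI impI)
    show "\<forall>\<^sub>F Y in finite_subsets_at_top UNIV. finite Y \<and> X \<subseteq> Y"
      using X(1) by (auto simp: eventually_finite_subsets_at_top)
    fix Y Z assume YZ: "finite Y \<and> X \<subseteq> Y" "finite Z \<and> X \<subseteq> Z"
    have "L2_norm (\<lambda>\<xi>. ?S Y \<xi> - ?S Z \<xi>) \<le> L2_norm (\<lambda>\<xi>. ?S Y \<xi> - ?S X \<xi>) + L2_norm (\<lambda>\<xi>. ?S X \<xi> - ?S Z \<xi>)"
      by (rule L2_norm_triangle_diff[OF L2_orthonormal_sum_in[OF e] L2_orthonormal_sum_in[OF e] L2_orthonormal_sum_in[OF e]])
    also have "\<dots> \<le> \<epsilon> / 2 + \<epsilon> / 2"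
      using near[of Y] near[of Z] YZ L2_norm_minus_commute[of "?S X" "?S Z"] by linarith
    finally show "L2_norm (\<lambda>\<xi>. ?S Y \<xi> - ?S Z \<xi>) \<le> \<epsilon>" by simp
  qed
qed

text \<open>The filter is left open so that this covers both unordered sums over the lattice and ordered
  sums over an enumerated basis.\<close>

lemma L2_series_inner:
  assumes e: "L2_orthonormal E e" and u: "u \<in> L2 E" and h: "h \<in> L2 E'"
    and t: "L2_tendsto (\<lambda>i \<xi>. \<Sum>k\<in>K i. a k * e k \<xi>) u F"
  shows "((\<lambda>i. \<Sum>k\<in>K i. a k * cnj (L2_inner h (e k))) \<longlongrightarrow> L2_inner u h) F"
proof -
  have "((\<lambda>i. L2_inner (\<lambda>\<xi>. \<Sum>k\<in>K i. a k * e k \<xi>) h) \<longlongrightarrow> L2_inner u h) F"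
    by (rule L2_tendsto_inner[OF t L2_orthonormal_sum_in[OF e] u h])
  moreover have "L2_inner (\<lambda>\<xi>. \<Sum>k\<in>K i. a k * e k \<xi>) h = (\<Sum>k\<in>K i. a k * cnj (L2_inner h (e k)))" for i
    by (simp add: L2_inner_sum_left[OF L2_orthonormal_in[OF e] h] flip: L2_inner_commute)
  ultimately show ?thesis by simp
qed

lemma L2_series_coeff:
  assumes e: "L2_orthonormal E e" and u: "u \<in> L2 E" and F: "F \<noteq> bot"
    and K: "\<forall>\<^sub>F i in F. finite (K i) \<and> j \<in> K i"
    and t: "L2_tendsto (\<lambda>i \<xi>. \<Sum>k\<in>K i. a k * e k \<xi>) u F"
  shows "L2_inner u (e j) = a j"
proof (rule tendsto_unique[OF F])
  show "((\<lambda>i. L2_inner (\<lambda>\<xi>. \<Sum>k\<in>K i. a k * e k \<xi>) (e j)) \<longlongrightarrow> L2_inner u (e j)) F"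
    by (rule L2_tendsto_inner[OF t L2_orthonormal_sum_in[OF e] u L2_orthonormal_in[OF e]])
  show "((\<lambda>i. L2_inner (\<lambda>\<xi>. \<Sum>k\<in>K i. a k * e k \<xi>) (e j)) \<longlongrightarrow> a j) F"
    using K by (intro tendsto_eventually) (auto elim!: eventually_mono simp: L2_orthonormal_sum_inner[OF e])
qed

lemma L2_Bessel_summable:
  assumes e: "L2_orthonormal E e" and g: "g \<in> L2 torus"
  shows "(\<lambda>i. (cmod (L2_inner g (e i)))\<^sup>2) summable_on UNIV"
proof (rule nonneg_bdd_above_summable_on)
  show "bdd_above (sum (\<lambda>i. (cmod (L2_inner g (e i)))\<^sup>2) ` {F. F \<subseteq> UNIV \<and> finite F})"
    using L2_Bessel[OF e _ g] by (intro bdd_aboveI[of _ "(L2_norm g)\<^sup>2"]) auto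
qed simp

section \<open>Interpolation by bounded analytic functions in the unit disc\<close>

lemma pseudohyperbolic_identity:
  fixes a b :: complex
  shows "(cmod (1 - cnj b * a))\<^sup>2 - (cmod (a - b))\<^sup>2 = (1 - (cmod a)\<^sup>2) * (1 - (cmod b)\<^sup>2)"
  by (simp only: cmod_power2) (simp add: algebra_simps power2_eq_square)

lemma one_minus_cnj_mult_nonzero:
  fixes a b :: complex assumes "cmod a * cmod b < 1" shows "1 - cnj b * a \<noteq> 0"
proof
  assume "1 - cnj b * a = 0"
  then have "cmod (cnj b * a) = 1" by (metis eq_iff_diff_eq_0 norm_one)
  then show False using assms by (simp add: norm_mult mult.commute)
qed

lemma cmod_mult_less_one: "cmod a < 1 \<Longrightarrow> cmod b \<le> 1 \<Longrightarrow> cmod a * cmod b < 1"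
  using mult_left_le[of "cmod b" "cmod a"] by simp

lemma pseudohyperbolic_eq:
  assumes "cmod a < 1" "cmod b < 1"
  shows "(1 - (cmod a)\<^sup>2) * (1 - (cmod b)\<^sup>2) / (cmod (1 - cnj b * a))\<^sup>2
       = 1 - (cmod ((a - b) / (1 - cnj b * a)))\<^sup>2"
proof -
  have "1 - cnj b * a \<noteq> 0"
    using assms by (intro one_minus_cnj_mult_nonzero cmod_mult_less_one) auto
  then show ?thesis
    unfolding pseudohyperbolic_identity[symmetric] norm_divide power_divide by (simp add: diff_divide_distrib)
qed

lemma pseudohyperbolic_le_1:
  assumes "cmod a < 1" "cmod b < 1" shows "cmod ((a - b) / (1 - cnj b * a)) \<le> 1"
proof -
  have "0 \<le> (1 - (cmod a)\<^sup>2) * (1 - (cmod b)\<^sup>2) / (cmod (1 - cnj b * a))\<^sup>2"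
    using assms by (intro divide_nonneg_nonneg mult_nonneg_nonneg) (auto simp: power_le_one)
  then have "(cmod ((a - b) / (1 - cnj b * a)))\<^sup>2 \<le> 1\<^sup>2"
    unfolding pseudohyperbolic_eq[OF assms] by simp
  then show ?thesis by (rule power2_le_imp_le) simp
qed

text \<open>With \<open>w = cnj a z\<close> and \<open>\<bar>z\<bar> = 1\<close> the right-hand side is the Poisson kernel of the point \<open>a\<close>.\<close>

lemma Re_cayley:
  assumes "1 - w \<noteq> 0" shows "Re ((1 + w) / (1 - w)) = (1 - (cmod w)\<^sup>2) / (cmod (1 - w))\<^sup>2"
  using assms by (simp only: Re_divide cmod_power2) (simp add: algebra_simps power2_eq_square)

text \<open>A telescoping estimate: each summand is at most the increment of \<open>t \<mapsto> - exp (- t)\<close>.\<close>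

lemma sum_exp_partial_sums_le:
  fixes \<alpha> r :: "'i \<Rightarrow> real"
  assumes "finite J" "\<And>j. j \<in> J \<Longrightarrow> 0 \<le> \<alpha> j"
  shows "(\<Sum>j\<in>J. \<alpha> j * exp (- (\<Sum>k\<in>{k\<in>J. r k \<le> r j}. \<alpha> k))) \<le> 1 - exp (- (\<Sum>j\<in>J. \<alpha> j))"
  using assms
proof (induction J rule: finite_ranking_induct[where f = r])
  case empty
  then show ?case by simp
next
  case (insert x S)
  show ?case
  proof (cases "x \<in> S")
    case True
    then show ?thesis using insert by (simp add: insert_absorb)
  next
    case False
    have nonneg: "\<alpha> x \<ge> 0" "\<And>j. j \<in> S \<Longrightarrow> \<alpha> j \<ge> 0" using insert.prems by auto
    let ?s = "\<Sum>j\<in>S. \<alpha> j"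
    have top: "{k \<in> insert x S. r k \<le> r x} = insert x S" using insert.hyps by auto
    have "(\<Sum>j\<in>S. \<alpha> j * exp (- (\<Sum>k\<in>{k\<in>insert x S. r k \<le> r j}. \<alpha> k)))
        \<le> (\<Sum>j\<in>S. \<alpha> j * exp (- (\<Sum>k\<in>{k\<in>S. r k \<le> r j}. \<alpha> k)))"
      using insert.hyps(1) nonneg
      by (intro sum_mono mult_left_mono) (auto intro!: sum_mono2)
    also have "\<dots> \<le> 1 - exp (- ?s)"
      using insert.IH nonneg by auto
    finally have "(\<Sum>j\<in>insert x S. \<alpha> j * exp (- (\<Sum>k\<in>{k\<in>insert x S. r k \<le> r j}. \<alpha> k)))
        \<le> \<alpha> x * exp (- (\<alpha> x + ?s)) + (1 - exp (- ?s))"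
      using False insert.hyps(1) by (subst sum.insert) (auto simp: top simp del: insert_iff)
    also have "\<dots> \<le> 1 - exp (- (\<alpha> x + ?s))"
    proof -
      have "(1 + \<alpha> x) * exp (- (\<alpha> x + ?s)) \<le> exp (\<alpha> x) * exp (- (\<alpha> x + ?s))"
        by (intro mult_right_mono exp_ge_add_one_self) auto
      also have "\<dots> = exp (- ?s)" by (simp flip: exp_add)
      finally show ?thesis by (simp add: algebra_simps)
    qed
    finally show ?thesis using False insert.hyps(1) by simp
  qed
qed

lemma exp_le_inverse: "0 < x \<Longrightarrow> exp (1 - x) \<le> 1 / (x :: real)"
proof -
  assume x: "0 < x"
  have "x \<le> exp (x - 1)" using exp_ge_add_one_self[of "x - 1"] by simp
  then have "x * exp (1 - x) \<le> exp (x - 1) * exp (1 - x)" by (intro mult_right_mono) auto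
  then show ?thesis using x by (simp add: field_simps flip: exp_add)
qed

text \<open>
  Jones's formula. Put \<open>p\<^sub>j = 1 - \<bar>l\<^sub>j\<bar>\<^sup>2\<close> and \<open>q\<^sub>j(z) = p\<^sub>j / (1 - cnj l\<^sub>j z)\<close>, and let \<open>B\<^sub>j\<close> be the Blaschke
  product of the other points. The function \<open>B\<^sub>j q\<^sub>j\<^sup>2 / B\<^sub>j(l\<^sub>j)\<close> is one at \<open>l\<^sub>j\<close> and zero at the other
  points, but the moduli of these functions need not have a bounded sum. The factor
  \<open>exp (H\<^sub>j(l\<^sub>j) - H\<^sub>j(z))\<close> repairs this: on the circle the real part of \<open>H\<^sub>j\<close> is the sum of \<open>\<bar>q\<^sub>k\<bar>\<^sup>2\<close> over all
  points \<open>l\<^sub>k\<close> at least as close to the circle as \<open>l\<^sub>j\<close>, so that the sum over \<open>j\<close> telescopes by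
  \<open>sum_exp_partial_sums_le\<close>. At \<open>l\<^sub>j\<close> the real part of \<open>H\<^sub>j\<close> is bounded, because
  \<open>\<Sum>\<^sub>k (1 - \<rho>\<^sub>k\<^sup>2) \<le> - 2 ln \<delta>\<close> for the pseudohyperbolic distances \<open>\<rho>\<^sub>k\<close> from \<open>l\<^sub>j\<close> to the other points.
\<close>

lemma interpolation_bounded:
  fixes l w :: "'i \<Rightarrow> complex"
  assumes J: "finite J" and l: "\<And>j. j \<in> J \<Longrightarrow> cmod (l j) < 1"
    and \<delta>: "\<delta> > 0"
    and sep: "\<And>j. j \<in> J \<Longrightarrow> \<delta> \<le> (\<Prod>k\<in>J - {j}. cmod ((l j - l k) / (1 - cnj (l k) * l j)))"
    and w: "\<And>j. j \<in> J \<Longrightarrow> cmod (w j) \<le> 1"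
    and R: "\<And>j. j \<in> J \<Longrightarrow> R * cmod (l j) < 1"
  obtains \<phi> where "\<phi> holomorphic_on ball 0 R" "\<And>j. j \<in> J \<Longrightarrow> \<phi> (l j) = w j"
    "\<And>z. cmod z = 1 \<Longrightarrow> cmod (\<phi> z) \<le> exp 2 / \<delta> ^ 5"
proof -
  define p where "p j = 1 - (cmod (l j))\<^sup>2" for j
  have p: "p j > 0" if "j \<in> J" for j
    using l[OF that] by (simp add: p_def power_less_one_iff)
  define D where "D k z = 1 - cnj (l k) * z" for k z
  have D_nz: "D k z \<noteq> 0" if "k \<in> J" "cmod z \<le> 1" for k z
    unfolding D_def using l[OF that(1)] that(2) cmod_mult_less_one[of "l k" z]
    by (intro one_minus_cnj_mult_nonzero) (simp add: mult.commute)
  have D_nz_R: "D k z \<noteq> 0" if "k \<in> J" "cmod z < R" for k z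
  proof -
    have "cmod z * cmod (l k) \<le> R * cmod (l k)" using that(2) by (intro mult_right_mono) auto
    then show ?thesis unfolding D_def using R[OF that(1)]
      by (intro one_minus_cnj_mult_nonzero) simp
  qed
  define B where "B j z = (\<Prod>k\<in>J - {j}. (z - l k) / D k z)" for j z
  define q where "q j z = of_real (p j) / D j z" for j z
  define H where "H j z = (\<Sum>k\<in>{k\<in>J. p k \<le> p j}. of_real (p k) * ((1 + cnj (l k) * z) / D k z))" for j z
  define f where "f j z = B j z / B j (l j) * (q j z)\<^sup>2 * exp (H j (l j) - H j z)" for j z
  define \<phi> where "\<phi> z = (\<Sum>j\<in>J. w j * f j z)" for z
  have B_sep: "cmod (B j (l j)) \<ge> \<delta>" if "j \<in> J" for j
    using sep[OF that] by (simp add: B_def D_def prod_norm)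
  then have B_nz: "B j (l j) \<noteq> 0" if "j \<in> J" for j
    using that \<delta> by fastforce
  have hol: "\<phi> holomorphic_on ball 0 R"
    unfolding \<phi>_def f_def B_def q_def H_def D_def
    using D_nz_R by (intro holomorphic_intros) (auto simp: D_def)
  have "\<phi> (l i) = w i" if i: "i \<in> J" for i
  proof -
    have "f j (l i) = (if j = i then 1 else 0)" if j: "j \<in> J" for j
    proof (cases "j = i")
      case True
      have "D i (l i) = of_real (p i)"
        by (simp add: D_def p_def mult.commute flip: complex_norm_square)
      then show ?thesis using True B_nz[OF i] p[OF i] by (simp add: f_def q_def)
    next
      case False
      then have "B j (l i) = 0" using i J by (auto simp: B_def)
      then show ?thesis using False by (simp add: f_def)
    qed
    then have "\<phi> (l i) = (\<Sum>j\<in>J. if j = i then w j else 0)"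
      unfolding \<phi>_def by (intro sum.cong) auto
    then show ?thesis using i J by simp
  qed
  moreover have "cmod (\<phi> z) \<le> exp 2 / \<delta> ^ 5" if z: "cmod z = 1" for z
  proof -
    define \<alpha> where "\<alpha> k = (cmod (q k z))\<^sup>2" for k
    have ReH: "Re (H j z) = (\<Sum>k\<in>{k\<in>J. p k \<le> p j}. \<alpha> k)" for j
    proof -
      have "Re (of_real (p k) * ((1 + cnj (l k) * z) / D k z)) = \<alpha> k" if "k \<in> J" for k
      proof -
        have "Re (of_real (p k) * ((1 + cnj (l k) * z) / D k z)) = p k * Re ((1 + cnj (l k) * z) / (1 - cnj (l k) * z))"
          by (simp only: Re_complex_of_real times_complex.simps complex_of_real_def D_def) simp
        also have "\<dots> = p k * ((1 - (cmod (l k))\<^sup>2) / (cmod (D k z))\<^sup>2)"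
          using D_nz[OF that, of z] z by (subst Re_cayley) (auto simp: D_def norm_mult)
        also have "\<dots> = \<alpha> k"
          using p[OF that] unfolding p_def[symmetric]
          by (simp add: \<alpha>_def q_def norm_divide power_divide power2_eq_square)
        finally show ?thesis .
      qed
      then show ?thesis by (simp add: H_def)
    qed
    have ReHl: "exp (Re (H j (l j))) \<le> exp 2 / \<delta> ^ 4" if j: "j \<in> J" for j
    proof -
      define \<rho> where "\<rho> k = cmod ((l j - l k) / (1 - cnj (l k) * l j))" for k
      have \<rho>_prod: "\<delta> \<le> (\<Prod>k\<in>J - {j}. \<rho> k)" using sep[OF j] by (simp add: \<rho>_def)
      have \<rho>_pos: "\<rho> k > 0" if "k \<in> J - {j}" for k
      proof -
        have "(\<Prod>k\<in>J - {j}. \<rho> k) \<noteq> 0" using \<rho>_prod \<delta> by linarith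
        then have "\<rho> k \<noteq> 0" using J that by simp
        then show ?thesis by (simp add: \<rho>_def)
      qed
      have term_le: "Re (of_real (p k) * ((1 + cnj (l k) * l j) / D k (l j))) \<le> 2 * (1 - (\<rho> k)\<^sup>2)"

        if k: "k \<in> J" "p k \<le> p j" for k
      proof -
        have *: "p j * p k / (cmod (D k (l j)))\<^sup>2 = 1 - (\<rho> k)\<^sup>2"
          unfolding p_def D_def \<rho>_def by (rule pseudohyperbolic_eq[OF l[OF j] l[OF k(1)]])
        have nz: "1 - cnj (l k) * l j \<noteq> 0"
          using D_nz[OF k(1), of "l j"] l[OF j] by (simp add: D_def)
        have "Re (of_real (p k) * ((1 + cnj (l k) * l j) / D k (l j)))
            = p k * Re ((1 + cnj (l k) * l j) / (1 - cnj (l k) * l j))"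
          by (simp only: Re_complex_of_real times_complex.simps complex_of_real_def D_def) simp
        also have "\<dots> = p k * ((1 - (1 - p k) * (1 - p j)) / (cmod (D k (l j)))\<^sup>2)"
          by (subst Re_cayley[OF nz]) (simp add: D_def p_def norm_mult power_mult_distrib)
        also have "\<dots> \<le> p k * (2 * p j / (cmod (D k (l j)))\<^sup>2)"
        proof (intro mult_left_mono divide_right_mono)
          have "1 - (1 - p k) * (1 - p j) = p k + p j - p j * p k" by (simp add: algebra_simps)
          then show "1 - (1 - p k) * (1 - p j) \<le> 2 * p j"
            using k(2) mult_pos_pos[OF p[OF j] p[OF k(1)]] by linarith
        qed (use p[OF k(1)] in auto)
        also have "\<dots> = 2 * (p j * p k / (cmod (D k (l j)))\<^sup>2)" by simp
        finally show ?thesis unfolding * .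
      qed
      have term_nonneg: "0 \<le> 1 - (\<rho> k)\<^sup>2" if "k \<in> J" for k
        using pseudohyperbolic_le_1[OF l[OF j] l[OF that]] by (simp add: \<rho>_def power_le_one)
      \<comment> \<open>The term for \<open>k = j\<close> has \<open>\<rho> j = 0\<close> and contributes the \<open>2\<close>.\<close>
      have "Re (H j (l j)) \<le> (\<Sum>k\<in>{k\<in>J. p k \<le> p j}. 2 * (1 - (\<rho> k)\<^sup>2))"
        unfolding H_def Re_sum by (intro sum_mono term_le) auto
      also have "\<dots> \<le> (\<Sum>k\<in>J. 2 * (1 - (\<rho> k)\<^sup>2))"
        using J term_nonneg by (intro sum_mono2) auto
      also have "\<dots> = 2 + (\<Sum>k\<in>J - {j}. 2 * (1 - (\<rho> k)\<^sup>2))"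
        using J j by (subst sum.remove[of _ j]) (auto simp: \<rho>_def)
      finally have "exp (Re (H j (l j))) \<le> exp (2 + (\<Sum>k\<in>J - {j}. 2 * (1 - (\<rho> k)\<^sup>2)))" by simp
      also have "\<dots> = exp 2 * (\<Prod>k\<in>J - {j}. exp (2 * (1 - (\<rho> k)\<^sup>2)))"
        using J by (simp add: exp_add exp_sum)
      also have "\<dots> \<le> exp 2 * (\<Prod>k\<in>J - {j}. (1 / \<rho> k) ^ 4)"
      proof (intro mult_left_mono prod_mono conjI)
        fix k assume "k \<in> J - {j}"
        have "exp (2 * (1 - (\<rho> k)\<^sup>2)) = (exp (1 - (\<rho> k)\<^sup>2))\<^sup>2" by (rule exp_double)
        also have "\<dots> \<le> (1 / (\<rho> k)\<^sup>2)\<^sup>2"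
          using \<rho>_pos[OF \<open>k \<in> J - {j}\<close>] by (intro power_mono exp_le_inverse) auto
        finally show "exp (2 * (1 - (\<rho> k)\<^sup>2)) \<le> (1 / \<rho> k) ^ 4" by (simp add: power_divide flip: power_mult)
      qed auto
      also have "(\<Prod>k\<in>J - {j}. (1 / \<rho> k) ^ 4) = 1 / (\<Prod>k\<in>J - {j}. \<rho> k) ^ 4"
        by (simp add: prod_dividef power_divide flip: prod_power_distrib)
      also have "exp 2 * (1 / (\<Prod>k\<in>J - {j}. \<rho> k) ^ 4) \<le> exp 2 * (1 / \<delta> ^ 4)"
        using \<delta> \<rho>_prod by (intro mult_left_mono divide_left_mono power_mono mult_pos_pos zero_less_power) auto
      finally show ?thesis by simp
    qed
    have B_unit: "cmod (B j z) = 1" for j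
    proof -
      have "cmod ((z - l k) / D k z) = 1" if "k \<in> J - {j}" for k
      proof -
        have "(cmod (D k z))\<^sup>2 = (cmod (z - l k))\<^sup>2"
          using pseudohyperbolic_identity[of "l k" z] z by (simp add: D_def)
        then have "cmod (D k z) = cmod (z - l k)" by (simp add: power2_eq_iff_nonneg)
        moreover have "cmod (D k z) \<noteq> 0" using D_nz[of k z] that z by simp
        ultimately show ?thesis unfolding norm_divide by (metis divide_self)
      qed
      then show ?thesis by (simp add: B_def flip: prod_norm)
    qed
    have f_bound: "cmod (f j z) \<le> exp 2 / \<delta> ^ 5 * (\<alpha> j * exp (- (\<Sum>k\<in>{k\<in>J. p k \<le> p j}. \<alpha> k)))"
      if j: "j \<in> J" for j
    proof -
      have "cmod (f j z) = 1 / cmod (B j (l j)) * \<alpha> j * (exp (Re (H j (l j))) * exp (- Re (H j z)))"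
        by (simp add: f_def norm_mult norm_divide norm_power B_unit \<alpha>_def flip: exp_add)
      also have "\<dots> \<le> 1 / \<delta> * \<alpha> j * (exp 2 / \<delta> ^ 4 * exp (- Re (H j z)))"
        using B_sep[OF j] \<delta> ReHl[OF j]
        by (intro mult_mono divide_left_mono mult_pos_pos) (auto simp: \<alpha>_def)
      also have "\<dots> = exp 2 / \<delta> ^ 5 * (\<alpha> j * exp (- (\<Sum>k\<in>{k\<in>J. p k \<le> p j}. \<alpha> k)))"
        by (simp add: ReH eval_nat_numeral)
      finally show ?thesis .
    qed
    have "cmod (\<phi> z) \<le> (\<Sum>j\<in>J. cmod (w j * f j z))"
      unfolding \<phi>_def by (rule norm_sum)
    also have "\<dots> \<le> (\<Sum>j\<in>J. exp 2 / \<delta> ^ 5 * (\<alpha> j * exp (- (\<Sum>k\<in>{k\<in>J. p k \<le> p j}. \<alpha> k))))"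
    proof (rule sum_mono)
      fix j assume j: "j \<in> J"
      have "cmod (w j * f j z) \<le> 1 * cmod (f j z)"
        unfolding norm_mult using w[OF j] by (intro mult_right_mono) auto
      then show "cmod (w j * f j z) \<le> exp 2 / \<delta> ^ 5 * (\<alpha> j * exp (- (\<Sum>k\<in>{k\<in>J. p k \<le> p j}. \<alpha> k)))"
        using f_bound[OF j] by simp
    qed
    also have "\<dots> = exp 2 / \<delta> ^ 5 * (\<Sum>j\<in>J. \<alpha> j * exp (- (\<Sum>k\<in>{k\<in>J. p k \<le> p j}. \<alpha> k)))"
      by (simp add: sum_distrib_left)
    also have "\<dots> \<le> exp 2 / \<delta> ^ 5 * 1"
    proof (rule mult_left_mono)
      have "(\<Sum>j\<in>J. \<alpha> j * exp (- (\<Sum>k\<in>{k\<in>J. p k \<le> p j}. \<alpha> k))) \<le> 1 - exp (- (\<Sum>j\<in>J. \<alpha> j))"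
        by (rule sum_exp_partial_sums_le[OF J]) (simp add: \<alpha>_def)
      also have "\<dots> \<le> 1" by simp
      finally show "(\<Sum>j\<in>J. \<alpha> j * exp (- (\<Sum>k\<in>{k\<in>J. p k \<le> p j}. \<alpha> k))) \<le> 1" .
    qed (use \<delta> in simp)
    finally show ?thesis by simp
  qed
  ultimately show ?thesis using that hol by blast
qed


section \<open>Multipliers of power series in the Hardy space\<close>

lemma has_integral_exp_int:
  fixes k :: int and a :: real
  shows "((\<lambda>t. exp (2 * of_real pi * \<i> * of_int k * of_real t)) has_integral (if k = 0 then 1 else 0)) {a..a + 1}"
proof (cases "k = 0")
  case True
  then show ?thesis using has_integral_const_real[of "1 :: complex" a "a + 1"] by simp
next
  case False
  define c where "c = 2 * of_real pi * \<i> * of_int k"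
  have c: "c \<noteq> 0" using False by (simp add: c_def)
  have "((\<lambda>t. exp (c * of_real t)) has_integral
      exp (c * of_real (a + 1)) / c - exp (c * of_real a) / c) {a..a + 1}"
  proof (rule fundamental_theorem_of_calculus)
    fix t assume "t \<in> {a..a + 1}"
    have "((\<lambda>z. exp (c * z) / c) has_field_derivative exp (c * of_real t)) (at (of_real t))"
      using c by (auto intro!: derivative_eq_intros)
    then show "((\<lambda>t. exp (c * of_real t) / c) has_vector_derivative exp (c * of_real t)) (at t within {a..a + 1})"
      by (rule has_vector_derivative_real_field)
  qed simp
  moreover have "exp (c * of_real (a + 1)) = exp (c * of_real a)"
    using exp_integer_2pi[of "of_int k"] by (simp add: distrib_left exp_add c_def mult_ac)
  ultimately show ?thesis using False by (simp add: c_def)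
qed

text \<open>For partial sums this is the orthogonality of the exponentials; they converge boundedly on the
  circle, which allows passing to the limit.\<close>

lemma Parseval_circle:
  fixes a :: "nat \<Rightarrow> complex"
  defines "e \<equiv> \<lambda>t :: real. exp (2 * of_real pi * \<i> * of_real t)"
  assumes a: "summable (\<lambda>n. cmod (a n))"
  shows "(\<lambda>t. (cmod (\<Sum>n. a n * e t ^ n))\<^sup>2) integrable_on {0..1}"
    and "(\<lambda>n. (cmod (a n))\<^sup>2) sums integral {0..1} (\<lambda>t. (cmod (\<Sum>n. a n * e t ^ n))\<^sup>2)"
proof -
  have norm_e [simp]: "cmod (e t) = 1" for t
    by (simp add: e_def norm_exp_eq_Re)
  have e_power: "e t ^ m * cnj (e t ^ n) = exp (2 * of_real pi * \<i> * of_int (int m - int n) * of_real t)" for t m n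
  proof -
    have "e t ^ m * cnj (e t ^ n) = exp (of_nat m * (2 * of_real pi * \<i> * of_real t)) * exp (of_nat n * cnj (2 * of_real pi * \<i> * of_real t))"
      by (simp only: e_def exp_of_nat_mult[symmetric] exp_cnj) (simp add: exp_cnj)
    also have "\<dots> = exp (2 * of_real pi * \<i> * of_int (int m - int n) * of_real t)"
      by (simp add: algebra_simps flip: exp_add)
    finally show ?thesis .
  qed
  define S where "S N t = (\<Sum>n<N. a n * e t ^ n)" for N t
  have S_sq: "of_real ((cmod (S N t))\<^sup>2) =
      (\<Sum>m<N. \<Sum>n<N. a m * cnj (a n) * exp (2 * of_real pi * \<i> * of_int (int m - int n) * of_real t))" for N t
    unfolding complex_norm_square S_def cnj_sum sum_product e_power[symmetric]
    by (simp add: mult_ac)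
  have S_int: "((\<lambda>t. (cmod (S N t))\<^sup>2) has_integral (\<Sum>n<N. (cmod (a n))\<^sup>2)) {0..1}" for N
  proof -
    have "((\<lambda>t. complex_of_real ((cmod (S N t))\<^sup>2)) has_integral
        (\<Sum>m<N. \<Sum>n<N. a m * cnj (a n) * (if int m - int n = 0 then 1 else 0))) {0..1}"
      unfolding S_sq
      by (intro has_integral_sum has_integral_mult_right has_integral_exp_int[of _ 0, unfolded add_0]) simp_all
    also have "(\<Sum>m<N. \<Sum>n<N. a m * cnj (a n) * (if int m - int n = 0 then 1 else 0))
        = (\<Sum>m<N. \<Sum>n<N. if n = m then of_real ((cmod (a m))\<^sup>2) else 0)"
      by (intro sum.cong refl) (auto simp flip: complex_norm_square)
    also have "\<dots> = complex_of_real (\<Sum>m<N. (cmod (a m))\<^sup>2)"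
      by simp
    finally show ?thesis using has_integral_linear[OF _ bounded_linear_Re] by (force simp: o_def)
  qed
  define A where "A = (\<Sum>n. cmod (a n))"
  have S_bound: "cmod (S N t) \<le> A" for N t
  proof -
    have "cmod (S N t) \<le> (\<Sum>n<N. cmod (a n))"
      unfolding S_def by (rule order_trans[OF norm_sum]) (simp add: norm_mult norm_power)
    also have "\<dots> \<le> A" unfolding A_def by (rule sum_le_suminf[OF a]) auto
    finally show ?thesis .
  qed
  have lim: "(\<lambda>N. (cmod (S N t))\<^sup>2) \<longlonglongrightarrow> (cmod (\<Sum>n. a n * e t ^ n))\<^sup>2" for t
  proof -
    have "summable (\<lambda>n. a n * e t ^ n)"
      by (rule summable_norm_cancel) (simp add: norm_mult norm_power a)
    then show ?thesis unfolding S_def by (intro tendsto_intros summable_LIMSEQ)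
  qed
  have *: "(\<lambda>t. (cmod (\<Sum>n. a n * e t ^ n))\<^sup>2) integrable_on {0..1} \<and>
      (\<lambda>N. integral {0..1} (\<lambda>t. (cmod (S N t))\<^sup>2)) \<longlonglongrightarrow> integral {0..1} (\<lambda>t. (cmod (\<Sum>n. a n * e t ^ n))\<^sup>2)"
  proof (intro conjI)
    have 1: "(\<lambda>t. (cmod (S N t))\<^sup>2) integrable_on {0..1}" for N
      using S_int by blast
    have 2: "(\<lambda>t :: real. A\<^sup>2) integrable_on {0..1}" by (rule integrable_const_ivl)
    have 3: "norm ((cmod (S N t))\<^sup>2) \<le> A\<^sup>2" for N t
      using S_bound by (simp add: power_mono)
    note dc = dominated_convergence[OF 1 2 3 lim]
    show "(\<lambda>t. (cmod (\<Sum>n. a n * e t ^ n))\<^sup>2) integrable_on {0..1}" by (rule dc(1))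
    show "(\<lambda>N. integral {0..1} (\<lambda>t. (cmod (S N t))\<^sup>2)) \<longlonglongrightarrow> integral {0..1} (\<lambda>t. (cmod (\<Sum>n. a n * e t ^ n))\<^sup>2)"
      by (rule dc(2))
  qed
  then show "(\<lambda>t. (cmod (\<Sum>n. a n * e t ^ n))\<^sup>2) integrable_on {0..1}" by blast
  from * show "(\<lambda>n. (cmod (a n))\<^sup>2) sums integral {0..1} (\<lambda>t. (cmod (\<Sum>n. a n * e t ^ n))\<^sup>2)"
    unfolding integral_unique[OF S_int] sums_def by blast
qed

lemma holomorphic_absolutely_summable:
  assumes "f holomorphic_on ball 0 R" "1 < R"
  obtains a :: "nat \<Rightarrow> complex" where "summable (\<lambda>n. cmod (a n))"
    "\<And>z. cmod z \<le> 1 \<Longrightarrow> (\<lambda>n. a n * z ^ n) sums f z"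
proof -
  define a where "a n = (deriv ^^ n) f 0 / fact n" for n
  have sums: "(\<lambda>n. a n * z ^ n) sums f z" if "cmod z < R" for z
    using holomorphic_power_series[OF assms(1), of z] that by (simp add: a_def)
  define r where "r = (1 + R) / 2"
  have r: "1 < r" "r < R" using assms(2) by (auto simp: r_def)
  have "summable (\<lambda>n. a n * of_real r ^ n)"
    using sums[of "of_real r"] r by (auto simp: sums_iff)
  then have "summable (\<lambda>n. cmod (a n * 1 ^ n))"
    by (rule powser_insidea) (use r in simp)
  then show ?thesis using sums r by (intro that[of a]) auto
qed

definition sqsum :: "(nat \<Rightarrow> complex) \<Rightarrow> real" where
  "sqsum u = (\<Sum>k. (cmod (u k))\<^sup>2)"

text \<open>As a sequence in \<open>k\<close>, the Taylor coefficients of \<open>\<Sum>\<^sub>j b j / (1 - l j * z)\<close>.\<close>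

definition power_sums :: "'i set \<Rightarrow> ('i \<Rightarrow> complex) \<Rightarrow> ('i \<Rightarrow> complex) \<Rightarrow> nat \<Rightarrow> complex" where
  "power_sums J l b k = (\<Sum>j\<in>J. b j * l j ^ k)"

lemma power_sums_summable:
  assumes "finite J" "\<And>j. j \<in> J \<Longrightarrow> cmod (l j) < 1"
  shows "summable (\<lambda>k. cmod (power_sums J l b k))"
proof (rule summable_comparison_test')
  show "summable (\<lambda>k. \<Sum>j\<in>J. cmod (b j) * cmod (l j) ^ k)"
    using assms by (intro summable_sum summable_mult summable_geometric) auto
  show "norm (cmod (power_sums J l b k)) \<le> (\<Sum>j\<in>J. cmod (b j) * cmod (l j) ^ k)" for k
    unfolding power_sums_def by (simp, rule order_trans[OF norm_sum]) (simp add: norm_mult norm_power)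
qed

lemma summable_square:
  fixes x :: "nat \<Rightarrow> real"
  assumes "summable x" "\<And>n. 0 \<le> x n" shows "summable (\<lambda>n. (x n)\<^sup>2)"
proof (rule summable_comparison_test_ev[OF _ assms(1)])
  have "\<forall>\<^sub>F n in sequentially. x n < 1"
    using summable_LIMSEQ_zero[OF assms(1)] by (rule order_tendstoD) simp
  then show "\<forall>\<^sub>F n in sequentially. norm ((x n)\<^sup>2) \<le> x n"
  proof eventually_elim
    case (elim n)
    then show ?case using mult_left_le[of "x n" "x n"] assms(2)[of n] by (simp add: power2_eq_square)
  qed
qed

lemma power_sums_sq_summable:
  assumes "finite J" "\<And>j. j \<in> J \<Longrightarrow> cmod (l j) < 1"
  shows "summable (\<lambda>k. (cmod (power_sums J l b k))\<^sup>2)"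
  by (rule summable_square[OF power_sums_summable[OF assms]]) auto

lemma sqsum_nonneg: "0 \<le> sqsum u" if "summable (\<lambda>k. (cmod (u k))\<^sup>2)"
  unfolding sqsum_def using that by (intro suminf_nonneg) auto

lemma Cauchy_Schwarz_suminf:
  fixes u v :: "nat \<Rightarrow> complex"
  assumes u: "summable (\<lambda>k. (cmod (u k))\<^sup>2)" and v: "summable (\<lambda>k. (cmod (v k))\<^sup>2)"
    and s: "(\<lambda>k. u k * v k) sums s"
  shows "(cmod s)\<^sup>2 \<le> sqsum u * sqsum v"
proof (rule Lim_bounded)
  show "(\<lambda>N. (cmod (\<Sum>k<N. u k * v k))\<^sup>2) \<longlonglongrightarrow> (cmod s)\<^sup>2"
    using s unfolding sums_def by (intro tendsto_intros)
  show "\<forall>N\<ge>0. (cmod (\<Sum>k<N. u k * v k))\<^sup>2 \<le> sqsum u * sqsum v"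
  proof (intro allI impI)
    fix N :: nat
    have "(cmod (\<Sum>k<N. u k * v k))\<^sup>2 \<le> (\<Sum>k<N. cmod (u k) * cmod (v k))\<^sup>2"
      by (intro power_mono order_trans[OF norm_sum]) (auto simp: norm_mult)
    also have "\<dots> \<le> (\<Sum>k<N. (cmod (u k))\<^sup>2) * (\<Sum>k<N. (cmod (v k))\<^sup>2)"
      by (rule Cauchy_Schwarz_ineq_sum)
    also have "\<dots> \<le> sqsum u * sqsum v"
      unfolding sqsum_def using u v by (intro mult_mono sum_le_suminf suminf_nonneg sum_nonneg) auto
    finally show "(cmod (\<Sum>k<N. u k * v k))\<^sup>2 \<le> sqsum u * sqsum v" .
  qed
qed

text \<open>
  The sequences are the Taylor coefficients of combinations of reproducing kernels, and multiplying
  the coefficient of the kernel at \<open>cnj (l j)\<close> by \<open>\<phi> (l j)\<close> is the adjoint of multiplication by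
  \<open>\<phi>\<close>, up to conjugation. Accordingly the proof is by duality: with \<open>U\<close> the power series with
  coefficients \<open>cnj (u k)\<close>, the squared norm of \<open>u\<close> is the pairing of the sequence \<open>w\<close> with the
  coefficients \<open>v\<close> of \<open>\<phi> U\<close>, and \<open>v\<close> is controlled by Parseval's identity.
\<close>

lemma multiplier_bound:
  fixes l b :: "'i \<Rightarrow> complex"
  assumes J: "finite J" and l: "\<And>j. j \<in> J \<Longrightarrow> cmod (l j) < 1"
    and R: "1 < R" "\<And>j. j \<in> J \<Longrightarrow> R * cmod (l j) < 1"
    and hol: "\<phi> holomorphic_on ball 0 R"
    and \<phi>: "\<And>z. cmod z = 1 \<Longrightarrow> cmod (\<phi> z) \<le> C"
  shows "sqsum (power_sums J l (\<lambda>j. b j * \<phi> (l j))) \<le> C\<^sup>2 * sqsum (power_sums J l b)"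
proof -
  have C: "0 \<le> C" using order_trans[OF norm_ge_zero \<phi>[of 1]] by simp
  define u where "u = power_sums J l (\<lambda>j. b j * \<phi> (l j))"
  define w where "w = power_sums J l b"
  have u1: "summable (\<lambda>k. cmod (u k))" unfolding u_def by (rule power_sums_summable[OF J l])
  have u2: "summable (\<lambda>k. (cmod (u k))\<^sup>2)" unfolding u_def by (rule power_sums_sq_summable[OF J l])
  have w2: "summable (\<lambda>k. (cmod (w k))\<^sup>2)" unfolding w_def by (rule power_sums_sq_summable[OF J l])
  define U where "U z = (\<Sum>j\<in>J. cnj (b j * \<phi> (l j)) / (1 - cnj (l j) * z))" for z
  have U_sums: "(\<lambda>k. cnj (u k) * z ^ k) sums U z" if "cmod z \<le> 1" for z
  proof -
    have "(\<lambda>k. \<Sum>j\<in>J. cnj (b j * \<phi> (l j)) * (cnj (l j) * z) ^ k) sums U z"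
      unfolding U_def divide_inverse
    proof (intro sums_sum sums_mult)
      fix j assume "j \<in> J"
      then have "cmod (cnj (l j) * z) < 1"
        using cmod_mult_less_one[OF l that] by (simp add: norm_mult)
      from geometric_sums[OF this] show "(\<lambda>k. (cnj (l j) * z) ^ k) sums inverse (1 - cnj (l j) * z)"
        by (simp add: inverse_eq_divide)
    qed
    then show ?thesis
      by (simp add: u_def power_sums_def power_mult_distrib sum_distrib_right mult.assoc)
  qed
  have "1 - cnj (l j) * z \<noteq> 0" if "j \<in> J" "cmod z < R" for j z
  proof -
    have "cmod z * cmod (l j) \<le> R * cmod (l j)" using that(2) by (intro mult_right_mono) auto
    then show ?thesis using R(2)[OF that(1)] by (intro one_minus_cnj_mult_nonzero) simp
  qed
  then have "(\<lambda>z. \<phi> z * U z) holomorphic_on ball 0 R"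
    unfolding U_def by (intro holomorphic_intros hol) auto
  from holomorphic_absolutely_summable[OF this R(1)]
  obtain v where v1: "summable (\<lambda>n. cmod (v n))"
    and v_sums: "\<And>z. cmod z \<le> 1 \<Longrightarrow> (\<lambda>n. v n * z ^ n) sums (\<phi> z * U z)"
    by blast
  have v2: "summable (\<lambda>k. (cmod (v k))\<^sup>2)" by (rule summable_square[OF v1]) auto
  define e where "e t = exp (2 * of_real pi * \<i> * of_real t)" for t :: real
  have e: "cmod (e t) = 1" for t by (simp add: e_def norm_exp_eq_Re)
  have U_eq: "(\<Sum>n. cnj (u n) * e t ^ n) = U (e t)" for t
    using U_sums[of "e t"] e[of t] by (simp add: sums_iff)
  have v_eq: "(\<Sum>n. v n * e t ^ n) = \<phi> (e t) * U (e t)" for t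
    using v_sums[of "e t"] e[of t] by (simp add: sums_iff)
  have u1': "summable (\<lambda>n. cmod (cnj (u n)))" using u1 by simp
  note Pu = Parseval_circle[OF u1', folded e_def, unfolded U_eq]
  note Pv = Parseval_circle[OF v1, folded e_def, unfolded v_eq]
  have "sqsum v = integral {0..1} (\<lambda>t. (cmod (\<phi> (e t) * U (e t)))\<^sup>2)"
    using Pv(2) by (simp add: sqsum_def sums_iff)
  also have "\<dots> \<le> integral {0..1} (\<lambda>t. C\<^sup>2 * (cmod (U (e t)))\<^sup>2)"
  proof (rule integral_le[OF Pv(1)])
    show "(\<lambda>t. C\<^sup>2 * (cmod (U (e t)))\<^sup>2) integrable_on {0..1}"
      using Pu(1) by (intro integrable_on_mult_right)
    show "(cmod (\<phi> (e t) * U (e t)))\<^sup>2 \<le> C\<^sup>2 * (cmod (U (e t)))\<^sup>2" for t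
      using \<phi>[OF e] unfolding norm_mult power_mult_distrib
      by (intro mult_right_mono power_mono) auto
  qed
  also have "\<dots> = C\<^sup>2 * sqsum u"
    using Pu(2) by (simp add: sqsum_def sums_iff)
  finally have v_le: "sqsum v \<le> C\<^sup>2 * sqsum u" .
  have "(\<lambda>k. u k * cnj (u k)) sums of_real (sqsum u)"
    unfolding sqsum_def complex_norm_square[symmetric] by (rule sums_of_real[OF summable_sums[OF u2]])
  moreover have "(\<lambda>k. u k * cnj (u k)) sums (\<Sum>j\<in>J. b j * \<phi> (l j) * U (l j))"
  proof -
    have "(\<lambda>k. \<Sum>j\<in>J. b j * \<phi> (l j) * (cnj (u k) * l j ^ k)) sums (\<Sum>j\<in>J. b j * \<phi> (l j) * U (l j))"
      using l by (intro sums_sum sums_mult U_sums) (auto intro: less_imp_le)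
    moreover have "(\<Sum>j\<in>J. b j * \<phi> (l j) * (cnj (u k) * l j ^ k)) = u k * cnj (u k)" for k
    proof -
      have "(\<Sum>j\<in>J. b j * \<phi> (l j) * (cnj (u k) * l j ^ k)) = (\<Sum>j\<in>J. b j * \<phi> (l j) * l j ^ k) * cnj (u k)"
        by (simp add: sum_distrib_left mult_ac)
      then show ?thesis by (simp add: u_def power_sums_def)
    qed
    ultimately show ?thesis by simp
  qed
  ultimately have u_eq: "of_real (sqsum u) = (\<Sum>j\<in>J. b j * \<phi> (l j) * U (l j))"
    by (rule sums_unique2)
  have "(\<lambda>n. \<Sum>j\<in>J. b j * (v n * l j ^ n)) sums (\<Sum>j\<in>J. b j * (\<phi> (l j) * U (l j)))"
    using l by (intro sums_sum sums_mult v_sums) (auto intro: less_imp_le)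
  then have "(\<lambda>n. v n * w n) sums of_real (sqsum u)"
    unfolding u_eq by (simp add: w_def power_sums_def sum_distrib_left mult_ac)
  then have "(cmod (of_real (sqsum u)))\<^sup>2 \<le> sqsum v * sqsum w"
    by (rule Cauchy_Schwarz_suminf[OF v2 w2])
  also have "\<dots> \<le> C\<^sup>2 * sqsum u * sqsum w"
    using sqsum_nonneg[OF w2] v_le by (intro mult_right_mono)
  finally have "sqsum u * sqsum u \<le> sqsum u * (C\<^sup>2 * sqsum w)"
    by (simp add: power2_eq_square mult_ac)
  moreover have "0 \<le> C\<^sup>2 * sqsum w" using sqsum_nonneg[OF w2] by simp
  ultimately have "sqsum u \<le> C\<^sup>2 * sqsum w"
    using sqsum_nonneg[OF u2] by (cases "sqsum u = 0") auto
  then show ?thesis by (simp add: u_def w_def)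
qed


section \<open>Riesz bounds for reproducing kernels at separated points\<close>

lemma sqsum_parallelogram:
  fixes u v :: "nat \<Rightarrow> complex"
  assumes "summable (\<lambda>k. (cmod (u k))\<^sup>2)" "summable (\<lambda>k. (cmod (v k))\<^sup>2)"
    "summable (\<lambda>k. (cmod (u k + v k))\<^sup>2)" "summable (\<lambda>k. (cmod (u k - v k))\<^sup>2)"
  shows "sqsum (\<lambda>k. u k + v k) + sqsum (\<lambda>k. u k - v k) = 2 * sqsum u + 2 * sqsum v"
proof -
  have *: "(cmod (u k + v k))\<^sup>2 + (cmod (u k - v k))\<^sup>2 = 2 * (cmod (u k))\<^sup>2 + 2 * (cmod (v k))\<^sup>2" for k
    by (simp only: cmod_power2) (simp add: algebra_simps power2_eq_square)
  have "sqsum (\<lambda>k. u k + v k) + sqsum (\<lambda>k. u k - v k) = (\<Sum>k. (cmod (u k + v k))\<^sup>2 + (cmod (u k - v k))\<^sup>2)"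
    unfolding sqsum_def by (rule suminf_add[OF assms(3,4)])
  also have "\<dots> = 2 * sqsum u + 2 * sqsum v"
    unfolding * sqsum_def
    by (subst suminf_add[symmetric]) (use assms in \<open>auto simp: suminf_mult intro!: summable_mult\<close>)
  finally show ?thesis .
qed

lemma power_sums_insert:
  "finite J \<Longrightarrow> x \<notin> J \<Longrightarrow> power_sums (insert x J) l b k = b x * l x ^ k + power_sums J l b k"
  by (simp add: power_sums_def)

lemma sqsum_power_sums_single:
  assumes "cmod (l x) < 1"
  shows "sqsum (\<lambda>k. b x * l x ^ k) = (cmod (b x))\<^sup>2 / (1 - (cmod (l x))\<^sup>2)"
proof -
  have *: "(cmod (b x * l x ^ k))\<^sup>2 = (cmod (b x))\<^sup>2 * ((cmod (l x))\<^sup>2) ^ k" for k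
    by (simp add: norm_mult norm_power power_mult_distrib mult.commute flip: power_mult)
  have "norm ((cmod (l x))\<^sup>2) < 1" using assms by (simp add: power_less_one_iff)
  then show ?thesis
    unfolding sqsum_def * by (simp add: suminf_mult suminf_geometric summable_geometric)
qed

text \<open>By the parallelogram law the two choices for each new sign have the orthogonal value as their
  mean, so one of them does not exceed it and one does not fall below it. The factor \<open>s\<close> treats both
  directions together, with \<open>s = 1\<close> and \<open>s = - 1\<close>.\<close>

lemma exists_signs:
  fixes l b :: "'i \<Rightarrow> complex" and s :: real
  assumes J: "finite J" and l: "\<And>j. j \<in> J \<Longrightarrow> cmod (l j) < 1"
  shows "\<exists>\<epsilon>. (\<forall>j. \<epsilon> j = 1 \<or> \<epsilon> j = - 1) \<and>
      s * sqsum (power_sums J l (\<lambda>j. b j * \<epsilon> j)) \<le> s * (\<Sum>j\<in>J. (cmod (b j))\<^sup>2 / (1 - (cmod (l j))\<^sup>2))"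
proof -
  have step: "sqsum (power_sums (insert x J) l (\<lambda>j. b j * (\<epsilon>(x := 1)) j))
      + sqsum (power_sums (insert x J) l (\<lambda>j. b j * (\<epsilon>(x := -1)) j))
      = 2 * ((cmod (b x))\<^sup>2 / (1 - (cmod (l x))\<^sup>2)) + 2 * sqsum (power_sums J l (\<lambda>j. b j * \<epsilon> j))"
    if "finite J" "x \<notin> J" "\<And>j. j \<in> insert x J \<Longrightarrow> cmod (l j) < 1" for J x and \<epsilon> :: "'i \<Rightarrow> complex"
  proof -
    have old: "power_sums J l (\<lambda>j. b j * (\<epsilon>(x := c)) j) = power_sums J l (\<lambda>j. b j * \<epsilon> j)" for c
      using that(2) by (auto simp: power_sums_def fun_eq_iff intro!: sum.cong)
    let ?v = "power_sums J l (\<lambda>j. b j * \<epsilon> j)" and ?u = "\<lambda>k. b x * l x ^ k"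
    have p: "power_sums (insert x J) l (\<lambda>j. b j * (\<epsilon>(x := 1)) j) = (\<lambda>k. ?u k + ?v k)"
      using power_sums_insert[OF that(1,2)] old by (auto simp: fun_eq_iff)
    have m: "power_sums (insert x J) l (\<lambda>j. b j * (\<epsilon>(x := -1)) j) = (\<lambda>k. - (?u k - ?v k))"
      using power_sums_insert[OF that(1,2)] old by (auto simp: fun_eq_iff)
    have m': "sqsum (\<lambda>k. - (?u k - ?v k)) = sqsum (\<lambda>k. ?u k - ?v k)"
      by (simp add: sqsum_def norm_minus_commute)
    have fin: "finite (insert x J)" using that by simp
    have s: "summable (\<lambda>k. (cmod (?u k))\<^sup>2)"
      using power_sums_sq_summable[of "{x}" l b] that(3) by (simp add: power_sums_def)
    have t: "summable (\<lambda>k. (cmod (?v k))\<^sup>2)"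
      by (rule power_sums_sq_summable[OF that(1)]) (use that(3) in auto)
    have sp: "summable (\<lambda>k. (cmod (?u k + ?v k))\<^sup>2)"
      using power_sums_sq_summable[where l = l and b = "\<lambda>j. b j * (\<epsilon>(x := 1)) j", OF fin that(3)] unfolding p by simp
    have sm: "summable (\<lambda>k. (cmod (?u k - ?v k))\<^sup>2)"
      using power_sums_sq_summable[where l = l and b = "\<lambda>j. b j * (\<epsilon>(x := -1)) j", OF fin that(3)] unfolding m
      by (simp add: norm_minus_commute)
    have lx: "cmod (l x) < 1" using that(3) by simp
    show ?thesis
      unfolding p m m' sqsum_parallelogram[OF s t sp sm] sqsum_power_sums_single[of l x b, OF lx] ..
  qed
  show ?thesis using J l
  proof (induction J)
    case empty
    show ?case by (intro exI[of _ "\<lambda>_. 1"]) (simp add: power_sums_def sqsum_def)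
  next
    case (insert x J)
    have "\<exists>\<epsilon>. (\<forall>j. \<epsilon> j = 1 \<or> \<epsilon> j = - 1) \<and>
      s * sqsum (power_sums J l (\<lambda>j. b j * \<epsilon> j)) \<le> s * (\<Sum>j\<in>J. (cmod (b j))\<^sup>2 / (1 - (cmod (l j))\<^sup>2))"
      by (rule insert.IH) (use insert.prems in simp)
    then obtain \<epsilon> where \<epsilon>: "\<forall>j. \<epsilon> j = 1 \<or> \<epsilon> j = - 1"
      "s * sqsum (power_sums J l (\<lambda>j. b j * \<epsilon> j)) \<le> s * (\<Sum>j\<in>J. (cmod (b j))\<^sup>2 / (1 - (cmod (l j))\<^sup>2))"
      by (elim exE conjE)
    define X where "X c = sqsum (power_sums (insert x J) l (\<lambda>j. b j * (\<epsilon>(x := c)) j))" for c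
    define q where "q = (cmod (b x))\<^sup>2 / (1 - (cmod (l x))\<^sup>2)"
    define y where "y = sqsum (power_sums J l (\<lambda>j. b j * \<epsilon> j))"
    have "X 1 + X (-1) = 2 * q + 2 * y"
      unfolding X_def q_def y_def by (rule step[OF insert.hyps(1,2)]) (rule insert.prems)
    then have "s * X 1 + s * X (-1) = 2 * (s * q) + 2 * (s * y)"
      unfolding distrib_left[symmetric, of s] by (simp only: distrib_left mult.left_commute)
    then have "s * X 1 \<le> s * q + s * y \<or> s * X (-1) \<le> s * q + s * y" by linarith
    then obtain c where c: "c = 1 \<or> c = - 1" "s * X c \<le> s * q + s * y" by blast
    have "s * sqsum (power_sums (insert x J) l (\<lambda>j. b j * (\<epsilon>(x := c)) j))
        \<le> s * (\<Sum>j\<in>insert x J. (cmod (b j))\<^sup>2 / (1 - (cmod (l j))\<^sup>2))"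
      unfolding sum.insert[OF insert.hyps(1,2)] distrib_left using c(2) \<epsilon>(2) unfolding X_def q_def y_def by linarith
    moreover have "\<forall>j. (\<epsilon>(x := c)) j = 1 \<or> (\<epsilon>(x := c)) j = - 1" using \<epsilon>(1) c(1) by simp
    ultimately show ?case by blast
  qed
qed

lemma exists_common_radius:
  fixes l :: "'i \<Rightarrow> complex"
  assumes "finite J" "\<And>j. j \<in> J \<Longrightarrow> cmod (l j) < 1"
  obtains R :: real where "1 < R" "\<And>j. j \<in> J \<Longrightarrow> R * cmod (l j) < 1"
proof -
  define m where "m = Max (insert 0 ((\<lambda>j. cmod (l j)) ` J))"
  have m: "0 \<le> m" "m < 1" "\<And>j. j \<in> J \<Longrightarrow> cmod (l j) \<le> m"
    using assms by (auto simp: m_def)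
  have "2 / (1 + m) * cmod (l j) < 1" if "j \<in> J" for j
    using m m(3)[OF that] by (simp add: field_simps)
  then show ?thesis using m by (intro that[of "2 / (1 + m)"]) (auto simp: field_simps)
qed

text \<open>Sign changes are realised by multipliers of norm at most \<open>C\<close>. Undoing a choice of signs whose norm
  is small gives the upper bound, and applying one whose norm is large gives the lower bound.\<close>

lemma finite_Riesz_bounds:
  fixes l b :: "'i \<Rightarrow> complex"
  assumes J: "finite J" and l: "\<And>j. j \<in> J \<Longrightarrow> cmod (l j) < 1" and \<delta>: "\<delta> > 0"
    and sep: "\<And>j. j \<in> J \<Longrightarrow> \<delta> \<le> (\<Prod>k\<in>J - {j}. cmod ((l j - l k) / (1 - cnj (l k) * l j)))"
  defines "C \<equiv> exp 2 / \<delta> ^ 5"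
  shows "sqsum (power_sums J l b) \<le> C\<^sup>2 * (\<Sum>j\<in>J. (cmod (b j))\<^sup>2 / (1 - (cmod (l j))\<^sup>2))"
    and "(\<Sum>j\<in>J. (cmod (b j))\<^sup>2 / (1 - (cmod (l j))\<^sup>2)) \<le> C\<^sup>2 * sqsum (power_sums J l b)"
proof -
  obtain R where R: "1 < R" "\<And>j. j \<in> J \<Longrightarrow> R * cmod (l j) < 1"
    using exists_common_radius[OF J, of l] l by metis
  have mult: "sqsum (power_sums J l (\<lambda>j. b j * w j)) \<le> C\<^sup>2 * sqsum (power_sums J l b)"
    if w: "\<And>j. j \<in> J \<Longrightarrow> cmod (w j) \<le> 1" for b w
  proof -
    obtain \<phi> where \<phi>: "\<phi> holomorphic_on ball 0 R" "\<And>j. j \<in> J \<Longrightarrow> \<phi> (l j) = w j"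
        "\<And>z. cmod z = 1 \<Longrightarrow> cmod (\<phi> z) \<le> C"
      using interpolation_bounded[where l = l and w = w and R = R, OF J l \<delta> sep w R(2)] unfolding C_def by blast
    have "power_sums J l (\<lambda>j. b j * w j) = power_sums J l (\<lambda>j. b j * \<phi> (l j))"
      using \<phi>(2) by (auto simp: power_sums_def fun_eq_iff intro!: sum.cong)
    then show ?thesis using multiplier_bound[OF J l R \<phi>(1,3)] by simp
  qed
  have C: "0 \<le> C\<^sup>2" by simp
  from exists_signs[where l = l and b = b and s = 1, OF J l] obtain \<epsilon> where \<epsilon>: "\<And>j. \<epsilon> j = 1 \<or> \<epsilon> j = - 1"
    "sqsum (power_sums J l (\<lambda>j. b j * \<epsilon> j)) \<le> (\<Sum>j\<in>J. (cmod (b j))\<^sup>2 / (1 - (cmod (l j))\<^sup>2))"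
    unfolding mult_1 by blast
  have \<epsilon>1: "cmod (\<epsilon> j) \<le> 1" for j using \<epsilon>(1)[of j] by auto
  have "(\<lambda>j. b j * \<epsilon> j * \<epsilon> j) = b"
  proof
    fix j show "b j * \<epsilon> j * \<epsilon> j = b j" using \<epsilon>(1)[of j] by auto
  qed
  then have "sqsum (power_sums J l b) \<le> C\<^sup>2 * sqsum (power_sums J l (\<lambda>j. b j * \<epsilon> j))"
    using mult[of \<epsilon> "\<lambda>j. b j * \<epsilon> j", OF \<epsilon>1] by simp
  also have "\<dots> \<le> C\<^sup>2 * (\<Sum>j\<in>J. (cmod (b j))\<^sup>2 / (1 - (cmod (l j))\<^sup>2))"
    using \<epsilon>(2) C by (intro mult_left_mono)
  finally show "sqsum (power_sums J l b) \<le> C\<^sup>2 * (\<Sum>j\<in>J. (cmod (b j))\<^sup>2 / (1 - (cmod (l j))\<^sup>2))" .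
  from exists_signs[where l = l and b = b and s = "- 1", OF J l] obtain \<epsilon> where \<epsilon>: "\<And>j. \<epsilon> j = 1 \<or> \<epsilon> j = - 1"
    "(\<Sum>j\<in>J. (cmod (b j))\<^sup>2 / (1 - (cmod (l j))\<^sup>2)) \<le> sqsum (power_sums J l (\<lambda>j. b j * \<epsilon> j))"
    unfolding mult_minus1 neg_le_iff_le by blast
  have \<epsilon>1: "cmod (\<epsilon> j) \<le> 1" for j using \<epsilon>(1)[of j] by auto
  show "(\<Sum>j\<in>J. (cmod (b j))\<^sup>2 / (1 - (cmod (l j))\<^sup>2)) \<le> C\<^sup>2 * sqsum (power_sums J l b)"
    using \<epsilon>(2) mult[of \<epsilon> b, OF \<epsilon>1] by linarith
qed

text \<open>All factors are at most one, so the partial products decrease and dominate their limit.\<close>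

lemma uniformly_separated_finite:
  assumes "uniformly_separated lam"
  obtains \<delta> where "\<delta> > 0"
    "\<And>N j. \<delta> \<le> (\<Prod>k\<in>{..<N} - {j}. cmod ((lam j - lam k) / (1 - cnj (lam k) * lam j)))"
proof -
  have l: "cmod (lam j) < 1" for j using assms by (simp add: uniformly_separated_def)
  define \<rho> where "\<rho> j k = cmod ((lam j - lam k) / (1 - cnj (lam k) * lam j))" for j k
  have \<rho>: "0 \<le> \<rho> j k" "\<rho> j k \<le> 1" for j k
    unfolding \<rho>_def by (simp, rule pseudohyperbolic_le_1[OF l l])
  define Q where "Q j N = (\<Prod>k\<in>{..<N} - {j}. \<rho> j k)" for j N
  have Q_nonneg: "0 \<le> Q j N" for j N unfolding Q_def by (intro prod_nonneg) (simp add: \<rho>)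
  have dec: "decseq (Q j)" for j
  proof (rule decseq_SucI)
    fix N
    show "Q j (Suc N) \<le> Q j N"
    proof (cases "N = j")
      case True
      then have "{..<Suc N} - {j} = {..<N} - {j}" by auto
      then show ?thesis by (simp add: Q_def)
    next
      case False
      then have "{..<Suc N} - {j} = insert N ({..<N} - {j})" by auto
      then have "Q j (Suc N) = \<rho> j N * Q j N" by (simp add: Q_def)
      also have "\<dots> \<le> 1 * Q j N" using \<rho> Q_nonneg by (intro mult_right_mono) auto
      finally show ?thesis by simp
    qed
  qed
  have conv: "Q j \<longlonglongrightarrow> lim (Q j)" for j
  proof -
    obtain L where "Q j \<longlonglongrightarrow> L" using decseq_convergent[OF dec[of j], of 0] Q_nonneg by metis
    then show ?thesis by (simp add: limI)
  qed
  have lim_le: "lim (Q j) \<le> Q j N" for j N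
    using decseq_ge[OF dec conv] by simp
  have lim_nonneg: "0 \<le> lim (Q j)" for j
    by (rule LIMSEQ_le_const[OF conv]) (auto intro: Q_nonneg)
  define \<delta> where "\<delta> = (INF j. lim (Q j))"
  have "\<delta> > 0" using assms unfolding uniformly_separated_def \<delta>_def Q_def \<rho>_def by blast
  moreover have "\<delta> \<le> lim (Q j)" for j
    unfolding \<delta>_def by (intro cINF_lower bdd_belowI[of _ 0]) (auto intro: lim_nonneg)
  ultimately show ?thesis
    using lim_le by (intro that[of \<delta>]) (auto simp: Q_def \<rho>_def intro: order_trans)
qed


text \<open>The bounds for finitely many points do not depend on their number. The upper bound, applied to
  tails, shows that the truncated sequences converge in \<open>\<ell>\<^sup>2\<close>, which carries the lower bound to the limit.\<close>

lemma Carleson_frame_bounds: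
  fixes lam h :: "nat \<Rightarrow> complex"
  assumes sep: "uniformly_separated lam" and c0: "0 < c0" and C0: "0 < C0"
    and h: "\<And>j. c0 * (cmod (h j))\<^sup>2 \<le> 1 - (cmod (lam j))\<^sup>2" "\<And>j. 1 - (cmod (lam j))\<^sup>2 \<le> C0 * (cmod (h j))\<^sup>2"
  shows "\<exists>A B. A > 0 \<and> B > 0 \<and>
    (\<forall>G W. summable (\<lambda>j. (cmod (G j))\<^sup>2) \<longrightarrow> (\<forall>k. (\<lambda>j. G j * cnj (lam j ^ k * h j)) sums W k) \<longrightarrow>
       summable (\<lambda>k. (cmod (W k))\<^sup>2) \<and> A * sqsum G \<le> sqsum W \<and> sqsum W \<le> B * sqsum G)"
proof -
  have l: "cmod (lam j) < 1" for j using sep by (simp add: uniformly_separated_def)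
  define p where "p j = 1 - (cmod (lam j))\<^sup>2" for j
  have p: "p j > 0" for j using l[of j] by (simp add: p_def power_less_one_iff)
  obtain \<delta> where \<delta>: "\<delta> > 0"
    "\<And>N j. \<delta> \<le> (\<Prod>k\<in>{..<N} - {j}. cmod ((lam j - lam k) / (1 - cnj (lam k) * lam j)))"
    using uniformly_separated_finite[OF sep] by metis
  define K where "K = (exp 2 / \<delta> ^ 5)\<^sup>2"
  have K: "K > 0" using \<delta>(1) by (simp add: K_def)
  note fin = finite_Riesz_bounds[where l = lam and \<delta> = \<delta>, OF finite_lessThan l \<delta>(1) \<delta>(2), folded K_def p_def]
  define A where "A = 1 / (2 * C0 * K)"
  define B where "B = K / c0"
  have AB: "A > 0" "B > 0" using K c0 C0 by (auto simp: A_def B_def)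
  have "summable (\<lambda>k. (cmod (W k))\<^sup>2) \<and> A * sqsum G \<le> sqsum W \<and> sqsum W \<le> B * sqsum G"
    if G: "summable (\<lambda>j. (cmod (G j))\<^sup>2)" and W: "\<And>k. (\<lambda>j. G j * cnj (lam j ^ k * h j)) sums W k" for G W
  proof -
    define b where "b j = cnj (G j) * h j" for j
    define x where "x N = power_sums {..<N} lam b" for N
    define y where "y k = cnj (W k)" for k
    have x_y: "(\<lambda>N. x N k) \<longlonglongrightarrow> y k" for k
    proof -
      have "(\<lambda>j. cnj (G j * cnj (lam j ^ k * h j))) sums y k"
        unfolding y_def using W[of k] by (simp only: sums_cnj)
      then show ?thesis by (simp add: x_def power_sums_def b_def sums_def mult_ac)
    qed
    have b_le: "(cmod (b j))\<^sup>2 / p j \<le> (cmod (G j))\<^sup>2 / c0" and b_ge: "(cmod (G j))\<^sup>2 / C0 \<le> (cmod (b j))\<^sup>2 / p j" for j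
    proof -
      have *: "(cmod (b j))\<^sup>2 = (cmod (G j))\<^sup>2 * (cmod (h j))\<^sup>2"
        by (simp add: b_def norm_mult power_mult_distrib)
      have "(cmod (G j))\<^sup>2 * (c0 * (cmod (h j))\<^sup>2) \<le> (cmod (G j))\<^sup>2 * p j"
        unfolding p_def by (intro mult_left_mono h) auto
      then show "(cmod (b j))\<^sup>2 / p j \<le> (cmod (G j))\<^sup>2 / c0"
        using c0 p[of j] by (simp add: * field_simps)
      have "(cmod (G j))\<^sup>2 * p j \<le> (cmod (G j))\<^sup>2 * (C0 * (cmod (h j))\<^sup>2)"
        unfolding p_def by (intro mult_left_mono h) auto
      then show "(cmod (G j))\<^sup>2 / C0 \<le> (cmod (b j))\<^sup>2 / p j"
        using C0 p[of j] by (simp add: * field_simps)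
    qed
    define T where "T N = (\<Sum>j<N. (cmod (G j))\<^sup>2)" for N
    have T: "T \<longlonglongrightarrow> sqsum G" unfolding T_def sqsum_def by (rule summable_LIMSEQ[OF G])
    have T_le: "T N \<le> sqsum G" for N
      unfolding T_def sqsum_def by (rule sum_le_suminf[OF G]) auto
    have x_sq: "summable (\<lambda>k. (cmod (x N k))\<^sup>2)" for N
      unfolding x_def by (rule power_sums_sq_summable) (use l in auto)
    have lower: "T N / (C0 * K) \<le> sqsum (x N)" for N
    proof -
      have "T N / C0 \<le> (\<Sum>j<N. (cmod (b j))\<^sup>2 / p j)"
        unfolding T_def sum_divide_distrib by (intro sum_mono b_ge)
      also have "\<dots> \<le> K * sqsum (x N)" unfolding x_def by (rule fin(2))
      finally show ?thesis using K C0 by (simp add: field_simps)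
    qed
    have diff: "(\<Sum>k<k0. (cmod (y k - x N k))\<^sup>2) \<le> B * (sqsum G - T N)" for N k0
    proof (rule LIMSEQ_le_const2)
      show "(\<lambda>M. \<Sum>k<k0. (cmod (x M k - x N k))\<^sup>2) \<longlonglongrightarrow> (\<Sum>k<k0. (cmod (y k - x N k))\<^sup>2)"
        by (intro tendsto_intros x_y)
      show "\<exists>M0. \<forall>M\<ge>M0. (\<Sum>k<k0. (cmod (x M k - x N k))\<^sup>2) \<le> B * (sqsum G - T N)"
      proof (intro exI[of _ N] allI impI)
        fix M assume NM: "N \<le> M"
        define b' where "b' j = (if j < N then 0 else b j)" for j
        have split: "{..<M} = {..<N} \<union> {N..<M}" using NM by auto
        have x_diff: "x M k - x N k = power_sums {..<M} lam b' k" for k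
          unfolding x_def power_sums_def split
          by (subst (1 2) sum.union_disjoint) (auto simp: b'_def)
        have sm: "summable (\<lambda>k. (cmod (power_sums {..<M} lam b' k))\<^sup>2)"
          by (rule power_sums_sq_summable) (use l in auto)
        have "(\<Sum>k<k0. (cmod (x M k - x N k))\<^sup>2) \<le> sqsum (power_sums {..<M} lam b')"
          unfolding x_diff sqsum_def by (rule sum_le_suminf[OF sm]) auto
        also have "\<dots> \<le> K * (\<Sum>j<M. (cmod (b' j))\<^sup>2 / p j)" by (rule fin(1))
        also have "(\<Sum>j<M. (cmod (b' j))\<^sup>2 / p j) = (\<Sum>j=N..<M. (cmod (b j))\<^sup>2 / p j)"
          unfolding split by (subst sum.union_disjoint) (auto simp: b'_def)
        also have "K * \<dots> \<le> K * (\<Sum>j=N..<M. (cmod (G j))\<^sup>2 / c0)"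
          using K by (intro mult_left_mono sum_mono b_le) auto
        also have "\<dots> = B * (T M - T N)"
        proof -
          have "T M = T N + (\<Sum>j=N..<M. (cmod (G j))\<^sup>2)"
            unfolding T_def split by (subst sum.union_disjoint) auto
          then show ?thesis by (simp add: B_def flip: sum_divide_distrib)
        qed
        also have "\<dots> \<le> B * (sqsum G - T N)" using AB T_le[of M] by (intro mult_left_mono) auto
        finally show "(\<Sum>k<k0. (cmod (x M k - x N k))\<^sup>2) \<le> B * (sqsum G - T N)" .
      qed
    qed
    have d_sum: "summable (\<lambda>k. (cmod (y k - x N k))\<^sup>2)" for N
      by (rule summableI_nonneg_bounded[OF _ diff]) simp
    have d_le: "sqsum (\<lambda>k. y k - x N k) \<le> B * (sqsum G - T N)" for N
      using suminf_le_const[OF d_sum diff] by (simp add: sqsum_def[of "\<lambda>k. y k - x N k"])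
    have x0: "x 0 k = 0" for k by (simp add: x_def power_sums_def)
    have y_sum: "summable (\<lambda>k. (cmod (y k))\<^sup>2)" using d_sum[of 0] by (simp add: x0)
    have y_le: "sqsum y \<le> B * sqsum G" using d_le[of 0] by (simp add: x0 T_def)
    have "T N / (C0 * K) \<le> 2 * sqsum y + 2 * (B * (sqsum G - T N))" for N
    proof -
      have *: "(cmod (x N k))\<^sup>2 \<le> 2 * (cmod (y k))\<^sup>2 + 2 * (cmod (y k - x N k))\<^sup>2" for k
      proof -
        have "(cmod (x N k))\<^sup>2 \<le> (cmod (y k) + cmod (y k - x N k))\<^sup>2"
          using norm_triangle_ineq4[of "y k" "y k - x N k"] by (intro power_mono) auto
        then show ?thesis
          using sum_squares_bound[of "cmod (y k)" "cmod (y k - x N k)"] by (simp add: power2_sum)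
      qed
      have "T N / (C0 * K) \<le> sqsum (x N)" by (rule lower)
      also have "\<dots> \<le> (\<Sum>k. 2 * (cmod (y k))\<^sup>2 + 2 * (cmod (y k - x N k))\<^sup>2)"
        unfolding sqsum_def by (rule suminf_le[OF * x_sq]) (intro summable_add summable_mult y_sum d_sum)
      also have "\<dots> = 2 * sqsum y + 2 * sqsum (\<lambda>k. y k - x N k)"
        unfolding sqsum_def using y_sum d_sum
        by (subst suminf_add[symmetric]) (auto intro!: summable_mult simp: suminf_mult)
      finally show ?thesis using d_le[of N] by linarith
    qed
    then have bound: "\<exists>N0. \<forall>N\<ge>N0. T N / (C0 * K) \<le> 2 * sqsum y + 2 * (B * (sqsum G - T N))" by blast
    have "sqsum G / (C0 * K) \<le> 2 * sqsum y + 2 * (B * (sqsum G - sqsum G))"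
    proof (rule LIMSEQ_le[OF _ _ bound])
      show "(\<lambda>N. T N / (C0 * K)) \<longlonglongrightarrow> sqsum G / (C0 * K)"
        using K C0 by (intro tendsto_divide T tendsto_const) simp
      show "(\<lambda>N. 2 * sqsum y + 2 * (B * (sqsum G - T N))) \<longlonglongrightarrow> 2 * sqsum y + 2 * (B * (sqsum G - sqsum G))"
        by (intro tendsto_intros T)
    qed
    then have "A * sqsum G \<le> sqsum y" using K C0 by (simp add: A_def field_simps)
    moreover have "sqsum y = sqsum W" by (simp add: sqsum_def y_def)
    ultimately show ?thesis using y_sum y_le by (simp add: y_def)
  qed
  with AB show ?thesis by blast
qed

section \<open>Characters of the torus\<close>

lemma continuous_on_torus_character: "continuous_on S (torus_character k)"
  unfolding torus_character_def by (intro continuous_intros)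

lemma norm_torus_character [simp]: "cmod (torus_character k \<xi>) = 1"
  by (simp add: torus_character_def norm_exp_eq_Re)

lemma torus_character_add: "torus_character (k + l) \<xi> = torus_character k \<xi> * torus_character l \<xi>"
  by (simp add: torus_character_def ring_distribs sum.distrib flip: exp_add)

lemma torus_character_cnj: "cnj (torus_character k \<xi>) = torus_character (- k) \<xi>"
  by (simp add: torus_character_def exp_cnj sum_negf)

lemma torus_character_measurable: "torus_character k \<in> borel_measurable torus_measure"
  by (rule continuous_imp_measurable_on_sets_lebesgue[OF continuous_on_torus_character torus_lebesgue])

lemma L2_mult_bounded:
  assumes g: "g \<in> L2 E" and m: "m \<in> borel_measurable torus_measure" and K: "\<And>\<xi>. \<xi> \<in> torus \<Longrightarrow> cmod (m \<xi>) \<le> K"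
  shows "(\<lambda>\<xi>. m \<xi> * g \<xi>) \<in> L2 E"
proof -
  note [measurable] = L2_measurable[OF g] m
  have "integrable torus_measure (\<lambda>\<xi>. K\<^sup>2 * (cmod (g \<xi>))\<^sup>2)" using L2_integrable_sq[OF g] by simp
  then have "integrable torus_measure (\<lambda>\<xi>. (cmod (m \<xi> * g \<xi>))\<^sup>2)"
  proof (rule Bochner_Integration.integrable_bound)
    show "AE \<xi> in torus_measure. norm ((cmod (m \<xi> * g \<xi>))\<^sup>2) \<le> norm (K\<^sup>2 * (cmod (g \<xi>))\<^sup>2)"
      using K by (intro AE_I2) (auto simp: norm_mult power_mult_distrib intro!: mult_right_mono power_mono)
  qed measurable
  moreover have "AE \<xi> in torus_measure. \<xi> \<notin> E \<longrightarrow> m \<xi> * g \<xi> = 0"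
    using L2_AE_zero[OF g] by eventually_elim auto
  ultimately show ?thesis by (simp add: L2_def)
qed

lemma torus_character_L2: "torus_character k \<in> L2 torus"
  using L2_mult_bounded[OF L2_one torus_character_measurable, of k 1] by simp

lemma integral_exp_unit_interval:
  fixes k :: int
  shows "integrable lborel (\<lambda>t :: real. indicator {- 1 / 2..<1 / 2} t *\<^sub>R exp (2 * of_real pi * \<i> * of_int k * of_real t))" (is ?A)
    and "(LINT t|lborel. indicator {- 1 / 2..<1 / 2} t *\<^sub>R exp (2 * of_real pi * \<i> * of_int k * of_real t))
        = (if k = 0 then 1 else 0)" (is ?B)
proof -
  let ?f = "\<lambda>t :: real. exp (2 * of_real pi * \<i> * of_int k * of_real t)"
  show i: ?A
  proof (rule Bochner_Integration.integrable_bound)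
    show "integrable lborel (indicator {- 1 / 2..<1 / 2 :: real} :: real \<Rightarrow> real)" by simp
    show "(\<lambda>t. indicator {- 1 / 2..<1 / 2} t *\<^sub>R ?f t) \<in> borel_measurable lborel"
      by (intro borel_measurable_scaleR borel_measurable_indicator)
        (auto intro!: borel_measurable_continuous_onI continuous_intros)
  qed (auto simp: indicator_def norm_exp_eq_Re)
  then have "(LINT t|lborel. indicator {- 1 / 2..<1 / 2} t *\<^sub>R ?f t) = integral {- 1 / 2..<1 / 2} ?f"
    using set_borel_integral_eq_integral(2)[of "{- 1 / 2..<1 / 2}" ?f] by (simp add: set_integrable_def set_lebesgue_integral_def)
  also have "\<dots> = integral {- 1 / 2..1 / 2} ?f"
  proof (rule integral_subset_negligible)
    have "{- 1 / 2..1 / 2} - {- 1 / 2..<1 / 2} = {1 / 2 :: real}" by auto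
    then show "negligible ({- 1 / 2..1 / 2} - {- 1 / 2..<1 / 2 :: real})" by simp
  qed auto
  also have "\<dots> = (if k = 0 then 1 else 0)"
    using has_integral_exp_int[of k "- 1 / 2"] by (intro integral_unique) simp
  finally show ?B .
qed

lemma Basis_vec_eq: "(Basis :: (real ^ 'n) set) = range (\<lambda>j. axis j 1)"
  by (auto simp: Basis_vec_def)

lemma inj_axis: "inj (\<lambda>j :: 'n :: finite. axis j (1 :: real))"
  by (auto simp: inj_on_def axis_eq_axis)

lemma torus_character_integral:
  "(LINT \<xi>|torus_measure. torus_character k (\<xi> :: real ^ 'n)) = (if k = 0 then 1 else 0)"
proof -
  define g where "g j t = indicator {- 1 / 2..<1 / 2} t *\<^sub>R exp (2 * of_real pi * \<i> * of_int (k $ j) * of_real t)"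
    for j and t :: real
  define ix where "ix = inv (\<lambda>j :: 'n. axis j (1 :: real))"
  have ix [simp]: "ix (axis j 1) = j" for j unfolding ix_def by (rule inv_f_f[OF inj_axis])
  interpret product_sigma_finite "\<lambda>b :: real ^ 'n. lborel :: real measure" ..
  have g_meas: "g j \<in> borel_measurable borel" for j
    using borel_measurable_integrable[OF integral_exp_unit_interval(1)] by (simp add: g_def[abs_def])
  have g_int: "integral\<^sup>L lborel (g j) = (if k $ j = 0 then 1 else 0)" for j
    unfolding g_def[abs_def] by (rule integral_exp_unit_interval(2))
  have prod_eq: "indicator torus \<xi> *\<^sub>R torus_character k \<xi> = (\<Prod>j\<in>UNIV. g j (\<xi> $ j))" for \<xi> :: "real ^ 'n"
  proof (cases "\<xi> \<in> torus")
    case True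
    then have "g j (\<xi> $ j) = exp (2 * of_real pi * \<i> * of_int (k $ j) * of_real (\<xi> $ j))" for j
      by (auto simp: g_def torus_def indicator_def)
    then show ?thesis using True
      by (simp add: torus_character_def sum_distrib_left mult.assoc flip: exp_sum)
  next
    case False
    then obtain j where "\<not> (- 1 / 2 \<le> \<xi> $ j \<and> \<xi> $ j < 1 / 2)" by (auto simp: torus_def)
    then have "g j (\<xi> $ j) = 0" by (auto simp: g_def indicator_def)
    then have "(\<Prod>j\<in>UNIV. g j (\<xi> $ j)) = 0" by (intro prod_zero) auto
    then show ?thesis using False by simp
  qed
  have char_meas: "torus_character k \<in> borel_measurable borel"
    by (intro borel_measurable_continuous_onI continuous_on_torus_character)
  have "(LINT \<xi>|torus_measure. torus_character k \<xi>) = (LINT \<xi>|lebesgue. indicator torus \<xi> *\<^sub>R torus_character k \<xi>)"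
    using torus_lebesgue by (intro integral_restrict_space) simp
  also have "\<dots> = (LINT \<xi>|lborel. indicator torus \<xi> *\<^sub>R torus_character k \<xi>)"
    using char_meas by (intro integral_completion) (auto intro!: borel_measurable_scaleR borel_measurable_indicator)
  also have "\<dots> = (LINT \<xi>|lborel. (\<Prod>b\<in>Basis. g (ix b) (\<xi> \<bullet> b)))"
    unfolding prod_eq Basis_vec_eq
    by (subst prod.reindex[OF inj_axis]) (simp add: inner_axis o_def)
  also have "\<dots> = (LINT f|(\<Pi>\<^sub>M b\<in>Basis. lborel). (\<Prod>b\<in>Basis. g (ix b) ((\<Sum>b'\<in>Basis. f b' *\<^sub>R b') \<bullet> b)))"
    using g_meas by (subst lborel_eq, intro integral_distr) auto
  also have "\<dots> = (LINT f|(\<Pi>\<^sub>M b\<in>Basis. lborel). (\<Prod>b\<in>Basis. g (ix b) (f b)))"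
    by (intro Bochner_Integration.integral_cong prod.cong refl) simp
  also have "\<dots> = (\<Prod>b\<in>Basis. LINT t|lborel. g (ix b) t)"
    using integral_exp_unit_interval(1) by (intro product_integral_prod) (simp_all add: g_def[abs_def])
  also have "\<dots> = (\<Prod>j\<in>UNIV. if k $ j = 0 then 1 else 0)"
    unfolding Basis_vec_eq
    by (subst prod.reindex[OF inj_axis]) (simp add: o_def g_int)
  also have "\<dots> = (if k = 0 then 1 else 0)"
    by (auto simp: vec_eq_iff intro!: prod_zero)
  finally show ?thesis .
qed

lemma torus_character_orthonormal: "L2_orthonormal torus torus_character"
proof -
  have "torus_character i \<xi> * cnj (torus_character j \<xi>) = torus_character (i - j) \<xi>" for i j and \<xi> :: "real ^ 'a"
    by (simp add: torus_character_cnj flip: torus_character_add)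
  then show ?thesis
    by (simp add: L2_orthonormal_def torus_character_L2 L2_inner_def torus_character_integral)
qed

section \<open>Completeness of the characters\<close>

text \<open>Completeness of the characters means that its elements vanish almost everywhere.\<close>

definition character_annihilator :: "(real ^ 'n \<Rightarrow> complex) set" where
  "character_annihilator = {g \<in> L2 torus. \<forall>k. L2_inner g (torus_character k) = 0}"

text \<open>The torus as a compact subset of \<open>\<complex>\<^sup>n\<close>. Periodic functions do not separate opposite faces of
  the closed cube, but they separate the points of this compact set.\<close>

definition circle_embed :: "real ^ 'n \<Rightarrow> complex ^ 'n" where
  "circle_embed \<xi> = (\<chi> j. exp (2 * of_real pi * \<i> * of_real (\<xi> $ j)))"

lemma circle_embed_nth: "circle_embed \<xi> $ j = torus_character (axis j 1) \<xi>"
proof -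
  have "(\<Sum>i\<in>UNIV. real_of_int (axis j 1 $ i) * \<xi> $ i) = (\<Sum>i\<in>UNIV. if i = j then \<xi> $ i else 0)"
    by (intro sum.cong) (auto simp: axis_def)
  then show ?thesis by (simp add: circle_embed_def torus_character_def)
qed

lemma continuous_on_circle_embed: "continuous_on S circle_embed"
  unfolding circle_embed_def by (intro continuous_intros)

lemma inj_on_circle_embed: "inj_on circle_embed torus"
proof (rule inj_onI)
  fix x y :: "real ^ 'n" assume x: "x \<in> torus" and y: "y \<in> torus" and eq: "circle_embed x = circle_embed y"
  show "x = y" unfolding vec_eq_iff
  proof
    fix j
    have "exp (2 * of_real pi * \<i> * of_real (x $ j)) = exp (2 * of_real pi * \<i> * of_real (y $ j))"
      using arg_cong[OF eq, of "\<lambda>v. v $ j"] by (simp add: circle_embed_def)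
    then obtain n :: int where "2 * of_real pi * \<i> * of_real (x $ j) = 2 * of_real pi * \<i> * of_real (y $ j) + (of_int (2 * n) * pi) * \<i>"
      unfolding exp_eq by auto
    then have "Im (2 * of_real pi * \<i> * of_real (x $ j)) = Im (2 * of_real pi * \<i> * of_real (y $ j) + (of_int (2 * n) * pi) * \<i>)"
      by simp
    then have "2 * pi * (x $ j) = 2 * pi * (y $ j + of_int n)" by (simp add: algebra_simps)
    then have n: "x $ j = y $ j + of_int n" by simp
    have "\<bar>x $ j - y $ j\<bar> < 1" using x y by (auto simp: torus_def abs_less_iff) (smt (verit) field_sum_of_halves)+
    then have "n = 0" using n by simp
    then show "x $ j = y $ j" using n by simp
  qed
qed

lemma circle_embed_torus_compact: "compact (circle_embed ` (torus :: (real ^ 'n) set))"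
proof -
  have "circle_embed ` (torus :: (real ^ 'n) set) = circle_embed ` cbox (\<chi> j. - 1 / 2) (\<chi> j. 1 / 2)" (is "_ = _ ` ?B")
  proof
    show "circle_embed ` torus \<subseteq> circle_embed ` ?B"
      by (rule image_mono) (auto simp: torus_def mem_box_cart less_imp_le)
    show "circle_embed ` ?B \<subseteq> circle_embed ` torus"
    proof
      fix w assume "w \<in> circle_embed ` ?B"
      then obtain x where x: "w = circle_embed x" "\<And>j. - 1 / 2 \<le> x $ j \<and> x $ j \<le> 1 / 2"
        by (auto simp: mem_box_cart)
      define y where "y = (\<chi> j. if x $ j = 1 / 2 then - 1 / 2 else x $ j)"
      have "circle_embed x = circle_embed y"
      proof -
        have "exp (2 * of_real pi * \<i> * of_real (x $ j)) = exp (2 * of_real pi * \<i> * of_real (y $ j))" for j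
        proof (cases "x $ j = 1 / 2")
          case True
          then have y: "y $ j = - 1 / 2" by (simp add: y_def)
          have "exp (2 * of_real pi * \<i> * of_real (1 / 2)) = - 1" "exp (2 * of_real pi * \<i> * of_real (- 1 / 2)) = - 1"
            by (simp_all add: exp_minus)
          then show ?thesis unfolding True y by metis
        next
          case False
          then show ?thesis by (simp add: y_def)
        qed
        then show ?thesis by (simp add: circle_embed_def)
      qed
      moreover have "y \<in> torus" using x(2) by (force simp: torus_def y_def order_less_le)
      ultimately show "w \<in> circle_embed ` torus" using x(1) by blast
    qed
  qed
  then show ?thesis
    using compact_continuous_image[OF continuous_on_circle_embed compact_cbox] by simp
qed


lemma annihilator_multiplier:
  fixes r :: "complex ^ 'n \<Rightarrow> real"
  assumes r: "continuous_on (circle_embed ` torus) r" and g: "g \<in> L2 torus"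
  shows "(\<lambda>\<xi>. of_real (r (circle_embed \<xi>)) * g \<xi>) \<in> L2 torus"
proof -
  have "compact (r ` circle_embed ` torus)"
    by (rule compact_continuous_image[OF r circle_embed_torus_compact])
  then obtain K where "\<forall>x\<in>r ` circle_embed ` torus. norm x \<le> K"
    using compact_imp_bounded bounded_iff by metis
  then have K: "\<And>\<xi>. \<xi> \<in> torus \<Longrightarrow> \<bar>r (circle_embed \<xi>)\<bar> \<le> K" by auto
  have "continuous_on torus (\<lambda>\<xi>. complex_of_real (r (circle_embed \<xi>)))"
    by (intro continuous_intros continuous_on_compose2[OF r continuous_on_circle_embed] order_refl)
  then have "(\<lambda>\<xi>. complex_of_real (r (circle_embed \<xi>))) \<in> borel_measurable torus_measure"
    by (rule continuous_imp_measurable_on_sets_lebesgue[OF _ torus_lebesgue])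
  then show ?thesis by (rule L2_mult_bounded[OF g]) (use K in simp)
qed

text \<open>Multiplication by a character only permutes the Fourier coefficients.\<close>

lemma character_annihilator_shift:
  assumes g: "g \<in> character_annihilator"
  shows "(\<lambda>\<xi>. torus_character m \<xi> * g \<xi>) \<in> character_annihilator"
proof -
  have gL: "g \<in> L2 torus" and g0: "\<And>k. L2_inner g (torus_character k) = 0"
    using g by (auto simp: character_annihilator_def)
  have "L2_inner (\<lambda>\<xi>. torus_character m \<xi> * g \<xi>) (torus_character k) = L2_inner g (torus_character (k - m))" for k
  proof -
    have "torus_character m \<xi> * g \<xi> * cnj (torus_character k \<xi>) = g \<xi> * cnj (torus_character (k - m) \<xi>)" for \<xi>
    proof -
      have "torus_character m \<xi> * cnj (torus_character k \<xi>) = cnj (torus_character (k - m) \<xi>)"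
        by (simp add: torus_character_cnj flip: torus_character_add)
      then show ?thesis by (simp add: mult_ac)
    qed
    then show ?thesis by (simp only: L2_inner_def)
  qed
  then show ?thesis
    using L2_mult_bounded[OF gL torus_character_measurable, of m 1] g0
    by (simp add: character_annihilator_def)
qed

lemma character_annihilator_combine:
  assumes "g \<in> character_annihilator" "h \<in> character_annihilator"
  shows "(\<lambda>\<xi>. a * g \<xi> + b * h \<xi>) \<in> character_annihilator"
proof -
  have g: "(\<lambda>\<xi>. a * g \<xi>) \<in> L2 torus" and h: "(\<lambda>\<xi>. b * h \<xi>) \<in> L2 torus"
    using assms by (auto simp: character_annihilator_def intro: L2_scale)
  show ?thesis
    using assms L2_add[OF g h] L2_inner_add_left[OF g h torus_character_L2]
    by (simp add: character_annihilator_def L2_inner_scale_left)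
qed

text \<open>The real functions on the embedded torus that multiply the annihilator into itself form an
  algebra separating points, so the Stone--Weierstrass theorem applies to them.\<close>

definition annihilator_multipliers :: "(complex ^ 'n \<Rightarrow> real) set" where
  "annihilator_multipliers = {r. continuous_on (circle_embed ` torus) r \<and>
     (\<forall>g\<in>character_annihilator. (\<lambda>\<xi>. of_real (r (circle_embed \<xi>)) * g \<xi>) \<in> character_annihilator)}"

lemma function_ring_multipliers:
  "function_ring_on annihilator_multipliers (circle_embed ` (torus :: (real ^ 'n) set))"
proof
  show "compact (circle_embed ` (torus :: (real ^ 'n) set))" by (rule circle_embed_torus_compact)
next
  fix f g :: "complex ^ 'n \<Rightarrow> real"
  assume f: "f \<in> annihilator_multipliers"
  then show "continuous_on (circle_embed ` torus) f" by (simp add: annihilator_multipliers_def)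
  assume g: "g \<in> annihilator_multipliers"
  show "(\<lambda>x. f x + g x) \<in> annihilator_multipliers"
    using f g character_annihilator_combine[where a = 1 and b = 1]
    by (auto simp: annihilator_multipliers_def ring_distribs intro!: continuous_on_add)
  show "(\<lambda>x. f x * g x) \<in> annihilator_multipliers"
    using f g by (auto simp: annihilator_multipliers_def mult.assoc intro!: continuous_on_mult)
next
  fix c :: real
  show "(\<lambda>_. c) \<in> annihilator_multipliers"
    using character_annihilator_combine[where a = "of_real c" and b = 0]
    by (auto simp: annihilator_multipliers_def)
next
  fix x y :: "complex ^ 'n" assume "x \<noteq> y"
  then obtain j where j: "x $ j \<noteq> y $ j" by (auto simp: vec_eq_iff)
  have "(\<lambda>w :: complex ^ 'n. Re (w $ j)) \<in> annihilator_multipliers"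
  proof -
    have "complex_of_real (Re (circle_embed \<xi> $ j)) * g \<xi>
        = (1 / 2) * (torus_character (axis j 1) \<xi> * g \<xi>) + (1 / 2) * (torus_character (- axis j 1) \<xi> * g \<xi>)"
      for g and \<xi> :: "real ^ 'n"
      unfolding torus_character_cnj[symmetric] circle_embed_nth
      by (simp add: complex_eq_iff field_simps)
    note eq = this
    show ?thesis
      unfolding annihilator_multipliers_def
    proof (intro CollectI conjI ballI)
      show "continuous_on (circle_embed ` torus) (\<lambda>w :: complex ^ 'n. Re (w $ j))" by (intro continuous_intros)
      fix g :: "real ^ 'n \<Rightarrow> complex" assume "g \<in> character_annihilator"
      then show "(\<lambda>\<xi>. complex_of_real (Re (circle_embed \<xi> $ j)) * g \<xi>) \<in> character_annihilator"
        unfolding ext[OF eq[of _ g]] by (intro character_annihilator_combine character_annihilator_shift)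
    qed
  qed
  moreover have "(\<lambda>w :: complex ^ 'n. Im (w $ j)) \<in> annihilator_multipliers"
  proof -
    have "complex_of_real (Im (circle_embed \<xi> $ j)) * g \<xi>
        = (- \<i> / 2) * (torus_character (axis j 1) \<xi> * g \<xi>) + (\<i> / 2) * (torus_character (- axis j 1) \<xi> * g \<xi>)"
      for g and \<xi> :: "real ^ 'n"
      unfolding torus_character_cnj[symmetric] circle_embed_nth
      by (simp add: complex_eq_iff field_simps)
    note eq = this
    show ?thesis
      unfolding annihilator_multipliers_def
    proof (intro CollectI conjI ballI)
      show "continuous_on (circle_embed ` torus) (\<lambda>w :: complex ^ 'n. Im (w $ j))" by (intro continuous_intros)
      fix g :: "real ^ 'n \<Rightarrow> complex" assume "g \<in> character_annihilator"
      then show "(\<lambda>\<xi>. complex_of_real (Im (circle_embed \<xi> $ j)) * g \<xi>) \<in> character_annihilator"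
        unfolding ext[OF eq[of _ g]] by (intro character_annihilator_combine character_annihilator_shift)
    qed
  qed
  ultimately show "\<exists>f\<in>annihilator_multipliers. f x \<noteq> f y"
    using j unfolding complex_eq_iff by (metis (no_types, lifting))
qed

lemma annihilator_integral_continuous:
  fixes u :: "complex ^ 'n \<Rightarrow> real"
  assumes g: "g \<in> character_annihilator" and u: "continuous_on (circle_embed ` torus) u"
  shows "(LINT \<xi>|torus_measure. of_real (u (circle_embed \<xi>)) * g \<xi>) = 0"
proof -
  interpret function_ring_on annihilator_multipliers "circle_embed ` (torus :: (real ^ 'n) set)"
    by (rule function_ring_multipliers)
  have gL: "g \<in> L2 torus" using g by (simp add: character_annihilator_def)
  have one: "torus_character (0 :: int ^ 'n) = (\<lambda>_. 1)" by (simp add: torus_character_def fun_eq_iff)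
  define X where "X = cmod (LINT \<xi>|torus_measure. of_real (u (circle_embed \<xi>)) * g \<xi>)"
  define N where "N = (LINT \<xi>|torus_measure. cmod (g \<xi>))"
  have int_g: "integrable torus_measure (\<lambda>\<xi>. cmod (g \<xi>))"
    using L2_integrable_product(2)[OF gL L2_one] by simp
  have N: "0 \<le> N" by (simp add: N_def)
  have bound: "X \<le> e * N" if e: "e > 0" for e
  proof -
    obtain r where r: "r \<in> annihilator_multipliers" "\<And>w. w \<in> circle_embed ` torus \<Longrightarrow> \<bar>u w - r w\<bar> < e"
      using Stone_Weierstrass_basic[OF u e] by blast
    have rc: "continuous_on (circle_embed ` torus) r"
      and rg: "(\<lambda>\<xi>. of_real (r (circle_embed \<xi>)) * g \<xi>) \<in> character_annihilator"
      using r(1) g by (auto simp: annihilator_multipliers_def)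
    have iu: "integrable torus_measure (\<lambda>\<xi>. of_real (u (circle_embed \<xi>)) * g \<xi>)"
      using L2_integrable_product(1)[OF annihilator_multiplier[OF u gL] L2_one] by simp
    have ir: "integrable torus_measure (\<lambda>\<xi>. of_real (r (circle_embed \<xi>)) * g \<xi>)"
      using L2_integrable_product(1)[OF annihilator_multiplier[OF rc gL] L2_one] by simp
    have "L2_inner (\<lambda>\<xi>. of_real (r (circle_embed \<xi>)) * g \<xi>) (torus_character 0) = 0"
      using rg unfolding character_annihilator_def by blast
    then have r0: "(LINT \<xi>|torus_measure. of_real (r (circle_embed \<xi>)) * g \<xi>) = 0"
      by (simp add: L2_inner_def one)
    have "(LINT \<xi>|torus_measure. of_real (u (circle_embed \<xi>)) * g \<xi>)
        = (LINT \<xi>|torus_measure. of_real (u (circle_embed \<xi>)) * g \<xi> - of_real (r (circle_embed \<xi>)) * g \<xi>)"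
      by (simp add: Bochner_Integration.integral_diff[OF iu ir] r0)
    then have "X \<le> (LINT \<xi>|torus_measure. cmod (of_real (u (circle_embed \<xi>)) * g \<xi> - of_real (r (circle_embed \<xi>)) * g \<xi>))"
      unfolding X_def by (simp only: integral_norm_bound)
    also have "\<dots> \<le> (LINT \<xi>|torus_measure. e * cmod (g \<xi>))"
    proof (rule integral_mono)
      show "integrable torus_measure (\<lambda>\<xi>. cmod (of_real (u (circle_embed \<xi>)) * g \<xi> - of_real (r (circle_embed \<xi>)) * g \<xi>))"
        by (intro Bochner_Integration.integrable_norm Bochner_Integration.integrable_diff iu ir)
      fix \<xi> :: "real ^ 'n" assume "\<xi> \<in> space torus_measure"
      then have "\<bar>u (circle_embed \<xi>) - r (circle_embed \<xi>)\<bar> < e" by (intro r(2)) auto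
      then show "cmod (of_real (u (circle_embed \<xi>)) * g \<xi> - of_real (r (circle_embed \<xi>)) * g \<xi>) \<le> e * cmod (g \<xi>)"
        by (simp add: norm_mult mult_right_mono flip: left_diff_distrib of_real_diff)
    qed (use int_g in simp)
    also have "\<dots> = e * N" by (simp add: N_def)
    finally show ?thesis .
  qed
  have "X \<le> 0 + e" if "e > 0" for e
  proof -
    have "X \<le> e / (N + 1) * N" using bound[of "e / (N + 1)"] that N by simp
    also have "\<dots> \<le> e" using that N by (simp add: field_simps)
    finally show ?thesis by simp
  qed
  then have "X \<le> 0" by (rule field_le_epsilon)
  then show ?thesis by (simp add: X_def)
qed

text \<open>The set \<open>circle_embed ` K\<close> is closed, so its indicator is a bounded pointwise limit of continuous
  functions; injectivity of the embedding pulls it back to the indicator of \<open>K\<close>.\<close>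

lemma annihilator_integral_compact:
  assumes g: "g \<in> character_annihilator" and K: "compact K" "K \<subseteq> (torus :: (real ^ 'n) set)"
  shows "(LINT \<xi>|torus_measure. indicator K \<xi> * g \<xi>) = 0"
proof (cases "K = {}")
  case True
  then show ?thesis by simp
next
  case False
  have gL: "g \<in> L2 torus" using g by (simp add: character_annihilator_def)
  define C where "C = circle_embed ` K"
  have C: "closed C" "C \<noteq> {}"
    using False compact_continuous_image[OF continuous_on_circle_embed K(1)]
    by (auto simp: C_def compact_imp_closed)
  define u where "u m w = max 0 (1 - real m * infdist w C)" for m w
  have u: "continuous_on S (u m)" for m S
    unfolding u_def by (intro continuous_intros)
  have "(\<lambda>m. LINT \<xi>|torus_measure. of_real (u m (circle_embed \<xi>)) * g \<xi>) \<longlonglongrightarrow> (LINT \<xi>|torus_measure. indicator K \<xi> * g \<xi>)"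
  proof (rule integral_dominated_convergence)
    have "K \<in> sets lebesgue" using K(1) by (auto dest: compact_imp_closed)
    then have [measurable]: "K \<in> sets torus_measure" using K(2) torus_lebesgue by (simp add: sets_restrict_space_iff)
    note [measurable] = L2_measurable[OF gL]
    show "(\<lambda>\<xi>. indicator K \<xi> * g \<xi>) \<in> borel_measurable torus_measure" by measurable
    show "integrable torus_measure (\<lambda>\<xi>. cmod (g \<xi>))"
      using L2_integrable_product(2)[OF gL L2_one] by simp
    show "(\<lambda>\<xi>. of_real (u m (circle_embed \<xi>)) * g \<xi>) \<in> borel_measurable torus_measure" for m
      by (rule L2_measurable[OF annihilator_multiplier[OF u gL]])
    show "AE \<xi> in torus_measure. cmod (of_real (u m (circle_embed \<xi>)) * g \<xi>) \<le> cmod (g \<xi>)" for m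
    proof (rule AE_I2)
      fix \<xi> :: "real ^ 'n"
      have "\<bar>u m (circle_embed \<xi>)\<bar> \<le> 1" by (simp add: u_def infdist_nonneg)
      then show "cmod (of_real (u m (circle_embed \<xi>)) * g \<xi>) \<le> cmod (g \<xi>)"
        by (simp add: norm_mult mult_left_le_one_le)
    qed
    show "AE \<xi> in torus_measure. (\<lambda>m. of_real (u m (circle_embed \<xi>)) * g \<xi>) \<longlonglongrightarrow> indicator K \<xi> * g \<xi>"
    proof (rule AE_I2)
      fix \<xi> :: "real ^ 'n" assume "\<xi> \<in> space torus_measure"
      then have \<xi>: "\<xi> \<in> torus" by simp
      show "(\<lambda>m. of_real (u m (circle_embed \<xi>)) * g \<xi>) \<longlonglongrightarrow> indicator K \<xi> * g \<xi>"
      proof (cases "\<xi> \<in> K")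
        case True
        then have "infdist (circle_embed \<xi>) C = 0" by (intro infdist_zero) (simp add: C_def)
        then show ?thesis using True by (simp add: u_def)
      next
        case False
        then have "circle_embed \<xi> \<notin> C"
          using \<xi> K(2) inj_on_circle_embed by (auto simp: C_def dest: inj_onD)
        then have "infdist (circle_embed \<xi>) C \<noteq> 0" using C in_closed_iff_infdist_zero by blast
        then have d: "infdist (circle_embed \<xi>) C > 0" using infdist_nonneg[of "circle_embed \<xi>" C] by linarith
        then obtain m0 where m0: "1 < real m0 * infdist (circle_embed \<xi>) C"
          using ex_less_of_nat_mult by blast
        have "u m (circle_embed \<xi>) = 0" if "m \<ge> m0" for m
        proof -
          have "real m0 * infdist (circle_embed \<xi>) C \<le> real m * infdist (circle_embed \<xi>) C"
            using that d by (intro mult_right_mono) auto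
          then show ?thesis using m0 by (simp add: u_def)
        qed
        then show ?thesis
          using False by (intro tendsto_eventually) (auto simp: eventually_sequentially)
      qed
    qed
  qed
  moreover have "(LINT \<xi>|torus_measure. of_real (u m (circle_embed \<xi>)) * g \<xi>) = 0" for m
    by (rule annihilator_integral_continuous[OF g u])
  ultimately show ?thesis by (simp add: LIMSEQ_const_iff)
qed

text \<open>If \<open>f\<close> were positive on a set of positive measure, inner regularity would give a compact subset of
  positive measure, over which the integral of \<open>f\<close> could not vanish.\<close>

lemma nonpos_if_compact_integrals_zero:
  fixes f :: "real ^ 'n \<Rightarrow> real"
  assumes f: "integrable torus_measure f"
    and zero: "\<And>K. compact K \<Longrightarrow> K \<subseteq> torus \<Longrightarrow> (LINT \<xi>|torus_measure. indicator K \<xi> * f \<xi>) = 0"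
  shows "AE \<xi> in torus_measure. f \<xi> \<le> 0"
proof -
  define A where "A = {\<xi> \<in> torus. f \<xi> > 0}"
  have "A \<in> sets torus_measure"
  proof -
    have "{\<xi> \<in> space torus_measure. f \<xi> > 0} \<in> sets torus_measure"
      using borel_measurable_integrable[OF f] by measurable
    then show ?thesis by (simp add: A_def)
  qed
  then have A: "A \<in> sets lebesgue" using torus_lebesgue by (simp add: sets_restrict_space_iff)
  have "emeasure lebesgue A \<le> ennreal e" if e: "e > 0" for e :: real
  proof -
    obtain T where T: "closed T" "T \<subseteq> A" "A - T \<in> lmeasurable" "emeasure lebesgue (A - T) < ennreal e"
      using sets_lebesgue_inner_closed[OF A e] by blast
    have T_torus: "T \<subseteq> torus" using T(2) by (auto simp: A_def)
    have cT: "compact T" using T(1) bounded_subset[OF bounded_torus T_torus] by (simp add: compact_eq_bounded_closed)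
    have T_sets: "T \<in> sets torus_measure"
      using T(1) T_torus torus_lebesgue by (simp add: sets_restrict_space_iff)
    have int: "integrable torus_measure (\<lambda>\<xi>. indicator T \<xi> * f \<xi>)"
      using integrable_mult_indicator[OF T_sets f] by simp
    have "AE \<xi> in torus_measure. indicator T \<xi> * f \<xi> = 0"
    proof (subst integral_nonneg_eq_0_iff_AE[OF int, symmetric])
      show "AE \<xi> in torus_measure. 0 \<le> indicator T \<xi> * f \<xi>"
        using T(2) by (intro AE_I2) (auto simp: indicator_def A_def)
      show "(LINT \<xi>|torus_measure. indicator T \<xi> * f \<xi>) = 0" by (rule zero[OF cT T_torus])
    qed
    then have "AE \<xi> in torus_measure. \<xi> \<notin> T"
      by eventually_elim (use T(2) in \<open>auto simp: A_def indicator_def\<close>)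
    then have "T \<in> null_sets torus_measure"
      using T_sets by (simp add: AE_iff_null_sets)
    then have "T \<in> null_sets lebesgue"
      using torus_lebesgue T_torus by (simp add: null_sets_restrict_space)
    then have "emeasure lebesgue A = emeasure lebesgue (A - T)"
      using A by (simp add: emeasure_Diff_null_set)
    then show ?thesis using T(4) by simp
  qed
  then have "emeasure lebesgue A = 0"
    by (metis ennreal_le_epsilon add.left_neutral le_zero_eq zero_less_one)
  then have "A \<in> null_sets lebesgue" using A by auto
  then have "A \<in> null_sets torus_measure"
    using torus_lebesgue by (simp add: null_sets_restrict_space A_def)
  then have "AE \<xi> in torus_measure. \<xi> \<notin> A" by (rule AE_not_in)
  moreover have "AE \<xi> in torus_measure. \<xi> \<in> torus" by (rule AE_I2) simp
  ultimately show ?thesis by eventually_elim (auto simp: A_def)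
qed

lemma characters_total:
  assumes "g \<in> character_annihilator"
  shows "L2_eq g (\<lambda>\<xi>. 0)"
proof -
  have gL: "g \<in> L2 torus" using assms by (simp add: character_annihilator_def)
  have int: "integrable torus_measure g"
    using L2_integrable_product(1)[OF gL L2_one] by simp
  have K: "complex_of_real (LINT \<xi>|torus_measure. indicator K \<xi> * Re (g \<xi>)) + \<i> * (LINT \<xi>|torus_measure. indicator K \<xi> * Im (g \<xi>)) = 0"
    if "compact K" "K \<subseteq> torus" for K
  proof -
    have "K \<in> sets torus_measure"
      using that torus_lebesgue by (auto simp: sets_restrict_space_iff dest: compact_imp_closed)
    then have "integrable torus_measure (\<lambda>\<xi>. indicator K \<xi> *\<^sub>R g \<xi>)"
      by (rule integrable_mult_indicator[OF _ int])
    moreover have "indicator K \<xi> *\<^sub>R g \<xi> = indicator K \<xi> * g \<xi>" for \<xi> by (simp add: indicator_def)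
    ultimately have i: "integrable torus_measure (\<lambda>\<xi>. indicator K \<xi> * g \<xi>)" by simp
    have Re: "Re (indicator K \<xi> * g \<xi>) = indicator K \<xi> * Re (g \<xi>)"
      and Im: "Im (indicator K \<xi> * g \<xi>) = indicator K \<xi> * Im (g \<xi>)" for \<xi>
      by (simp_all add: indicator_def)
    show ?thesis
      using integral_Re[OF i] integral_Im[OF i]
      unfolding annihilator_integral_compact[OF assms that] Re Im by (simp add: complex_eq_iff)
  qed
  have ReK: "(LINT \<xi>|torus_measure. indicator K \<xi> * Re (g \<xi>)) = 0"
    and ImK: "(LINT \<xi>|torus_measure. indicator K \<xi> * Im (g \<xi>)) = 0"
    if "compact K" "K \<subseteq> torus" for K
    using K[OF that] by (simp_all add: complex_eq_iff)
  have "AE \<xi> in torus_measure. Re (g \<xi>) \<le> 0" "AE \<xi> in torus_measure. Im (g \<xi>) \<le> 0"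
    using int by (auto intro!: nonpos_if_compact_integrals_zero simp: ReK ImK)
  moreover have "AE \<xi> in torus_measure. - Re (g \<xi>) \<le> 0"
    by (rule nonpos_if_compact_integrals_zero) (use int ReK in auto)
  moreover have "AE \<xi> in torus_measure. - Im (g \<xi>) \<le> 0"
    by (rule nonpos_if_compact_integrals_zero) (use int ImK in auto)
  ultimately show ?thesis
    unfolding L2_eq_def by eventually_elim (simp add: complex_eq_iff)
qed

section \<open>The Fourier transform\<close>

lemma fourier_spec:
  assumes "f \<in> ell2"
  shows "fourier f \<in> L2 torus"
    and "L2_tendsto (\<lambda>K \<xi>. \<Sum>k\<in>K. f k * torus_character k \<xi>) (fourier f) (finite_subsets_at_top UNIV)"
proof -
  let ?P = "\<lambda>g. g \<in> L2 torus \<and>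
    L2_tendsto (\<lambda>K \<xi>. \<Sum>k\<in>K. f k * torus_character k \<xi>) g (finite_subsets_at_top UNIV)"
  have "\<exists>g. ?P g"
    using assms by (auto simp: ell2_def intro: L2_series_exists[OF torus_character_orthonormal])
  then have "?P (fourier f)" unfolding fourier_def by (rule someI_ex)
  then show "fourier f \<in> L2 torus"
    "L2_tendsto (\<lambda>K \<xi>. \<Sum>k\<in>K. f k * torus_character k \<xi>) (fourier f) (finite_subsets_at_top UNIV)" by auto
qed

lemma fourier_coeff:
  assumes "f \<in> ell2" shows "L2_inner (fourier f) (torus_character k) = f k"
proof (rule L2_series_coeff[OF torus_character_orthonormal fourier_spec(1)[OF assms] _ _ fourier_spec(2)[OF assms]])
  show "\<forall>\<^sub>F K in finite_subsets_at_top UNIV. finite K \<and> k \<in> K"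
    unfolding eventually_finite_subsets_at_top by (intro exI[of _ "{k}"]) auto
qed simp

lemma fourier_inner:
  assumes f: "f \<in> ell2" and g: "g \<in> ell2"
  shows "((\<lambda>k. f k * cnj (g k)) has_sum L2_inner (fourier f) (fourier g)) UNIV"
  using L2_series_inner[OF torus_character_orthonormal fourier_spec(1)[OF f] fourier_spec(1)[OF g] fourier_spec(2)[OF f]]
  by (simp add: has_sum_def fourier_coeff[OF g])

lemma ell2_inner_fourier:
  "f \<in> ell2 \<Longrightarrow> g \<in> ell2 \<Longrightarrow> ell2_inner f g = L2_inner (fourier f) (fourier g)"
  unfolding ell2_inner_def by (rule infsumI[OF fourier_inner])

lemma ell2_norm_fourier:
  assumes f: "f \<in> ell2" shows "ell2_norm f = L2_norm (fourier f)"
proof -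
  have "((\<lambda>k. Re (f k * cnj (f k))) has_sum Re (L2_inner (fourier f) (fourier f))) UNIV"
    using fourier_inner[OF f f] by (rule has_sum_Re)
  moreover have "Re (f k * cnj (f k)) = (cmod (f k))\<^sup>2" for k
    unfolding complex_norm_square[symmetric] by simp
  ultimately have "((\<lambda>k. (cmod (f k))\<^sup>2) has_sum (L2_norm (fourier f))\<^sup>2) UNIV"
    by (simp add: L2_inner_self)
  from infsumI[OF this] show ?thesis unfolding ell2_norm_def by simp
qed

lemma fourier_surj:
  assumes g: "g \<in> L2 torus"
  shows "(\<lambda>k. L2_inner g (torus_character k)) \<in> ell2"
    and "L2_eq (fourier (\<lambda>k. L2_inner g (torus_character k))) g"
proof -
  let ?f = "\<lambda>k. L2_inner g (torus_character k)"
  show f: "?f \<in> ell2"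
    unfolding ell2_def using L2_Bessel_summable[OF torus_character_orthonormal g] by simp
  note F = fourier_spec(1)[OF f]
  have "(\<lambda>\<xi>. fourier ?f \<xi> - g \<xi>) \<in> character_annihilator"
    using L2_diff[OF F g] fourier_coeff[OF f]
    by (simp add: character_annihilator_def L2_inner_diff_left[OF F g torus_character_L2])
  from characters_total[OF this] show "L2_eq (fourier ?f) g" by (simp add: L2_eq_def)
qed

lemma fourier_inv_spec:
  assumes g: "g \<in> L2 torus"
  shows "fourier_inv g \<in> ell2" and "L2_eq (fourier (fourier_inv g)) g"
proof -
  let ?f = "\<lambda>k. L2_inner g (torus_character k)"
  have "f = ?f" if "f \<in> ell2" "L2_eq (fourier f) g" for f
  proof
    fix k
    show "f k = ?f k"
      using L2_inner_cong_left[OF that(2) fourier_spec(1)[OF that(1)] g torus_character_L2]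
      by (simp add: fourier_coeff[OF that(1)])
  qed
  then have "\<exists>!f. f \<in> ell2 \<and> L2_eq (fourier f) g"
    using fourier_surj[OF g] by blast
  from theI'[OF this] show "fourier_inv g \<in> ell2" "L2_eq (fourier (fourier_inv g)) g"
    unfolding fourier_inv_def by auto
qed

section \<open>Change of variables in arbitrary index types\<close>

definition vec_reindex :: "('b \<Rightarrow> 'a) \<Rightarrow> real ^ 'a \<Rightarrow> real ^ 'b" where
  "vec_reindex \<pi> x = (\<chi> i. x $ \<pi> i)"

lemma vec_reindex_nth [simp]: "vec_reindex \<pi> x $ i = x $ \<pi> i"
  by (simp add: vec_reindex_def)

lemma linear_vec_reindex: "linear (vec_reindex \<pi>)"
  by (rule linearI) (simp_all add: vec_eq_iff)

lemma vec_reindex_inverse: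
  "(\<And>i. \<sigma> (\<pi> i) = i) \<Longrightarrow> vec_reindex \<pi> (vec_reindex \<sigma> x) = x"
  by (simp add: vec_eq_iff)

lemma bij_vec_reindex:
  assumes "bij \<pi>" shows "bij (vec_reindex \<pi>)"
  using assms
  by (intro o_bij[where g = "vec_reindex (inv \<pi>)"])
    (auto simp: fun_eq_iff vec_eq_iff bij_is_inj bij_is_surj surj_f_inv_f)

text \<open>Conjugating a permutation by a bijection preserves its sign.\<close>

lemma det_reindex:
  fixes M :: "real ^ 'a ^ 'a" and \<pi> :: "'b :: finite \<Rightarrow> 'a :: finite"
  assumes \<pi>: "bij \<pi>"
  shows "det (\<chi> i j. M $ \<pi> i $ \<pi> j) = det M"
proof -
  have ip [simp]: "inv \<pi> (\<pi> i) = i" for i using \<pi> by (simp add: bij_is_inj)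
  have pi_i [simp]: "\<pi> (inv \<pi> i) = i" for i using \<pi> by (simp add: bij_is_surj surj_f_inv_f)
  have "det (\<chi> i j. M $ \<pi> i $ \<pi> j)
      = (\<Sum>p | p permutes UNIV. of_int (sign p) * (\<Prod>i\<in>UNIV. M $ \<pi> i $ \<pi> (p i)))"
    by (simp add: det_def)
  also have "\<dots> = (\<Sum>q | q permutes UNIV. of_int (sign q) * (\<Prod>i\<in>UNIV. M $ i $ q i))"
  proof (rule sum.reindex_bij_witness[where i = "\<lambda>q. inv \<pi> \<circ> q \<circ> \<pi>" and j = "\<lambda>p. \<pi> \<circ> p \<circ> inv \<pi>"])
    fix p :: "'b \<Rightarrow> 'b" assume "p \<in> {p. p permutes UNIV}"
    then have p: "p permutes UNIV" by simp
    show "inv \<pi> \<circ> (\<pi> \<circ> p \<circ> inv \<pi>) \<circ> \<pi> = p" by (simp add: fun_eq_iff)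
    have "bij (\<pi> \<circ> p \<circ> inv \<pi>)"
      using \<pi> p by (intro bij_comp bij_imp_bij_inv) (simp_all add: permutes_bij)
    then show "\<pi> \<circ> p \<circ> inv \<pi> \<in> {p. p permutes UNIV}" by (auto intro: bij_imp_permutes)
    have "sign (map_permutation UNIV \<pi> p) = sign p"
      using \<pi> p by (intro sign_map_permutation) (auto simp: bij_is_inj)
    moreover have "map_permutation UNIV \<pi> p = \<pi> \<circ> p \<circ> inv \<pi>"
      using \<pi> by (simp add: map_permutation_def restrict_id_def fun_eq_iff bij_is_surj)
    moreover have "(\<Prod>i\<in>UNIV. M $ i $ (\<pi> \<circ> p \<circ> inv \<pi>) i) = (\<Prod>i\<in>UNIV. M $ \<pi> i $ \<pi> (p i))"
      by (rule prod.reindex_bij_witness[where i = "\<pi>" and j = "inv \<pi>"]) auto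
    ultimately show "of_int (sign (\<pi> \<circ> p \<circ> inv \<pi>)) * (\<Prod>i\<in>UNIV. M $ i $ (\<pi> \<circ> p \<circ> inv \<pi>) i)
        = of_int (sign p) * (\<Prod>i\<in>UNIV. M $ \<pi> i $ \<pi> (p i))" by simp
  next
    fix q :: "'a \<Rightarrow> 'a" assume "q \<in> {q. q permutes UNIV}"
    then have "q permutes UNIV" by simp
    show "\<pi> \<circ> (inv \<pi> \<circ> q \<circ> \<pi>) \<circ> inv \<pi> = q" by (simp add: fun_eq_iff)
    have "bij (inv \<pi> \<circ> q \<circ> \<pi>)"
      using \<pi> \<open>q permutes UNIV\<close> by (intro bij_comp bij_imp_bij_inv) (simp_all add: permutes_bij)
    then show "inv \<pi> \<circ> q \<circ> \<pi> \<in> {p. p permutes UNIV}" by (auto intro: bij_imp_permutes)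
  qed
  finally show ?thesis by (simp add: det_def)
qed

lemma det_matrix_reindex:
  fixes A :: "real ^ 'a \<Rightarrow> real ^ 'a" and \<pi> :: "'b :: finite \<Rightarrow> 'a :: finite"
  assumes \<pi>: "bij \<pi>"
  shows "det (matrix (vec_reindex \<pi> \<circ> A \<circ> vec_reindex (inv \<pi>))) = det (matrix A)"
proof -
  have "vec_reindex (inv \<pi>) (axis j 1) = axis (\<pi> j) 1" for j
    using \<pi> by (auto simp: vec_eq_iff axis_def bij_is_inj bij_is_surj surj_f_inv_f)
  then have "matrix (vec_reindex \<pi> \<circ> A \<circ> vec_reindex (inv \<pi>)) = (\<chi> i j. matrix A $ \<pi> i $ \<pi> j)"
    by (simp add: matrix_def)
  then show ?thesis by (simp add: det_reindex[OF \<pi>])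
qed

lemma lborel_vec_reindex:
  fixes \<pi> :: "'b :: finite \<Rightarrow> 'a :: finite"
  assumes \<pi>: "bij \<pi>"
  shows "distr lborel borel (vec_reindex \<pi>) = lborel"
proof (rule lborel_eqI[symmetric])
  have meas: "vec_reindex \<pi> \<in> borel_measurable borel"
    by (intro borel_measurable_continuous_onI linear_continuous_on linear_conv_bounded_linear[THEN iffD1] linear_vec_reindex)
  have prod_Basis: "(\<Prod>b\<in>Basis. (x :: real ^ 'c) \<bullet> b) = (\<Prod>i\<in>UNIV. x $ i)" for x :: "real ^ 'c :: finite"
    unfolding Basis_vec_eq by (subst prod.reindex[OF inj_axis]) (simp add: inner_axis o_def)
  have prod_Basis': "(\<Prod>b\<in>Basis. (x :: real ^ 'a) \<bullet> b) = (\<Prod>i\<in>UNIV. x $ i)" for x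
    unfolding Basis_vec_eq by (subst prod.reindex[OF inj_axis]) (simp add: inner_axis o_def)
  fix l u :: "real ^ 'b" assume lu: "\<And>b. b \<in> Basis \<Longrightarrow> l \<bullet> b \<le> u \<bullet> b"
  have lu': "l $ i \<le> u $ i" for i using lu[of "axis i 1"] by (simp add: inner_axis Basis_vec_eq)
  have vimage: "vec_reindex \<pi> -` box l u = box (vec_reindex (inv \<pi>) l) (vec_reindex (inv \<pi>) u)"
    using \<pi> by (auto simp: mem_box_cart) (metis bij_inv_eq_iff)+
  have "emeasure (distr lborel borel (vec_reindex \<pi>)) (box l u) = emeasure lborel (box (vec_reindex (inv \<pi>) l) (vec_reindex (inv \<pi>) u))"
    using meas by (subst emeasure_distr) (auto simp: vimage)
  also have "\<dots> = (\<Prod>b\<in>Basis. (vec_reindex (inv \<pi>) u - vec_reindex (inv \<pi>) l) \<bullet> b)"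
    using lu' by (intro emeasure_lborel_box) (auto simp: Basis_vec_eq inner_axis)
  also have "\<dots> = (\<Prod>i\<in>UNIV. (u - l) $ inv \<pi> i)"
    unfolding prod_Basis' by simp
  also have "\<dots> = (\<Prod>i\<in>UNIV. (u - l) $ i)"
    using \<pi> by (intro arg_cong[where f = ennreal] prod.reindex_bij_betw bij_imp_bij_inv)
  finally show "emeasure (distr lborel borel (vec_reindex \<pi>)) (box l u) = (\<Prod>b\<in>Basis. (u - l) \<bullet> b)"
    unfolding prod_Basis by simp
qed simp

lemma vec_reindex_measurable_lebesgue:
  fixes \<pi> :: "'b :: finite \<Rightarrow> 'a :: finite"
  assumes \<pi>: "bij \<pi>"
  shows "vec_reindex \<pi> \<in> lebesgue \<rightarrow>\<^sub>M lebesgue"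
proof (rule measurableI)
  fix S :: "(real ^ 'b) set" assume S: "S \<in> sets lebesgue"
  have "vec_reindex \<pi> -` S = vec_reindex (inv \<pi>) ` S"
  proof safe
    fix x assume "vec_reindex \<pi> x \<in> S"
    moreover have "x = vec_reindex (inv \<pi>) (vec_reindex \<pi> x)"
      using \<pi> by (simp add: vec_eq_iff bij_is_surj surj_f_inv_f)
    ultimately show "x \<in> vec_reindex (inv \<pi>) ` S" by blast
  next
    fix x assume "x \<in> S"
    then show "vec_reindex (inv \<pi>) x \<in> vec_reindex \<pi> -` S"
      using \<pi> by (simp add: vec_reindex_inverse bij_is_inj)
  qed
  moreover have "vec_reindex (inv \<pi>) ` S \<in> sets lebesgue"
  proof (rule differentiable_image_in_sets_lebesgue[OF S])
    show "DIM(real ^ 'b) \<le> DIM(real ^ 'a)" using bij_betw_same_card[OF \<pi>] by simp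
    show "vec_reindex (inv \<pi>) differentiable_on S"
      by (intro linear_imp_differentiable_on linear_vec_reindex)
  qed
  ultimately show "vec_reindex \<pi> -` S \<inter> space lebesgue \<in> sets lebesgue" by simp
qed simp

lemma lebesgue_vec_reindex:
  fixes \<pi> :: "'b :: finite \<Rightarrow> 'a :: finite"
  assumes \<pi>: "bij \<pi>"
  shows "distr lebesgue lebesgue (vec_reindex \<pi>) = lebesgue"
proof -
  have meas: "vec_reindex \<pi> \<in> borel_measurable borel"
    by (intro borel_measurable_continuous_onI linear_continuous_on linear_conv_bounded_linear[THEN iffD1] linear_vec_reindex)
  have meas': "vec_reindex \<pi> \<in> lebesgue \<rightarrow>\<^sub>M lborel"
    using meas by (intro measurable_completion) simp
  have eq: "distr lebesgue lborel (vec_reindex \<pi>) = lborel"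
  proof (rule measure_eqI)
    fix A assume "A \<in> sets (distr lebesgue lborel (vec_reindex \<pi>))"
    then have A: "A \<in> sets borel" by simp
    have "vec_reindex \<pi> -` A \<in> sets borel" using measurable_sets[OF meas A] by simp
    then have "emeasure (distr lebesgue lborel (vec_reindex \<pi>)) A = emeasure lborel (vec_reindex \<pi> -` A)"
      using A meas' by (subst emeasure_distr) (auto simp: emeasure_completion)
    also have "\<dots> = emeasure (distr lborel borel (vec_reindex \<pi>)) A"
      using A meas by (subst emeasure_distr) auto
    finally show "emeasure (distr lebesgue lborel (vec_reindex \<pi>)) A = emeasure lborel A"
      by (simp add: lborel_vec_reindex[OF \<pi>])
  qed simp
  show ?thesis
    using completion.completion_distr_eq[OF meas'] by (simp add: eq)
qed

lemma set_integral_vec_reindex: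
  fixes \<pi> :: "'b :: finite \<Rightarrow> 'a :: finite" and f :: "real ^ 'b \<Rightarrow> real"
  assumes \<pi>: "bij \<pi>"
  shows "set_integrable lebesgue (vec_reindex \<pi> ` S) f \<longleftrightarrow> set_integrable lebesgue S (\<lambda>x. f (vec_reindex \<pi> x))" (is ?A)
    and "set_integrable lebesgue (vec_reindex \<pi> ` S) f \<Longrightarrow>
      (LINT y:vec_reindex \<pi> ` S|lebesgue. f y) = (LINT x:S|lebesgue. f (vec_reindex \<pi> x))" (is "_ \<Longrightarrow> ?B")
proof -
  have inj: "inj (vec_reindex \<pi>)" using bij_vec_reindex[OF \<pi>] by (rule bij_is_inj)
  have ind: "indicator (vec_reindex \<pi> ` S) (vec_reindex \<pi> x) = (indicator S x :: real)" for x
    using inj by (auto simp: indicator_def inj_image_mem_iff)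
  define F where "F y = indicator (vec_reindex \<pi> ` S) y *\<^sub>R f y" for y
  have F: "F (vec_reindex \<pi> x) = indicator S x *\<^sub>R f (vec_reindex \<pi> x)" for x
    by (simp add: F_def ind)
  have push: "integrable lebesgue F" if "integrable lebesgue (\<lambda>x. F (vec_reindex \<pi> x))"
  proof -
    have "integrable lebesgue (\<lambda>y. F (vec_reindex \<pi> (vec_reindex (inv \<pi>) y)))"
      using \<pi> that
        integrable_distr_eq[OF vec_reindex_measurable_lebesgue[OF bij_imp_bij_inv[OF \<pi>]], of "\<lambda>x. F (vec_reindex \<pi> x)"]
      by (auto simp: lebesgue_vec_reindex[OF bij_imp_bij_inv[OF \<pi>]])
    then show ?thesis using \<pi> by (simp add: vec_reindex_inverse bij_is_inj)
  qed
  have pullF: "integrable lebesgue F \<Longrightarrow> integrable lebesgue (\<lambda>x. F (vec_reindex \<pi> x)) \<and> (LINT y|lebesgue. F y) = (LINT x|lebesgue. F (vec_reindex \<pi> x))"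
    using integrable_distr_eq[OF vec_reindex_measurable_lebesgue[OF \<pi>], of F]
      integral_distr[OF vec_reindex_measurable_lebesgue[OF \<pi>], of F]
    by (auto simp: lebesgue_vec_reindex[OF \<pi>])
  show ?A
    unfolding set_integrable_def F_def[symmetric] using push pullF by (auto simp: F)
  show ?B if "set_integrable lebesgue (vec_reindex \<pi> ` S) f"
    using pullF that unfolding set_integrable_def set_lebesgue_integral_def F_def[symmetric] by (simp add: F)
qed

text \<open>The Euclidean change of variables formula is first obtained for coordinates indexed by a
  well-ordered type. The order is arbitrary and has no geometric meaning: relabelling the coordinates
  changes neither Lebesgue measure nor the Jacobian determinant.\<close>

typedef 'n ordered_index = "UNIV :: 'n set" by simp

instance ordered_index :: (finite) finite
proof
  have "finite (Abs_ordered_index ` (UNIV :: 'a set))" by simp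
  moreover have "Abs_ordered_index ` (UNIV :: 'a set) = UNIV"
    by (metis Rep_ordered_index_inverse surj_def)
  ultimately show "finite (UNIV :: 'a ordered_index set)" by simp
qed

definition index_rank :: "('n :: finite) ordered_index \<Rightarrow> nat" where
  "index_rank = (SOME f. inj f)"

lemma inj_index_rank: "inj index_rank"
proof -
  obtain f :: "'a ordered_index \<Rightarrow> nat" where "inj f"
    using finite_imp_inj_to_nat_seg[of "UNIV :: 'a ordered_index set"] by auto
  then show ?thesis unfolding index_rank_def using someI[of inj f] by simp
qed

instantiation ordered_index :: (finite) wellorder
begin

definition less_eq_ordered_index :: "'a ordered_index \<Rightarrow> 'a ordered_index \<Rightarrow> bool" where
  "less_eq_ordered_index x y \<longleftrightarrow> index_rank x \<le> index_rank y"

definition less_ordered_index :: "'a ordered_index \<Rightarrow> 'a ordered_index \<Rightarrow> bool" where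
  "less_ordered_index x y \<longleftrightarrow> index_rank x < index_rank y"

instance
proof
  fix x y z :: "'a ordered_index"
  show "(x < y) = (x \<le> y \<and> \<not> y \<le> x)" by (auto simp: less_eq_ordered_index_def less_ordered_index_def)
  show "x \<le> x" by (simp add: less_eq_ordered_index_def)
  show "x \<le> y \<Longrightarrow> y \<le> z \<Longrightarrow> x \<le> z" by (simp add: less_eq_ordered_index_def)
  show "x \<le> y \<Longrightarrow> y \<le> x \<Longrightarrow> x = y"
    using inj_index_rank by (auto simp: less_eq_ordered_index_def dest: injD)
  show "x \<le> y \<or> y \<le> x" by (auto simp: less_eq_ordered_index_def)
next
  fix Q :: "'a ordered_index \<Rightarrow> bool" and a
  assume step: "\<And>x. (\<And>y. y < x \<Longrightarrow> Q y) \<Longrightarrow> Q x"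
  show "Q a"
    by (induction a rule: measure_induct_rule[where f = index_rank]) (rule step, simp add: less_ordered_index_def)
qed

end

lemma bij_Rep_ordered_index: "bij Rep_ordered_index"
  by (metis Abs_ordered_index_inverse Rep_ordered_index_inverse UNIV_I bij_betw_byWitness bijI' )

lemma change_of_variables_wellorder:
  fixes f :: "real ^ 'm :: {finite, wellorder} \<Rightarrow> real" and g :: "real ^ 'm :: _ \<Rightarrow> real ^ 'm :: _"
  assumes S: "S \<in> sets lebesgue"
    and der: "\<And>x. x \<in> S \<Longrightarrow> (g has_derivative g' x) (at x within S)"
    and inj: "inj_on g S"
  shows "set_integrable lebesgue (g ` S) f \<longleftrightarrow> set_integrable lebesgue S (\<lambda>x. \<bar>det (matrix (g' x))\<bar> * f (g x))" (is ?A)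
    and "set_integrable lebesgue (g ` S) f \<Longrightarrow>
      (LINT y:g ` S|lebesgue. f y) = (LINT x:S|lebesgue. \<bar>det (matrix (g' x))\<bar> * f (g x))" (is "_ \<Longrightarrow> ?B")
proof -
  define F :: "real ^ 'm :: _ \<Rightarrow> real ^ 1" where "F y = vec (f y)" for y
  have *: "(\<lambda>x. \<bar>det (matrix (g' x))\<bar> *\<^sub>R F (g x)) absolutely_integrable_on S \<and>
           integral S (\<lambda>x. \<bar>det (matrix (g' x))\<bar> *\<^sub>R F (g x)) = b
     \<longleftrightarrow> F absolutely_integrable_on (g ` S) \<and> integral (g ` S) F = b" for b
    by (rule has_absolute_integral_change_of_variables[OF S der inj])
  then have "F absolutely_integrable_on (g ` S) \<longleftrightarrow> (\<lambda>x. \<bar>det (matrix (g' x))\<bar> *\<^sub>R F (g x)) absolutely_integrable_on S"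
    by blast
  then show A: ?A
    by (simp add: absolutely_integrable_on_1_iff F_def)
  show ?B if f: "set_integrable lebesgue (g ` S) f"
  proof -
    have "F absolutely_integrable_on (g ` S)"
      using f by (simp add: absolutely_integrable_on_1_iff F_def)
    with * have "integral S (\<lambda>x. \<bar>det (matrix (g' x))\<bar> *\<^sub>R F (g x)) = integral (g ` S) F" by blast
    then have "integral S (\<lambda>x. \<bar>det (matrix (g' x))\<bar> * f (g x)) = integral (g ` S) f"
      by (simp add: integral_on_1_eq F_def vec_eq_iff)
    then show ?thesis
      using f A by (simp add: set_lebesgue_integral_eq_integral(2))
  qed
qed

lemma change_of_variables:
  fixes f :: "real ^ 'n \<Rightarrow> real" and g :: "real ^ 'n \<Rightarrow> real ^ 'n"
  assumes S: "S \<in> sets lebesgue"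
    and der: "\<And>x. x \<in> S \<Longrightarrow> (g has_derivative g' x) (at x within S)"
    and inj: "inj_on g S"
  shows "set_integrable lebesgue (g ` S) f \<longleftrightarrow> set_integrable lebesgue S (\<lambda>x. \<bar>det (matrix (g' x))\<bar> * f (g x))" (is ?A)
    and "set_integrable lebesgue (g ` S) f \<Longrightarrow>
      (LINT y:g ` S|lebesgue. f y) = (LINT x:S|lebesgue. \<bar>det (matrix (g' x))\<bar> * f (g x))" (is "_ \<Longrightarrow> ?B")
proof -
  define \<pi> :: "'n ordered_index \<Rightarrow> 'n" where "\<pi> = Rep_ordered_index"
  have \<pi>: "bij \<pi>" unfolding \<pi>_def by (rule bij_Rep_ordered_index)
  define T where "T = vec_reindex \<pi>"
  define T' where "T' = vec_reindex (inv \<pi>)"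
  have TT' [simp]: "T (T' y) = y" for y
    using \<pi> by (simp add: T_def T'_def vec_reindex_inverse bij_is_inj)
  have T'T [simp]: "T' (T x) = x" for x
    using \<pi> by (simp add: T_def T'_def vec_reindex_inverse bij_is_surj surj_f_inv_f)
  have lin: "linear T" "linear T'" by (simp_all add: T_def T'_def linear_vec_reindex)
  define G where "G = T \<circ> g \<circ> T'"
  define G' where "G' y = T \<circ> g' (T' y) \<circ> T'" for y
  have TS: "T ` S \<in> sets lebesgue"
  proof (rule differentiable_image_in_sets_lebesgue[OF S])
    show "DIM(real ^ 'n) \<le> DIM(real ^ 'n ordered_index)" using bij_betw_same_card[OF \<pi>] by simp
    show "T differentiable_on S" by (intro linear_imp_differentiable_on lin)
  qed
  have "T' ` T ` S = S" by (simp add: image_image)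
  have derG: "(G has_derivative G' y) (at y within T ` S)" if "y \<in> T ` S" for y
  proof -
    have "T' y \<in> S" using that by auto
    then have "(g has_derivative g' (T' y)) (at (T' y) within T' ` T ` S)"
      using der by (simp add: \<open>T' ` T ` S = S\<close>)
    then have "(g \<circ> T' has_derivative g' (T' y) \<circ> T') (at y within T ` S)"
      by (rule diff_chain_within[OF linear_imp_has_derivative[OF lin(2)]])
    then have "(T \<circ> (g \<circ> T') has_derivative T \<circ> (g' (T' y) \<circ> T')) (at y within T ` S)"
      by (rule diff_chain_within[OF _ linear_imp_has_derivative[OF lin(1)]])
    then show ?thesis by (simp add: G_def G'_def o_assoc)
  qed
  have injG: "inj_on G (T ` S)"
    using inj by (auto simp: G_def inj_on_def) (metis T'T)
  have GS: "G ` T ` S = T ` g ` S" by (simp add: G_def image_image)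
  have detG: "det (matrix (G' (T x))) = det (matrix (g' x))" for x
    unfolding G'_def T_def[symmetric] T'T
    unfolding T_def T'_def by (rule det_matrix_reindex[OF \<pi>])
  have 1: "set_integrable lebesgue (g ` S) f \<longleftrightarrow> set_integrable lebesgue (T ` g ` S) (\<lambda>y. f (T' y))"
    using set_integral_vec_reindex(1)[OF \<pi>, of "g ` S" "\<lambda>y. f (T' y)"] by (simp flip: T_def)
  have 2: "set_integrable lebesgue (T ` S) (\<lambda>y. \<bar>det (matrix (G' y))\<bar> * f (T' (G y)))
      \<longleftrightarrow> set_integrable lebesgue S (\<lambda>x. \<bar>det (matrix (g' x))\<bar> * f (g x))"
    using set_integral_vec_reindex(1)[OF \<pi>, of S "\<lambda>y. \<bar>det (matrix (G' y))\<bar> * f (T' (G y))"]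
    by (simp add: detG G_def flip: T_def)
  have cov: "set_integrable lebesgue (T ` g ` S) (\<lambda>y. f (T' y))
      \<longleftrightarrow> set_integrable lebesgue (T ` S) (\<lambda>y. \<bar>det (matrix (G' y))\<bar> * f (T' (G y)))"
    "set_integrable lebesgue (T ` g ` S) (\<lambda>y. f (T' y)) \<Longrightarrow>
      (LINT y:T ` g ` S|lebesgue. f (T' y)) = (LINT y:T ` S|lebesgue. \<bar>det (matrix (G' y))\<bar> * f (T' (G y)))"
    using change_of_variables_wellorder[where f = "\<lambda>y. f (T' y)", OF TS _ injG, of G'] derG unfolding GS by blast+
  show ?A using 1 2 cov(1) by simp
  show ?B if f: "set_integrable lebesgue (g ` S) f"
  proof -
    have f': "set_integrable lebesgue (T ` g ` S) (\<lambda>y. f (T' y))" using f 1 by simp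
    have "(LINT y:g ` S|lebesgue. f y) = (LINT y:T ` g ` S|lebesgue. f (T' y))"
      using set_integral_vec_reindex(2)[OF \<pi>, of "g ` S" "\<lambda>y. f (T' y)"] f' by (simp flip: T_def)
    also have "\<dots> = (LINT y:T ` S|lebesgue. \<bar>det (matrix (G' y))\<bar> * f (T' (G y)))"
      by (rule cov(2)[OF f'])
    also have "\<dots> = (LINT x:S|lebesgue. \<bar>det (matrix (g' x))\<bar> * f (g x))"
      using set_integral_vec_reindex(2)[OF \<pi>, of S "\<lambda>y. \<bar>det (matrix (G' y))\<bar> * f (T' (G y))"] cov(1) f'
      by (simp add: detG G_def flip: T_def)
    finally show ?thesis .
  qed
qed


section \<open>Piecewise smooth maps of the torus\<close>

lemma torus_wrap_id: "x \<in> torus \<Longrightarrow> torus_wrap x = x"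
proof -
  assume x: "x \<in> torus"
  have "frac (x $ j + 1 / 2) = x $ j + 1 / 2" for j
  proof -
    have "- 1 / 2 \<le> x $ j" "x $ j < 1 / 2" using x by (auto simp: torus_def)
    then show ?thesis by (subst frac_eq) simp
  qed
  then show ?thesis by (simp add: torus_wrap_def vec_eq_iff)
qed

lemma torus_open_subset_vimage: "torus_open U \<Longrightarrow> U \<subseteq> torus_wrap -` U"
  by (auto simp: torus_open_def torus_wrap_id)

lemma torus_open_lebesgue: assumes "torus_open U" shows "U \<in> sets lebesgue"
proof -
  have "U = torus \<inter> torus_wrap -` U"
    using assms by (auto simp: torus_open_def torus_wrap_id)
  moreover have "torus \<inter> torus_wrap -` U \<in> sets lebesgue"
    using assms torus_lebesgue by (intro sets.Int) (auto simp: torus_open_def)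
  ultimately show ?thesis by simp
qed

text \<open>Subtracting any integer other than zero from \<open>q - p\<close> could make it small only if \<open>q\<close> lay outside the
  interval.\<close>

lemma frac_recentre:
  fixes p q :: real
  assumes "- 1 / 2 < p" "p < 1 / 2" "- 1 / 2 \<le> q" "q < 1 / 2"
    and small: "\<bar>frac (q - p + 1 / 2) - 1 / 2\<bar> < 1 / 2 - \<bar>p\<bar>"
  shows "frac (q - p + 1 / 2) - 1 / 2 = q - p"
proof -
  define k where "k = \<lfloor>q - p + 1 / 2\<rfloor>"
  have fr: "frac (q - p + 1 / 2) - 1 / 2 = q - p - of_int k" by (simp add: frac_def k_def)
  have "of_int k \<le> q - p + 1 / 2" "q - p + 1 / 2 < of_int k + 1" unfolding k_def by linarith+
  then have "real_of_int k < 2" "- 2 < real_of_int k" using assms by linarith+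
  then have "k = - 1 \<or> k = 0 \<or> k = 1" by linarith
  then have "k = 0" using small assms unfolding fr by (elim disjE) (auto simp: abs_if split: if_splits)
  then show ?thesis using fr by simp
qed

text \<open>On the points whose images lie on a prescribed set of faces of the cube, a smooth self-map of the
  torus does not jump, so that it is differentiable there as a map into Euclidean space.\<close>

definition face_piece :: "(real ^ 'n \<Rightarrow> real ^ 'n) \<Rightarrow> (real ^ 'n) set \<Rightarrow> 'n set \<Rightarrow> (real ^ 'n) set" where
  "face_piece P U A = {\<xi> \<in> U. \<forall>j. P \<xi> $ j = - 1 / 2 \<longleftrightarrow> j \<in> A}"

lemma chart_rep_has_derivative:
  assumes "torus_C1_on P U" "\<xi> \<in> U"
  shows "(torus_chart_rep P \<xi> has_derivative (\<lambda>h. torus_derivative P \<xi> *v h)) (at \<xi>)"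
  using assms unfolding torus_C1_on_def torus_derivative_def by (auto simp: jacobian_works)

lemma chart_rep_self: "\<xi> \<in> torus \<Longrightarrow> torus_chart_rep P \<xi> \<xi> = 0"
  by (simp add: torus_chart_rep_def torus_wrap_id) (simp add: torus_wrap_def vec_eq_iff frac_def)

lemma face_piece_has_derivative:
  assumes P: "P ` torus \<subseteq> torus" and U: "U \<subseteq> torus" and C1: "torus_C1_on P U" and \<xi>: "\<xi> \<in> face_piece P U A"
  shows "(P has_derivative (\<lambda>h. torus_derivative P \<xi> *v h)) (at \<xi> within face_piece P U A)"
proof -
  let ?r = "torus_chart_rep P \<xi>"
  have \<xi>U: "\<xi> \<in> U" "\<xi> \<in> torus" "P \<xi> \<in> torus" using \<xi> U P by (auto simp: face_piece_def)
  note der = chart_rep_has_derivative[OF C1 \<xi>U(1)]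
  define M where "M = (\<lambda>j. 1 / 2 - \<bar>P \<xi> $ j\<bar>) ` {j. P \<xi> $ j \<noteq> - 1 / 2}"
  have M_pos: "m > 0" if m: "m \<in> M" for m
  proof -
    obtain j where j: "m = 1 / 2 - \<bar>P \<xi> $ j\<bar>" "P \<xi> $ j \<noteq> - 1 / 2" using m by (auto simp: M_def)
    have "- 1 / 2 \<le> P \<xi> $ j" "P \<xi> $ j < 1 / 2" using \<xi>U(3) by (auto simp: torus_def)
    then show ?thesis using j by (auto simp: abs_if)
  qed
  define \<eta> where "\<eta> = Min (insert 1 M)"
  have \<eta>: "\<eta> > 0" using M_pos by (simp add: \<eta>_def M_def)
  have "isCont ?r \<xi>" using der by (rule has_derivative_continuous)
  then obtain d where d: "d > 0" "\<And>y. dist y \<xi> < d \<Longrightarrow> dist (?r y) (?r \<xi>) < \<eta>"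
    using \<eta> by (auto simp: continuous_at_eps_delta)
  have "((\<lambda>y. P \<xi> + ?r y) has_derivative (\<lambda>h. torus_derivative P \<xi> *v h)) (at \<xi> within face_piece P U A)"
    using has_derivative_add[OF has_derivative_const has_derivative_at_withinI[OF der], of "P \<xi>" "face_piece P U A"] by simp
  then show ?thesis
  proof (rule has_derivative_transform_within[OF _ d(1) \<xi>])
    fix y assume y: "y \<in> face_piece P U A" "dist y \<xi> < d"
    have yU: "y \<in> torus" "P y \<in> torus" using y U P by (auto simp: face_piece_def)
    have small: "norm (?r y) < \<eta>" using d(2)[OF y(2)] by (simp add: chart_rep_self[OF \<xi>U(2)])
    have "?r y $ j = P y $ j - P \<xi> $ j" for j
    proof (cases "P \<xi> $ j = - 1 / 2")
      case True
      then have "j \<in> A" using \<xi> by (auto simp: face_piece_def)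
      then have "P y $ j = - 1 / 2" using y(1) by (auto simp: face_piece_def)
      then show ?thesis using True yU by (simp add: torus_chart_rep_def torus_wrap_id) (simp add: torus_wrap_def frac_def)
    next
      case False
      have b: "- 1 / 2 \<le> P y $ j" "P y $ j < 1 / 2" "- 1 / 2 \<le> P \<xi> $ j" "P \<xi> $ j < 1 / 2"
        using yU(2) \<xi>U(3) by (auto simp: torus_def)
      have r: "?r y $ j = frac (P y $ j - P \<xi> $ j + 1 / 2) - 1 / 2"
        using yU(1) by (simp add: torus_chart_rep_def torus_wrap_id) (simp add: torus_wrap_def)
      have "\<bar>?r y $ j\<bar> \<le> norm (?r y)" by (rule component_le_norm_cart)
      also have "\<dots> < \<eta>" by (rule small)
      also have "\<eta> \<le> 1 / 2 - \<bar>P \<xi> $ j\<bar>" unfolding \<eta>_def using False by (intro Min_le) (auto simp: M_def)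
      finally show ?thesis unfolding r using b False by (intro frac_recentre) auto
    qed
    then show "P \<xi> + ?r y = P y" by (simp add: vec_eq_iff)
  qed
qed

text \<open>The embedding does not see the lattice, so it turns addition in the chart into multiplication.\<close>

lemma circle_embed_chart_rep:
  assumes "y \<in> torus"
  shows "circle_embed (P y) $ j = circle_embed (P \<xi>) $ j * circle_embed (torus_chart_rep P \<xi> y) $ j"
proof -
  define k where "k = \<lfloor>P y $ j - P \<xi> $ j + 1 / 2\<rfloor>"
  have "torus_chart_rep P \<xi> y $ j = P y $ j - P \<xi> $ j - of_int k"
    using assms by (simp add: torus_chart_rep_def torus_wrap_id) (simp add: torus_wrap_def frac_def k_def)
  then have "P y $ j = P \<xi> $ j + torus_chart_rep P \<xi> y $ j + of_int k" by simp
  then have "circle_embed (P y) $ j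
      = circle_embed (P \<xi>) $ j * circle_embed (torus_chart_rep P \<xi> y) $ j * exp (2 * of_real pi * \<i> * of_int k)"
    by (simp add: circle_embed_def ring_distribs flip: exp_add)
  also have "exp (2 * of_real pi * \<i> * of_int k) = 1"
    using exp_integer_2pi[of "of_int k"] by (simp add: mult_ac)
  finally show ?thesis by simp
qed

text \<open>Unlike \<open>P\<close> itself, the composition is continuous also where \<open>P\<close> jumps across a face of the cube.\<close>

lemma continuous_on_circle_embed_comp:
  assumes U: "U \<subseteq> torus" and C1: "torus_C1_on P U"
  shows "continuous_on U (\<lambda>y. circle_embed (P y) $ j)"
  unfolding continuous_on_eq_continuous_within
proof
  fix \<xi> assume \<xi>: "\<xi> \<in> U"
  have "isCont (torus_chart_rep P \<xi>) \<xi>"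
    by (rule has_derivative_continuous[OF chart_rep_has_derivative[OF C1 \<xi>]])
  then have "continuous (at \<xi> within U) (torus_chart_rep P \<xi>)" by (rule continuous_at_imp_continuous_at_within)
  then have "continuous (at \<xi> within U) (\<lambda>y. circle_embed (P \<xi>) $ j * circle_embed (torus_chart_rep P \<xi> y) $ j)"
    unfolding circle_embed_def by (simp, intro continuous_intros)
  then show "continuous (at \<xi> within U) (\<lambda>y. circle_embed (P y) $ j)"
    by (rule continuous_transform_within[OF _ zero_less_one \<xi>]) (use U in \<open>auto simp: circle_embed_chart_rep[of _ P j \<xi>]\<close>)
qed

lemma face_piece_lebesgue:
  assumes P: "P ` torus \<subseteq> torus" and U: "torus_open U" and C1: "torus_C1_on P U"
  shows "face_piece P U A \<in> sets lebesgue"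
proof -
  have UT: "U \<subseteq> torus" using U by (simp add: torus_open_def)
  note UL = torus_open_lebesgue[OF U]
  have iff: "P \<xi> $ j = - 1 / 2 \<longleftrightarrow> circle_embed (P \<xi>) $ j = - 1" if "\<xi> \<in> U" for \<xi> j
  proof
    have m1: "exp (2 * of_real pi * \<i> * of_real (- 1 / 2)) = - 1" by (simp add: exp_minus)
    show "circle_embed (P \<xi>) $ j = - 1" if "P \<xi> $ j = - 1 / 2"
      unfolding circle_embed_def using m1 that by simp
    assume eq: "circle_embed (P \<xi>) $ j = - 1"
    have "P \<xi> \<in> torus" using that UT P by auto
    then have b: "- 1 / 2 \<le> P \<xi> $ j" "P \<xi> $ j < 1 / 2" by (auto simp: torus_def)
    define q where "q = (\<chi> i. if i = j then - 1 / 2 else P \<xi> $ i)"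
    have "q \<in> torus" using \<open>P \<xi> \<in> torus\<close> by (auto simp: torus_def q_def)
    moreover have "circle_embed q = circle_embed (P \<xi>)"
      using eq m1 by (auto simp: vec_eq_iff circle_embed_def q_def)
    ultimately have "q = P \<xi>" using inj_on_circle_embed \<open>P \<xi> \<in> torus\<close> by (auto dest: inj_onD)
    then have "q $ j = P \<xi> $ j" by simp
    then show "P \<xi> $ j = - 1 / 2" by (simp add: q_def)
  qed
  have [measurable]: "(\<lambda>y. circle_embed (P y) $ j) \<in> borel_measurable (lebesgue_on U)" for j
    by (rule continuous_imp_measurable_on_sets_lebesgue[OF continuous_on_circle_embed_comp[OF UT C1] UL])
  have "face_piece P U A = {\<xi> \<in> space (lebesgue_on U). \<forall>j. circle_embed (P \<xi>) $ j = - 1 \<longleftrightarrow> j \<in> A}"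
    using iff by (auto simp: face_piece_def)
  also have "\<dots> \<in> sets (lebesgue_on U)" by measurable
  finally show ?thesis using UL by (simp add: sets_restrict_space_iff)
qed

lemma torus_jacobian_det_measurable:
  assumes U: "torus_open U" and C1: "torus_C1_on P U"
  shows "torus_jacobian_det P \<in> borel_measurable (lebesgue_on U)"
proof (rule continuous_imp_measurable_on_sets_lebesgue[OF _ torus_open_lebesgue[OF U]])
  have "continuous_on U (\<lambda>x. torus_derivative P (torus_wrap x))"
    using C1 torus_open_subset_vimage[OF U] by (auto simp: torus_C1_on_def intro: continuous_on_subset)
  moreover have "torus_derivative P (torus_wrap x) = torus_derivative P x" if "x \<in> U" for x
    using that U by (auto simp: torus_open_def torus_wrap_id subset_iff)
  ultimately have "continuous_on U (torus_derivative P)" by (metis (no_types, lifting) continuous_on_cong)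
  then show "continuous_on U (torus_jacobian_det P)"
    unfolding torus_jacobian_det_def[abs_def] det_def by (intro continuous_intros) auto
qed

text \<open>The comparison has to be made piece by piece, since \<open>P\<close> is differentiable within each piece but may
  jump from one to the next.\<close>

lemma finite_pieces_change_of_variables:
  fixes f w :: "real ^ 'n \<Rightarrow> real"
  assumes I: "finite I" and inj: "inj_on P (\<Union>i\<in>I. N i)"
    and disj: "\<And>i j. i \<in> I \<Longrightarrow> j \<in> I \<Longrightarrow> i \<noteq> j \<Longrightarrow> N i \<inter> N j = {}"
    and N: "\<And>i. i \<in> I \<Longrightarrow> N i \<in> sets lebesgue" and PN: "\<And>i. i \<in> I \<Longrightarrow> P ` N i \<in> sets lebesgue"
    and eq: "\<And>i. i \<in> I \<Longrightarrow> set_integrable lebesgue (P ` N i) f \<longleftrightarrow> set_integrable lebesgue (N i) w"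
      "\<And>i. i \<in> I \<Longrightarrow> set_integrable lebesgue (P ` N i) f \<Longrightarrow> (LINT y:P ` N i|lebesgue. f y) = (LINT x:N i|lebesgue. w x)"
  shows "(set_integrable lebesgue (P ` (\<Union>i\<in>I. N i)) f \<longleftrightarrow> set_integrable lebesgue (\<Union>i\<in>I. N i) w) \<and>
    (set_integrable lebesgue (P ` (\<Union>i\<in>I. N i)) f \<longrightarrow>
      (LINT y:P ` (\<Union>i\<in>I. N i)|lebesgue. f y) = (LINT x:(\<Union>i\<in>I. N i)|lebesgue. w x))"
  using assms
proof (induction I)
  case empty
  then show ?case by (simp add: set_integrable_def set_lebesgue_integral_def)
next
  case (insert i I)
  let ?M = "\<Union>j\<in>I. N j"
  have M: "?M \<in> sets lebesgue" using insert.prems(3) insert.hyps(1) by auto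
  have PM: "P ` ?M \<in> sets lebesgue"
    using insert.prems(4) insert.hyps(1) by (auto simp: image_UN)
  have Ni: "N i \<in> sets lebesgue" "P ` N i \<in> sets lebesgue" using insert.prems by auto
  have d: "N i \<inter> ?M = {}" using insert.prems(2)[of i] insert.hyps(2) by blast
  have "inj_on P (N i \<union> ?M)" using insert.prems(1) by (simp add: Un_commute)
  then have dP: "P ` N i \<inter> P ` ?M = {}" using d by (auto simp: inj_on_def) 
  have injM: "inj_on P ?M" using insert.prems(1) by (rule inj_on_subset) auto
  have IH: "(set_integrable lebesgue (P ` ?M) f \<longleftrightarrow> set_integrable lebesgue ?M w) \<and>
    (set_integrable lebesgue (P ` ?M) f \<longrightarrow> (LINT y:P ` ?M|lebesgue. f y) = (LINT x:?M|lebesgue. w x))"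
    using insert.IH[OF injM] insert.prems by auto

  have un: "(\<Union>j\<in>insert i I. N j) = N i \<union> ?M" by auto
  have split: "set_integrable lebesgue (X \<union> Y) h \<longleftrightarrow> set_integrable lebesgue X h \<and> set_integrable lebesgue Y h"
    if "X \<in> sets lebesgue" "Y \<in> sets lebesgue" for X Y :: "(real ^ 'n) set" and h :: "real ^ 'n \<Rightarrow> real"
    using that by (auto intro: set_integrable_subset set_integrable_Un)
  have ii: "set_integrable lebesgue (P ` N i) f \<longleftrightarrow> set_integrable lebesgue (N i) w"
    "set_integrable lebesgue (P ` N i) f \<Longrightarrow> (LINT y:P ` N i|lebesgue. f y) = (LINT x:N i|lebesgue. w x)"
    using insert.prems(5,6) by auto
  show ?case
    unfolding un image_Un split[OF Ni(2) PM] split[OF Ni(1) M]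
  proof (intro conjI impI)
    show "(set_integrable lebesgue (P ` N i) f \<and> set_integrable lebesgue (P ` ?M) f) =
        (set_integrable lebesgue (N i) w \<and> set_integrable lebesgue ?M w)"
      using IH ii(1) by blast
    assume f: "set_integrable lebesgue (P ` N i) f \<and> set_integrable lebesgue (P ` ?M) f"
    have "(LINT y:P ` N i \<union> P ` ?M|lebesgue. f y) = (LINT y:P ` N i|lebesgue. f y) + (LINT y:P ` ?M|lebesgue. f y)"
      using f by (intro set_integral_Un dP) auto
    also have "\<dots> = (LINT x:N i|lebesgue. w x) + (LINT x:?M|lebesgue. w x)"
      using f IH ii(2) by auto
    also have "\<dots> = (LINT x:N i \<union> ?M|lebesgue. w x)"
      using f IH ii(1) by (intro set_integral_Un[symmetric] d) auto
    finally show "(LINT y:P ` N i \<union> P ` ?M|lebesgue. f y) = (LINT x:N i \<union> ?M|lebesgue. w x)" .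
  qed
qed

text \<open>No measurability of \<open>f\<close> is presupposed in the equivalence of integrability, so that it also yields
  the measurability of compositions with \<open>P\<close> and with its inverse.\<close>

theorem torus_change_of_variables:
  fixes P :: "real ^ 'n \<Rightarrow> real ^ 'n"
  assumes P: "bij_betw P torus torus" and \<Omega>: "\<Omega> \<subseteq> torus" "\<Omega> \<in> sets lebesgue"
    and D: "P ` \<Omega> \<in> sets lebesgue"
    and pw: "torus_piecewise_C1_on P \<Omega> \<U>"
    and jac: "\<And>\<xi>. \<xi> \<in> \<Union>\<U> \<Longrightarrow> c \<le> \<bar>torus_jacobian_det P \<xi>\<bar> \<and> \<bar>torus_jacobian_det P \<xi>\<bar> \<le> C"
  obtains J :: "real ^ 'n \<Rightarrow> real" and C' where "J \<in> borel_measurable (lebesgue_on \<Omega>)"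
    "\<And>\<xi>. c \<le> J \<xi>" "\<And>\<xi>. J \<xi> \<le> C'"
    "\<And>f :: real ^ 'n \<Rightarrow> real. integrable (lebesgue_on (P ` \<Omega>)) f \<longleftrightarrow> integrable (lebesgue_on \<Omega>) (\<lambda>\<xi>. J \<xi> * f (P \<xi>))"
    "\<And>f :: real ^ 'n \<Rightarrow> real. integrable (lebesgue_on (P ` \<Omega>)) f \<Longrightarrow>
       (LINT y|lebesgue_on (P ` \<Omega>). f y) = (LINT \<xi>|lebesgue_on \<Omega>. J \<xi> * f (P \<xi>))"
proof -
  have fin: "finite \<U>" and dis: "pairwise disjnt \<U>"
    and U: "\<And>U. U \<in> \<U> \<Longrightarrow> torus_open U" "\<And>U. U \<in> \<U> \<Longrightarrow> U \<subseteq> \<Omega>" "\<And>U. U \<in> \<U> \<Longrightarrow> torus_C1_on P U"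
    and neg: "negligible (\<Omega> - \<Union>\<U>)" "negligible (P ` (\<Omega> - \<Union>\<U>))"
    using pw by (auto simp: torus_piecewise_C1_on_def)
  have PT: "P ` torus \<subseteq> torus" and injP: "inj_on P torus" using P by (auto simp: bij_betw_def)
  \<comment> \<open>The pieces cover \<open>\<Omega>\<close> up to a null set; off them the value \<open>c\<close> keeps the bounds valid.\<close>
  define J where "J \<xi> = (if \<xi> \<in> \<Union>\<U> then \<bar>torus_jacobian_det P \<xi>\<bar> else c)" for \<xi>
  define I where "I = \<U> \<times> (UNIV :: 'n set set)"
  define N where "N i = face_piece P (fst i) (snd i)" for i
  have I: "finite I" using fin by (simp add: I_def)
  have UN: "(\<Union>i\<in>I. N i) = \<Union>\<U>"
  proof
    show "(\<Union>i\<in>I. N i) \<subseteq> \<Union>\<U>" by (auto simp: I_def N_def face_piece_def)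
    show "\<Union>\<U> \<subseteq> (\<Union>i\<in>I. N i)"
    proof
      fix \<xi> assume "\<xi> \<in> \<Union>\<U>"
      then obtain U where "U \<in> \<U>" "\<xi> \<in> U" by blast
      then have "(U, {j. P \<xi> $ j = - 1 / 2}) \<in> I" "\<xi> \<in> N (U, {j. P \<xi> $ j = - 1 / 2})"
        by (auto simp: I_def N_def face_piece_def)
      then show "\<xi> \<in> (\<Union>i\<in>I. N i)" by blast
    qed
  qed
  have UT: "U \<subseteq> torus" if "U \<in> \<U>" for U using U(1)[OF that] by (simp add: torus_open_def)
  have UU: "\<Union>\<U> \<subseteq> torus" using UT by auto
  have UL: "\<Union>\<U> \<in> sets lebesgue" using fin torus_open_lebesgue[OF U(1)] by (intro sets.finite_Union) auto
  have J_meas: "J \<in> borel_measurable (lebesgue_on \<Omega>)"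
  proof -
    have "(\<lambda>\<xi>. if \<xi> \<in> U then torus_jacobian_det P \<xi> else 0) \<in> borel_measurable lebesgue" if "U \<in> \<U>" for U
      using torus_jacobian_det_measurable[OF U(1,3)[OF that]] torus_open_lebesgue[OF U(1)[OF that]]
      by (simp add: borel_measurable_if_I)
    then have "(\<lambda>\<xi>. \<Sum>U\<in>\<U>. if \<xi> \<in> U then torus_jacobian_det P \<xi> else 0) \<in> borel_measurable lebesgue"
      by (rule borel_measurable_sum)
    then have m: "(\<lambda>\<xi>. if \<xi> \<in> \<Union>\<U> then \<bar>\<Sum>U\<in>\<U>. if \<xi> \<in> U then torus_jacobian_det P \<xi> else 0\<bar> else c) \<in> borel_measurable lebesgue"
      using UL by (intro measurable_If_set borel_measurable_abs) auto
    moreover have "(\<lambda>\<xi>. if \<xi> \<in> \<Union>\<U> then \<bar>\<Sum>U\<in>\<U>. if \<xi> \<in> U then torus_jacobian_det P \<xi> else 0\<bar> else c) = J"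
    proof
      fix \<xi>
      have "(\<Sum>U\<in>\<U>. if \<xi> \<in> U then torus_jacobian_det P \<xi> else 0) = torus_jacobian_det P \<xi>" if "V \<in> \<U>" "\<xi> \<in> V" for V
      proof -
        have "\<xi> \<in> U \<longleftrightarrow> U = V" if "U \<in> \<U>" for U
          using dis that \<open>V \<in> \<U>\<close> \<open>\<xi> \<in> V\<close> by (auto simp: pairwise_def disjnt_iff)
        then have "(\<Sum>U\<in>\<U>. if \<xi> \<in> U then torus_jacobian_det P \<xi> else 0) = (\<Sum>U\<in>\<U>. if U = V then torus_jacobian_det P \<xi> else 0)"
          by (intro sum.cong) auto
        then show ?thesis using fin that(1) by simp
      qed
      then show "(if \<xi> \<in> \<Union>\<U> then \<bar>\<Sum>U\<in>\<U>. if \<xi> \<in> U then torus_jacobian_det P \<xi> else 0\<bar> else c) = J \<xi>"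
        by (auto simp: J_def)
    qed
    ultimately have "J \<in> borel_measurable lebesgue" by simp
    then show ?thesis by (rule measurable_restrict_space1)
  qed
  have NL: "N i \<in> sets lebesgue" if "i \<in> I" for i
    using that U unfolding N_def I_def by (intro face_piece_lebesgue PT) auto
  have der: "(P has_derivative (\<lambda>h. torus_derivative P \<xi> *v h)) (at \<xi> within N i)" if "i \<in> I" "\<xi> \<in> N i" for i \<xi>
  proof -
    have "fst i \<in> \<U>" using that(1) by (auto simp: I_def)
    then show ?thesis
      using that(2) unfolding N_def by (intro face_piece_has_derivative[OF PT UT U(3)])
  qed
  have NU: "N i \<subseteq> \<Union>\<U>" if "i \<in> I" for i using that UN by auto
  have injN: "inj_on P (N i)" if "i \<in> I" for i
    using injP by (rule inj_on_subset) (use NU[OF that] UU in auto)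
  have PNL: "P ` N i \<in> sets lebesgue" if "i \<in> I" for i
  proof (rule differentiable_image_in_sets_lebesgue[OF NL[OF that] order_refl])
    show "P differentiable_on N i"
      using der[OF that] by (auto simp: differentiable_on_def differentiable_def)
  qed
  have disjN: "N i \<inter> N j = {}" if "i \<in> I" "j \<in> I" "i \<noteq> j" for i j
  proof (rule ccontr)
    assume "N i \<inter> N j \<noteq> {}"
    then obtain \<xi> where \<xi>: "\<xi> \<in> fst i" "\<xi> \<in> fst j" "snd i = {k. P \<xi> $ k = - 1 / 2}" "snd j = {k. P \<xi> $ k = - 1 / 2}"
      by (auto simp: N_def face_piece_def set_eq_iff)
    have "fst i \<in> \<U>" "fst j \<in> \<U>" using that by (auto simp: I_def)
    then have "fst i = fst j" using dis \<xi>(1,2) by (meson pairwiseD disjnt_iff)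
    then show False using \<xi> that(3) by (auto simp: prod_eq_iff)
  qed
  have cov: "(set_integrable lebesgue (P ` N i) f \<longleftrightarrow> set_integrable lebesgue (N i) (\<lambda>\<xi>. J \<xi> * f (P \<xi>))) \<and>
      (set_integrable lebesgue (P ` N i) f \<longrightarrow> (LINT y:P ` N i|lebesgue. f y) = (LINT \<xi>:N i|lebesgue. J \<xi> * f (P \<xi>)))"
    if "i \<in> I" for i and f :: "real ^ 'n \<Rightarrow> real"
  proof -
    have Jx: "\<bar>det (matrix (\<lambda>h. torus_derivative P \<xi> *v h))\<bar> = J \<xi>" if "\<xi> \<in> N i" for \<xi>
      using NU[OF \<open>i \<in> I\<close>] that by (auto simp: J_def torus_jacobian_det_def)
    note c = change_of_variables[OF NL[OF that] der[OF that] injN[OF that], of f]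
    have eq: "(\<lambda>\<xi>. indicator (N i) \<xi> * (\<bar>det (matrix (\<lambda>h. torus_derivative P \<xi> *v h))\<bar> * f (P \<xi>)))
        = (\<lambda>\<xi>. indicator (N i) \<xi> * (J \<xi> * f (P \<xi>)))"
    proof
      fix \<xi>
      show "indicator (N i) \<xi> * (\<bar>det (matrix (\<lambda>h. torus_derivative P \<xi> *v h))\<bar> * f (P \<xi>))
          = indicator (N i) \<xi> * (J \<xi> * f (P \<xi>))"
        by (cases "\<xi> \<in> N i") (simp_all only: Jx indicator_simps mult_zero_left simp_thms)
    qed
    show ?thesis
      using c unfolding set_integrable_def set_lebesgue_integral_def real_scaleR_def eq by blast
  qed
  have main: "(set_integrable lebesgue (P ` \<Union>\<U>) f \<longleftrightarrow> set_integrable lebesgue (\<Union>\<U>) (\<lambda>\<xi>. J \<xi> * f (P \<xi>))) \<and>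
      (set_integrable lebesgue (P ` \<Union>\<U>) f \<longrightarrow> (LINT y:P ` \<Union>\<U>|lebesgue. f y) = (LINT \<xi>:\<Union>\<U>|lebesgue. J \<xi> * f (P \<xi>)))"
    for f :: "real ^ 'n \<Rightarrow> real"
  proof -
    have inj: "inj_on P (\<Union>i\<in>I. N i)" using injP UU unfolding UN by (rule inj_on_subset)
    show ?thesis
      using finite_pieces_change_of_variables[where f = f and w = "\<lambda>\<xi>. J \<xi> * f (P \<xi>)" and N = N, OF I inj disjN NL PNL] cov
      unfolding UN by blast
  qed
  have spike: "(set_integrable lebesgue X h \<longleftrightarrow> set_integrable lebesgue Y h) \<and>
      (set_integrable lebesgue Y h \<longrightarrow> (LINT x:X|lebesgue. h x) = (LINT x:Y|lebesgue. h x))"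
    if "Y \<subseteq> X" "negligible (X - Y)" for X Y and h :: "real ^ 'n \<Rightarrow> real"
  proof -
    have n: "negligible {x \<in> X - Y. h x \<noteq> 0}" "negligible {x \<in> Y - X. h x \<noteq> 0}"
      using that by (auto intro: negligible_subset simp: Diff_eq_empty_iff[THEN iffD2])
    have a: "set_integrable lebesgue X h \<longleftrightarrow> set_integrable lebesgue Y h"
      by (rule absolutely_integrable_spike_set_eq[OF n])
    moreover have "integral X h = integral Y h" by (rule integral_spike_set[OF n])
    ultimately show ?thesis by (auto simp: set_lebesgue_integral_eq_integral(2))
  qed
  have U\<Omega>: "\<Union>\<U> \<subseteq> \<Omega>" using U(2) by auto
  have "P ` \<Omega> - P ` \<Union>\<U> \<subseteq> P ` (\<Omega> - \<Union>\<U>)" by auto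
  then have neg': "negligible (P ` \<Omega> - P ` \<Union>\<U>)" using neg(2) negligible_subset by blast
  have on: "integrable (lebesgue_on X) h \<longleftrightarrow> set_integrable lebesgue X h"
    "integral\<^sup>L (lebesgue_on X) h = (LINT x:X|lebesgue. h x)" if "X \<in> sets lebesgue" for X and h :: "real ^ 'n \<Rightarrow> real"
    using that by (simp_all add: set_integrable_def set_lebesgue_integral_def integrable_restrict_space integral_restrict_space)
  have final: "(integrable (lebesgue_on (P ` \<Omega>)) f \<longleftrightarrow> integrable (lebesgue_on \<Omega>) (\<lambda>\<xi>. J \<xi> * f (P \<xi>))) \<and>
      (integrable (lebesgue_on (P ` \<Omega>)) f \<longrightarrow>
       (LINT y|lebesgue_on (P ` \<Omega>). f y) = (LINT \<xi>|lebesgue_on \<Omega>. J \<xi> * f (P \<xi>)))" for f :: "real ^ 'n \<Rightarrow> real"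
    unfolding on[OF D] on[OF \<Omega>(2)]
    using spike[OF image_mono[OF U\<Omega>] neg', of f] spike[OF U\<Omega> neg(1), of "\<lambda>\<xi>. J \<xi> * f (P \<xi>)"] main[of f] by auto
  show ?thesis
  proof (rule that[of J "max C c"])
    show "c \<le> J \<xi>" for \<xi> using jac[of \<xi>] by (auto simp: J_def)
    show "J \<xi> \<le> max C c" for \<xi>
      using jac[of \<xi>] by (cases "\<xi> \<in> \<Union>\<U>") (simp_all only: J_def if_True if_False le_max_iff_disj order_refl simp_thms)
  qed (use J_meas final in auto)
qed

section \<open>Transport of square-integrable functions\<close>

lemma restrict_space_torus:
  assumes "X \<subseteq> torus" "X \<in> sets lebesgue" shows "lebesgue_on X = restrict_space torus_measure X"
  using assms torus_lebesgue by (subst restrict_restrict_space) (auto simp: Int_absorb1)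

lemma restrict_to_measurable:
  fixes g :: "real ^ 'n \<Rightarrow> complex"
  assumes X: "X \<subseteq> torus" "X \<in> sets lebesgue" and g: "g \<in> borel_measurable (lebesgue_on X)"
  shows "restrict_to X g \<in> borel_measurable torus_measure"
  unfolding restrict_to_def
  by (rule measurable_restrict_space1, rule borel_measurable_if_I[OF g X(2)])

lemma restrict_to_L2:
  fixes g :: "real ^ 'n \<Rightarrow> complex"
  assumes X: "X \<subseteq> torus" "X \<in> sets lebesgue" and g: "g \<in> borel_measurable (lebesgue_on X)"
    and i: "integrable (lebesgue_on X) (\<lambda>\<xi>. (cmod (g \<xi>))\<^sup>2)"
  shows "restrict_to X g \<in> L2 X"
proof -
  have Xt: "X \<inter> space torus_measure \<in> sets torus_measure"
    using X torus_lebesgue by (simp add: sets_restrict_space_iff Int_absorb2)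
  have "integrable torus_measure (\<lambda>\<xi>. indicator X \<xi> *\<^sub>R (cmod (g \<xi>))\<^sup>2)"
    using i unfolding restrict_space_torus[OF X] integrable_restrict_space[OF Xt] .
  moreover have "indicator X \<xi> *\<^sub>R (cmod (g \<xi>))\<^sup>2 = (cmod (restrict_to X g \<xi>))\<^sup>2" for \<xi>
    by (simp add: restrict_to_def indicator_def)
  ultimately show ?thesis
    using restrict_to_measurable[OF X g] by (auto simp: L2_def restrict_to_def)
qed

lemma L2_on_support:
  fixes g :: "real ^ 'n \<Rightarrow> complex"
  assumes X: "X \<subseteq> torus" "X \<in> sets lebesgue" and g: "g \<in> L2 X"
  shows "g \<in> borel_measurable (lebesgue_on X)"
    and "integrable (lebesgue_on X) (\<lambda>\<xi>. (cmod (g \<xi>))\<^sup>2)"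
    and "integrable (lebesgue_on X) g"
    and "(L2_norm g)\<^sup>2 = (LINT \<xi>|lebesgue_on X. (cmod (g \<xi>))\<^sup>2)"
proof -
  have Xt: "X \<inter> space torus_measure \<in> sets torus_measure"
    using X torus_lebesgue by (simp add: sets_restrict_space_iff Int_absorb2)
  then have Xt': "X \<in> sets torus_measure" using X by (simp add: Int_absorb2)
  note [measurable] = L2_measurable[OF g] Xt'
  show "g \<in> borel_measurable (lebesgue_on X)"
    unfolding restrict_space_torus[OF X] by (rule measurable_restrict_space1[OF L2_measurable[OF g]])
  show "integrable (lebesgue_on X) (\<lambda>\<xi>. (cmod (g \<xi>))\<^sup>2)"
    unfolding restrict_space_torus[OF X] integrable_restrict_space[OF Xt]
    by (rule integrable_mult_indicator[OF Xt' L2_integrable_sq[OF g]])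
  have "integrable torus_measure g"
    using L2_integrable_product(1)[OF g L2_one] by simp
  then show "integrable (lebesgue_on X) g"
    unfolding restrict_space_torus[OF X] integrable_restrict_space[OF Xt]
    by (rule integrable_mult_indicator[OF Xt'])
  show "(L2_norm g)\<^sup>2 = (LINT \<xi>|lebesgue_on X. (cmod (g \<xi>))\<^sup>2)"
    unfolding L2_norm_sq restrict_space_torus[OF X] integral_restrict_space[OF Xt]
    by (rule integral_cong_AE)
      (use L2_AE_zero[OF g] in \<open>auto simp: indicator_def elim!: eventually_mono\<close>)
qed

lemma L2_inner_on_support:
  fixes g h :: "real ^ 'n \<Rightarrow> complex"
  assumes X: "X \<subseteq> torus" "X \<in> sets lebesgue" and g: "g \<in> L2 X" and h: "h \<in> L2 X"
  shows "L2_inner g h = (LINT \<xi>|lebesgue_on X. g \<xi> * cnj (h \<xi>))"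
    and "integrable (lebesgue_on X) (\<lambda>\<xi>. g \<xi> * cnj (h \<xi>))"
proof -
  have Xt: "X \<inter> space torus_measure \<in> sets torus_measure"
    using X torus_lebesgue by (simp add: sets_restrict_space_iff Int_absorb2)
  then have Xt': "X \<in> sets torus_measure" using X by (simp add: Int_absorb2)
  note [measurable] = L2_measurable[OF g] L2_measurable[OF h] Xt'
  show "L2_inner g h = (LINT \<xi>|lebesgue_on X. g \<xi> * cnj (h \<xi>))"
    unfolding L2_inner_def restrict_space_torus[OF X] integral_restrict_space[OF Xt]
  proof (rule integral_cong_AE)
    show "AE \<xi> in torus_measure. g \<xi> * cnj (h \<xi>) = indicator X \<xi> *\<^sub>R (g \<xi> * cnj (h \<xi>))"
      using L2_AE_zero[OF g] by eventually_elim (auto simp: indicator_def)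
  qed measurable
  show "integrable (lebesgue_on X) (\<lambda>\<xi>. g \<xi> * cnj (h \<xi>))"
    unfolding restrict_space_torus[OF X] integrable_restrict_space[OF Xt]
    by (rule integrable_mult_indicator[OF Xt' L2_integrable_product(1)[OF g h]])
qed

lemma L2_eq_on_support:
  fixes g h :: "real ^ 'n \<Rightarrow> complex"
  assumes X: "X \<subseteq> torus" "X \<in> sets lebesgue" and g: "g \<in> L2 X" and h: "h \<in> L2 X"
  shows "L2_eq g h \<longleftrightarrow> (AE \<xi> in lebesgue_on X. g \<xi> = h \<xi>)"
proof -
  have Xt: "X \<inter> space torus_measure \<in> sets torus_measure"
    using X torus_lebesgue by (simp add: sets_restrict_space_iff Int_absorb2)
  have *: "AE \<xi> in torus_measure. \<xi> \<notin> X \<longrightarrow> g \<xi> = h \<xi>"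
    using L2_AE_zero[OF g] L2_AE_zero[OF h] by eventually_elim auto
  show ?thesis
    unfolding L2_eq_def restrict_space_torus[OF X] AE_restrict_space_iff[OF Xt]
  proof
    assume "AE \<xi> in torus_measure. \<xi> \<in> X \<longrightarrow> g \<xi> = h \<xi>"
    then show "AE \<xi> in torus_measure. g \<xi> = h \<xi>" using * by eventually_elim auto
  qed (auto elim: eventually_mono)
qed

lemma complex_integrable_parts:
  fixes f :: "'a \<Rightarrow> complex"
  assumes "integrable M (\<lambda>x. Re (f x))" "integrable M (\<lambda>x. Im (f x))"
  shows "integrable M f"
proof -
  have "integrable M (\<lambda>x. complex_of_real (Re (f x)) + \<i> * complex_of_real (Im (f x)))"
    using assms by (intro Bochner_Integration.integrable_add integrable_mult_right integrable_of_real)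
  then show ?thesis by (simp flip: complex_eq)
qed

text \<open>On \<open>\<Omega>\<close>, up to a null set, \<open>J\<close> plays the part of the modulus of the Jacobian determinant of \<open>P\<close>; it is
  extended in such a way that its bounds hold everywhere.\<close>

locale torus_transport =
  fixes P :: "real ^ 'n \<Rightarrow> real ^ 'n" and \<Omega> D :: "(real ^ 'n) set"
    and J :: "real ^ 'n \<Rightarrow> real" and c C' :: real
  assumes bij: "bij_betw P torus torus"
    and \<Omega>: "\<Omega> \<subseteq> torus" "\<Omega> \<in> sets lebesgue" and D_eq: "D = P ` \<Omega>" and D_leb: "D \<in> sets lebesgue"
    and J_meas: "J \<in> borel_measurable (lebesgue_on \<Omega>)"
    and c_pos: "0 < c" and J_ge: "\<And>\<xi>. c \<le> J \<xi>" and J_le: "\<And>\<xi>. J \<xi> \<le> C'"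
    and cov_integrable: "\<And>f :: real ^ 'n \<Rightarrow> real.
       integrable (lebesgue_on D) f \<longleftrightarrow> integrable (lebesgue_on \<Omega>) (\<lambda>\<xi>. J \<xi> * f (P \<xi>))"
    and cov_integral: "\<And>f :: real ^ 'n \<Rightarrow> real. integrable (lebesgue_on D) f \<Longrightarrow>
       (LINT y|lebesgue_on D. f y) = (LINT \<xi>|lebesgue_on \<Omega>. J \<xi> * f (P \<xi>))"
begin

lemma J_pos: "0 < J \<xi>"
  using c_pos J_ge[of \<xi>] by linarith

lemma D_torus: "D \<subseteq> torus"
  using bij \<Omega>(1) by (auto simp: D_eq bij_betw_def)

lemma inv_P: "\<xi> \<in> \<Omega> \<Longrightarrow> inv_into torus P (P \<xi>) = \<xi>"
  using bij \<Omega>(1) by (auto simp: bij_betw_def intro!: inv_into_f_f)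

lemma P_D: "\<xi> \<in> \<Omega> \<Longrightarrow> P \<xi> \<in> D"
  by (simp add: D_eq)

lemma transport_op_P: "\<xi> \<in> \<Omega> \<Longrightarrow> transport_op P D g (P \<xi>) = g \<xi>"
  by (simp add: transport_op_def restrict_to_def P_D inv_P)

lemma cov_complex:
  fixes f :: "real ^ 'n \<Rightarrow> complex"
  assumes f: "integrable (lebesgue_on D) f"
  shows "integrable (lebesgue_on \<Omega>) (\<lambda>\<xi>. of_real (J \<xi>) * f (P \<xi>))"
    and "(LINT y|lebesgue_on D. f y) = (LINT \<xi>|lebesgue_on \<Omega>. of_real (J \<xi>) * f (P \<xi>))"
proof -
  have R: "integrable (lebesgue_on D) (\<lambda>y. Re (f y))" "integrable (lebesgue_on D) (\<lambda>y. Im (f y))"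
    using f by auto
  show i: "integrable (lebesgue_on \<Omega>) (\<lambda>\<xi>. of_real (J \<xi>) * f (P \<xi>))"
    using R[THEN cov_integrable[THEN iffD1]] by (intro complex_integrable_parts) simp_all
  show "(LINT y|lebesgue_on D. f y) = (LINT \<xi>|lebesgue_on \<Omega>. of_real (J \<xi>) * f (P \<xi>))"
  proof (rule complex_eqI)
    show "Re (LINT y|lebesgue_on D. f y) = Re (LINT \<xi>|lebesgue_on \<Omega>. of_real (J \<xi>) * f (P \<xi>))"
      using cov_integral[OF R(1)] integral_Re[OF f] integral_Re[OF i] by simp
    show "Im (LINT y|lebesgue_on D. f y) = Im (LINT \<xi>|lebesgue_on \<Omega>. of_real (J \<xi>) * f (P \<xi>))"
      using cov_integral[OF R(2)] integral_Im[OF f] integral_Im[OF i] by simp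
  qed
qed

text \<open>Square-integrability of \<open>h\<close> on \<open>D\<close> makes \<open>J (h \<circ> P)\<close> integrable, hence measurable, and \<open>J\<close> can be
  divided out.\<close>

lemma pullback_L2:
  assumes h: "h \<in> L2 D" shows "restrict_to \<Omega> (h \<circ> P) \<in> L2 \<Omega>"
proof (rule restrict_to_L2[OF \<Omega>])
  note hD = L2_on_support[OF D_torus D_leb h]
  note [measurable] = J_meas
  have m: "(\<lambda>\<xi>. of_real (J \<xi>) * h (P \<xi>)) \<in> borel_measurable (lebesgue_on \<Omega>)"
    using cov_complex(1)[OF hD(3)] by (rule borel_measurable_integrable)
  have "(\<lambda>\<xi>. of_real (J \<xi>) * h (P \<xi>) / of_real (J \<xi>)) \<in> borel_measurable (lebesgue_on \<Omega>)"
    using m by measurable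
  moreover have "of_real (J \<xi>) * h (P \<xi>) / of_real (J \<xi>) = (h \<circ> P) \<xi>" for \<xi>
    using J_pos[of \<xi>] by simp
  ultimately show [measurable]: "h \<circ> P \<in> borel_measurable (lebesgue_on \<Omega>)" by (simp add: o_def)
  have "integrable (lebesgue_on \<Omega>) (\<lambda>\<xi>. J \<xi> * (cmod (h (P \<xi>)))\<^sup>2 / c)"
    using hD(2) cov_integrable by simp
  then show "integrable (lebesgue_on \<Omega>) (\<lambda>\<xi>. (cmod ((h \<circ> P) \<xi>))\<^sup>2)"
  proof (rule Bochner_Integration.integrable_bound)
    show "AE \<xi> in lebesgue_on \<Omega>. norm ((cmod ((h \<circ> P) \<xi>))\<^sup>2) \<le> norm (J \<xi> * (cmod (h (P \<xi>)))\<^sup>2 / c)"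
    proof (rule AE_I2)
      fix \<xi>
      have "c * (cmod (h (P \<xi>)))\<^sup>2 \<le> J \<xi> * (cmod (h (P \<xi>)))\<^sup>2"
        by (intro mult_right_mono J_ge) simp
      then have "(cmod (h (P \<xi>)))\<^sup>2 \<le> J \<xi> * (cmod (h (P \<xi>)))\<^sup>2 / c"
        using c_pos by (simp add: pos_le_divide_eq mult.commute)
      then show "norm ((cmod ((h \<circ> P) \<xi>))\<^sup>2) \<le> norm (J \<xi> * (cmod (h (P \<xi>)))\<^sup>2 / c)"
        using c_pos J_pos[of \<xi>] by (simp add: abs_mult)
    qed
  qed measurable
qed

lemma weighted_integrable:
  fixes f :: "real ^ 'n \<Rightarrow> real"
  assumes f: "integrable (lebesgue_on \<Omega>) f"
  shows "integrable (lebesgue_on \<Omega>) (\<lambda>\<xi>. J \<xi> * f \<xi>)"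
proof (rule Bochner_Integration.integrable_bound)
  show "integrable (lebesgue_on \<Omega>) (\<lambda>\<xi>. C' * f \<xi>)" using f by simp
  show "(\<lambda>\<xi>. J \<xi> * f \<xi>) \<in> borel_measurable (lebesgue_on \<Omega>)"
    using J_meas borel_measurable_integrable[OF f] by measurable
  show "AE \<xi> in lebesgue_on \<Omega>. norm (J \<xi> * f \<xi>) \<le> norm (C' * f \<xi>)"
  proof (rule AE_I2)
    fix \<xi>
    have "\<bar>J \<xi>\<bar> \<le> \<bar>C'\<bar>" using J_pos[of \<xi>] J_le[of \<xi>] by simp
    then show "norm (J \<xi> * f \<xi>) \<le> norm (C' * f \<xi>)" by (simp add: abs_mult mult_right_mono)
  qed
qed

lemma transport_op_L2:
  assumes g: "g \<in> L2 \<Omega>"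
  shows "transport_op P D g \<in> L2 D"
    and "(L2_norm (transport_op P D g))\<^sup>2 = (LINT \<xi>|lebesgue_on \<Omega>. J \<xi> * (cmod (g \<xi>))\<^sup>2)"
proof -
  note g\<Omega> = L2_on_support[OF \<Omega> g]
  define u where "u = g \<circ> inv_into torus P"
  have uP: "u (P \<xi>) = g \<xi>" if "\<xi> \<in> \<Omega>" for \<xi> by (simp add: u_def inv_P[OF that])
  have cov: "integrable (lebesgue_on D) (\<lambda>y. \<phi> (u y))" if "integrable (lebesgue_on \<Omega>) (\<lambda>\<xi>. \<phi> (g \<xi>))"
    for \<phi> :: "complex \<Rightarrow> real"
    unfolding cov_integrable
    using weighted_integrable[OF that] by (rule Bochner_Integration.integrable_cong[THEN iffD1, rotated 2]) (auto simp: uP)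
  have i1: "integrable (lebesgue_on D) (\<lambda>y. Re (u y))" "integrable (lebesgue_on D) (\<lambda>y. Im (u y))"
    using g\<Omega>(3) by (auto intro!: cov)
  have um: "u \<in> borel_measurable (lebesgue_on D)"
    using complex_integrable_parts[OF i1] by (rule borel_measurable_integrable)
  have i2: "integrable (lebesgue_on D) (\<lambda>y. (cmod (u y))\<^sup>2)"
    by (rule cov[OF g\<Omega>(2)])
  show S: "transport_op P D g \<in> L2 D"
    unfolding transport_op_def u_def[symmetric] by (rule restrict_to_L2[OF D_torus D_leb um i2])
  show "(L2_norm (transport_op P D g))\<^sup>2 = (LINT \<xi>|lebesgue_on \<Omega>. J \<xi> * (cmod (g \<xi>))\<^sup>2)"
    unfolding L2_on_support(4)[OF D_torus D_leb S] cov_integral[OF L2_on_support(2)[OF D_torus D_leb S]]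
    by (rule Bochner_Integration.integral_cong) (auto simp: transport_op_P)
qed

lemma pullback_eq:
  assumes h: "h \<in> L2 D" "h' \<in> L2 D" and eq: "L2_eq h h'"
  shows "AE \<xi> in lebesgue_on \<Omega>. h (P \<xi>) = h' (P \<xi>)"
proof -
  have d: "(\<lambda>y. h y - h' y) \<in> L2 D" by (rule L2_diff[OF h])
  note dD = L2_on_support[OF D_torus D_leb d]
  have "L2_norm (\<lambda>y. h y - h' y) = L2_norm (\<lambda>y :: real ^ 'n. 0 :: complex)"
    using eq by (intro L2_norm_cong[OF _ d L2_zero[of D]]) (auto simp: L2_eq_def elim: eventually_mono)
  then have "(L2_norm (\<lambda>y. h y - h' y))\<^sup>2 = 0" by (simp add: L2_norm_def)
  then have z: "(LINT \<xi>|lebesgue_on \<Omega>. J \<xi> * (cmod (h (P \<xi>) - h' (P \<xi>)))\<^sup>2) = 0"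
    unfolding dD(4) cov_integral[OF dD(2)] .
  have i: "integrable (lebesgue_on \<Omega>) (\<lambda>\<xi>. J \<xi> * (cmod (h (P \<xi>) - h' (P \<xi>)))\<^sup>2)"
    using dD(2) by (simp add: cov_integrable)
  have "AE \<xi> in lebesgue_on \<Omega>. J \<xi> * (cmod (h (P \<xi>) - h' (P \<xi>)))\<^sup>2 = 0"
    using z by (subst (asm) integral_nonneg_eq_0_iff_AE[OF i]) (auto intro!: AE_I2 mult_nonneg_nonneg less_imp_le[OF J_pos])
  then show ?thesis
  proof eventually_elim
    case (elim \<xi>)
    then show ?case using J_pos[of \<xi>] by simp
  qed
qed

lemma transport_op_cong:
  assumes g: "g \<in> L2 \<Omega>" "g' \<in> L2 \<Omega>" and eq: "L2_eq g g'"
  shows "L2_eq (transport_op P D g) (transport_op P D g')"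
proof -
  have d: "(\<lambda>\<xi>. g \<xi> - g' \<xi>) \<in> L2 \<Omega>" by (rule L2_diff[OF g])
  note S = transport_op_L2[OF d]
  have "AE \<xi> in lebesgue_on \<Omega>. g \<xi> = g' \<xi>" using eq by (simp add: L2_eq_on_support[OF \<Omega> g])
  then have "(LINT \<xi>|lebesgue_on \<Omega>. J \<xi> * (cmod (g \<xi> - g' \<xi>))\<^sup>2) = 0"
    by (intro integral_eq_zero_AE) (auto elim: eventually_mono)
  then have "L2_norm (transport_op P D (\<lambda>\<xi>. g \<xi> - g' \<xi>)) = 0" using S(2) by simp
  from L2_norm_eq_0[OF S(1) this] have "AE y in torus_measure. transport_op P D (\<lambda>\<xi>. g \<xi> - g' \<xi>) y = 0"
    by (simp add: L2_eq_def)
  then show ?thesis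
    unfolding L2_eq_def by eventually_elim (auto simp: transport_op_def restrict_to_def split: if_splits)
qed

text \<open>The choice in \<open>S\<^sup>-\<^sup>1\<close> is immaterial: it is composition with \<open>P\<close> up to null sets.\<close>

lemma transport_op_inv_spec:
  assumes h: "h \<in> L2 D"
  shows "transport_op_inv P \<Omega> D h \<in> L2 \<Omega>"
    and "L2_eq (transport_op P D (transport_op_inv P \<Omega> D h)) h"
    and "AE \<xi> in lebesgue_on \<Omega>. transport_op_inv P \<Omega> D h \<xi> = h (P \<xi>)"
proof -
  let ?g = "restrict_to \<Omega> (h \<circ> P)"
  have g: "?g \<in> L2 \<Omega>" by (rule pullback_L2[OF h])
  have "transport_op P D ?g y = h y" if y: "y \<in> D" for y
  proof -
    obtain \<xi> where "\<xi> \<in> \<Omega>" "y = P \<xi>" using y by (auto simp: D_eq)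
    then show ?thesis by (simp add: transport_op_P restrict_to_def)
  qed
  then have "L2_eq (transport_op P D ?g) h"
    unfolding L2_eq_on_support[OF D_torus D_leb transport_op_L2(1)[OF g] h] by (intro AE_I2) simp
  then have "\<exists>g. g \<in> L2 \<Omega> \<and> L2_eq (transport_op P D g) h" using g by blast
  from someI_ex[OF this] show inv: "transport_op_inv P \<Omega> D h \<in> L2 \<Omega>"
    and eq: "L2_eq (transport_op P D (transport_op_inv P \<Omega> D h)) h"
    unfolding transport_op_inv_def by auto
  have "AE \<xi> in lebesgue_on \<Omega>. transport_op P D (transport_op_inv P \<Omega> D h) (P \<xi>) = h (P \<xi>)"
    by (rule pullback_eq[OF transport_op_L2(1)[OF inv] h eq])
  moreover have "AE \<xi> in lebesgue_on \<Omega>. \<xi> \<in> \<Omega>" by (rule AE_I2) simp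
  ultimately show "AE \<xi> in lebesgue_on \<Omega>. transport_op_inv P \<Omega> D h \<xi> = h (P \<xi>)"
    by eventually_elim (simp add: transport_op_P)
qed

text \<open>The adjoint of \<open>S\<^sup>-\<^sup>1\<close> is \<open>F \<mapsto> S (F / J)\<close>; it is bounded above and below because \<open>J\<close> is.\<close>

lemma adjoint_exists:
  assumes F: "F \<in> L2 \<Omega>"
  obtains G where "G \<in> L2 D"
    "\<And>h. h \<in> L2 D \<Longrightarrow> L2_inner G h = L2_inner F (transport_op_inv P \<Omega> D h)"
    "(L2_norm F)\<^sup>2 \<le> C' * (L2_norm G)\<^sup>2" "c * (L2_norm G)\<^sup>2 \<le> (L2_norm F)\<^sup>2"
proof -
  note F\<Omega> = L2_on_support[OF \<Omega> F]
  define F1 where "F1 = restrict_to \<Omega> (\<lambda>\<xi>. F \<xi> / of_real (J \<xi>))"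
  note [measurable] = F\<Omega>(1) J_meas
  have le: "(cmod (F \<xi> / of_real (J \<xi>)))\<^sup>2 \<le> (cmod (F \<xi>))\<^sup>2 / c\<^sup>2" for \<xi>
    using J_pos[of \<xi>] J_ge[of \<xi>] c_pos
    by (auto simp: norm_divide power_divide intro!: divide_left_mono power_mono mult_pos_pos)
  have F1: "F1 \<in> L2 \<Omega>"
    unfolding F1_def
  proof (rule restrict_to_L2[OF \<Omega>])
    show m: "(\<lambda>\<xi>. F \<xi> / of_real (J \<xi>)) \<in> borel_measurable (lebesgue_on \<Omega>)" by measurable
    have "integrable (lebesgue_on \<Omega>) (\<lambda>\<xi>. (cmod (F \<xi>))\<^sup>2 / c\<^sup>2)" using F\<Omega>(2) by simp
    then show "integrable (lebesgue_on \<Omega>) (\<lambda>\<xi>. (cmod (F \<xi> / of_real (J \<xi>)))\<^sup>2)"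
      by (rule Bochner_Integration.integrable_bound) (use m le in \<open>auto intro!: AE_I2\<close>)
  qed
  define G where "G = transport_op P D F1"
  have G: "G \<in> L2 D" unfolding G_def by (rule transport_op_L2(1)[OF F1])
  have inner: "L2_inner G h = L2_inner F (transport_op_inv P \<Omega> D h)" if h: "h \<in> L2 D" for h
  proof -
    note inv = transport_op_inv_spec[OF h]
    have "L2_inner G h = (LINT \<xi>|lebesgue_on \<Omega>. of_real (J \<xi>) * (G (P \<xi>) * cnj (h (P \<xi>))))"
      unfolding L2_inner_on_support(1)[OF D_torus D_leb G h]
      by (rule cov_complex(2)[OF L2_inner_on_support(2)[OF D_torus D_leb G h]])
    also have "\<dots> = (LINT \<xi>|lebesgue_on \<Omega>. F \<xi> * cnj (transport_op_inv P \<Omega> D h \<xi>))"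
    proof (rule integral_cong_AE)
      show "AE \<xi> in lebesgue_on \<Omega>. of_real (J \<xi>) * (G (P \<xi>) * cnj (h (P \<xi>))) = F \<xi> * cnj (transport_op_inv P \<Omega> D h \<xi>)"
      proof -
        have "AE \<xi> in lebesgue_on \<Omega>. \<xi> \<in> \<Omega>" by (rule AE_I2) simp
        with inv(3) show ?thesis
        proof eventually_elim
          case (elim \<xi>)
          then show ?case
            using J_pos[of \<xi>] by (simp add: G_def transport_op_P F1_def restrict_to_def)
        qed
      qed
      show "(\<lambda>\<xi>. of_real (J \<xi>) * (G (P \<xi>) * cnj (h (P \<xi>)))) \<in> borel_measurable (lebesgue_on \<Omega>)"
        by (rule borel_measurable_integrable[OF cov_complex(1)[OF L2_inner_on_support(2)[OF D_torus D_leb G h]]])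
      show "(\<lambda>\<xi>. F \<xi> * cnj (transport_op_inv P \<Omega> D h \<xi>)) \<in> borel_measurable (lebesgue_on \<Omega>)"
        by (rule borel_measurable_integrable[OF L2_inner_on_support(2)[OF \<Omega> F inv(1)]])
    qed
    also have "\<dots> = L2_inner F (transport_op_inv P \<Omega> D h)"
      by (rule L2_inner_on_support(1)[OF \<Omega> F inv(1), symmetric])
    finally show ?thesis .
  qed
  have normG: "(L2_norm G)\<^sup>2 = (LINT \<xi>|lebesgue_on \<Omega>. J \<xi> * (cmod (F1 \<xi>))\<^sup>2)"
    unfolding G_def by (rule transport_op_L2(2)[OF F1])
  have iF1: "integrable (lebesgue_on \<Omega>) (\<lambda>\<xi>. J \<xi> * (cmod (F1 \<xi>))\<^sup>2)"
    by (rule weighted_integrable[OF L2_on_support(2)[OF \<Omega> F1]])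
  have eq: "J \<xi> * (cmod (F1 \<xi>))\<^sup>2 = (cmod (F \<xi>))\<^sup>2 / J \<xi>" if "\<xi> \<in> \<Omega>" for \<xi>
    using J_pos[of \<xi>] that by (simp add: F1_def restrict_to_def norm_divide power_divide power2_eq_square)
  have "(L2_norm F)\<^sup>2 \<le> (LINT \<xi>|lebesgue_on \<Omega>. C' * (J \<xi> * (cmod (F1 \<xi>))\<^sup>2))"
    unfolding F\<Omega>(4)
  proof (rule integral_mono[OF F\<Omega>(2)])
    show "integrable (lebesgue_on \<Omega>) (\<lambda>\<xi>. C' * (J \<xi> * (cmod (F1 \<xi>))\<^sup>2))" using iF1 by simp
    fix \<xi> assume "\<xi> \<in> space (lebesgue_on \<Omega>)"
    then have "C' * (J \<xi> * (cmod (F1 \<xi>))\<^sup>2) = C' * ((cmod (F \<xi>))\<^sup>2 / J \<xi>)" by (simp add: eq)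
    moreover have "J \<xi> * ((cmod (F \<xi>))\<^sup>2 / J \<xi>) \<le> C' * ((cmod (F \<xi>))\<^sup>2 / J \<xi>)"
      using J_pos[of \<xi>] by (intro mult_right_mono J_le) auto
    ultimately show "(cmod (F \<xi>))\<^sup>2 \<le> C' * (J \<xi> * (cmod (F1 \<xi>))\<^sup>2)" using J_pos[of \<xi>] by simp
  qed
  then have upper: "(L2_norm F)\<^sup>2 \<le> C' * (L2_norm G)\<^sup>2" unfolding normG by simp
  have "(LINT \<xi>|lebesgue_on \<Omega>. c * (J \<xi> * (cmod (F1 \<xi>))\<^sup>2)) \<le> (L2_norm F)\<^sup>2"
    unfolding F\<Omega>(4)
  proof (rule integral_mono[OF _ F\<Omega>(2)])
    show "integrable (lebesgue_on \<Omega>) (\<lambda>\<xi>. c * (J \<xi> * (cmod (F1 \<xi>))\<^sup>2))" using iF1 by simp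
    fix \<xi> assume "\<xi> \<in> space (lebesgue_on \<Omega>)"
    then have "c * (J \<xi> * (cmod (F1 \<xi>))\<^sup>2) = c * ((cmod (F \<xi>))\<^sup>2 / J \<xi>)" by (simp add: eq)
    moreover have "c * ((cmod (F \<xi>))\<^sup>2 / J \<xi>) \<le> J \<xi> * ((cmod (F \<xi>))\<^sup>2 / J \<xi>)"
      using J_pos[of \<xi>] by (intro mult_right_mono J_ge) auto
    ultimately show "c * (J \<xi> * (cmod (F1 \<xi>))\<^sup>2) \<le> (cmod (F \<xi>))\<^sup>2" using J_pos[of \<xi>] by simp
  qed
  then have lower: "c * (L2_norm G)\<^sup>2 \<le> (L2_norm F)\<^sup>2" unfolding normG by simp
  show ?thesis by (rule that[OF G inner upper lower])
qed

end

section \<open>Expansions in an orthonormal basis\<close>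

lemma L2_basis_orthonormal: "L2_orthonormal_basis E \<psi> \<Longrightarrow> L2_orthonormal E \<psi>"
  by (simp add: L2_orthonormal_basis_def L2_orthonormal_def)

lemma L2_basis_inner_sums:
  assumes b: "L2_orthonormal_basis E \<psi>" and g: "g \<in> L2 E" and h: "h \<in> L2 E"
  shows "(\<lambda>j. L2_inner g (\<psi> j) * cnj (L2_inner h (\<psi> j))) sums L2_inner g h"
  unfolding sums_def
  by (rule L2_series_inner[OF L2_basis_orthonormal[OF b] g h])
    (use b g in \<open>simp add: L2_orthonormal_basis_def\<close>)

lemma L2_basis_Parseval:
  assumes b: "L2_orthonormal_basis E \<psi>" and g: "g \<in> L2 E"
  shows "summable (\<lambda>j. (cmod (L2_inner g (\<psi> j)))\<^sup>2)"
    and "sqsum (\<lambda>j. L2_inner g (\<psi> j)) = (L2_norm g)\<^sup>2"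
proof -
  have "(\<lambda>j. of_real ((cmod (L2_inner g (\<psi> j)))\<^sup>2)) sums complex_of_real ((L2_norm g)\<^sup>2)"
    using L2_basis_inner_sums[OF b g g] unfolding L2_inner_self complex_norm_square[symmetric] by simp
  then have "(\<lambda>j. (cmod (L2_inner g (\<psi> j)))\<^sup>2) sums (L2_norm g)\<^sup>2"
    by (simp only: sums_of_real_iff)
  then show "summable (\<lambda>j. (cmod (L2_inner g (\<psi> j)))\<^sup>2)"
    and "sqsum (\<lambda>j. L2_inner g (\<psi> j)) = (L2_norm g)\<^sup>2"
    by (simp_all add: sums_iff sqsum_def)
qed

text \<open>As \<open>\<bar>\<lambda>\<^sub>j\<bar> \<le> 1\<close>, the new coefficients are again square-summable, and Riesz--Fischer provides the sum.\<close>

lemma diagonal_op_spec: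
  assumes b: "L2_orthonormal_basis E \<psi>" and lam: "\<And>j. cmod (lam j) \<le> 1" and g: "g \<in> L2 E"
  shows "diagonal_op E \<psi> lam g \<in> L2 E"
    and "L2_inner (diagonal_op E \<psi> lam g) (\<psi> j) = lam j * L2_inner g (\<psi> j)"
proof -
  note o = L2_basis_orthonormal[OF b]
  let ?a = "\<lambda>j. lam j * L2_inner g (\<psi> j)"
  let ?Q = "\<lambda>u. u \<in> L2 E \<and> L2_tendsto (\<lambda>N \<xi>. \<Sum>j<N. ?a j * \<psi> j \<xi>) u sequentially"
  have "(\<lambda>j. (cmod (?a j))\<^sup>2) summable_on UNIV"
  proof (rule summable_on_comparison_test[OF L2_Bessel_summable[OF o L2_subset_torus[OF g]]])
    fix j
    have "cmod (?a j) \<le> 1 * cmod (L2_inner g (\<psi> j))"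
      unfolding norm_mult by (intro mult_right_mono lam) simp
    then show "(cmod (?a j))\<^sup>2 \<le> (cmod (L2_inner g (\<psi> j)))\<^sup>2" by (simp add: power_mono)
  qed simp
  then obtain u where u: "u \<in> L2 E" "L2_tendsto (\<lambda>K \<xi>. \<Sum>j\<in>K. ?a j * \<psi> j \<xi>) u (finite_subsets_at_top UNIV)"
    by (rule L2_series_exists[OF o])
  have "filterlim (\<lambda>N :: nat. {..<N}) (finite_subsets_at_top UNIV) sequentially"
    unfolding filterlim_iff eventually_finite_subsets_at_top
  proof (intro allI impI)
    fix Q :: "nat set \<Rightarrow> bool"
    assume "\<exists>X. finite X \<and> X \<subseteq> UNIV \<and> (\<forall>Y. finite Y \<and> X \<subseteq> Y \<and> Y \<subseteq> UNIV \<longrightarrow> Q Y)"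
    then obtain X where X: "finite X" "\<And>Y. finite Y \<Longrightarrow> X \<subseteq> Y \<Longrightarrow> Q Y" by auto
    then obtain m where "X \<subseteq> {..<m}" using finite_nat_bounded by blast
    then show "\<forall>\<^sub>F N in sequentially. Q {..<N}"
      by (intro eventually_sequentiallyI[of m] X(2)) auto
  qed
  then have "L2_tendsto (\<lambda>N \<xi>. \<Sum>j<N. ?a j * \<psi> j \<xi>) u sequentially"
    using u(2) unfolding L2_tendsto_def by (rule filterlim_compose[rotated])
  then have "\<exists>u. ?Q u" using u(1) by blast
  from someI_ex[OF this] have T: "?Q (diagonal_op E \<psi> lam g)" unfolding diagonal_op_def .
  then show "diagonal_op E \<psi> lam g \<in> L2 E" by blast
  show "L2_inner (diagonal_op E \<psi> lam g) (\<psi> j) = lam j * L2_inner g (\<psi> j)"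
  proof (rule L2_series_coeff[OF o])
    show "\<forall>\<^sub>F N in sequentially. finite {..<N} \<and> j \<in> {..<N}"
      by (intro eventually_sequentiallyI[of "Suc j"]) auto
  qed (use T in auto)
qed

text \<open>Equality is literal, not only almost everywhere, because the choice in \<open>diagonal_op\<close> depends on its
  argument only through the coefficients.\<close>

lemma diagonal_op_cong:
  "(\<And>j. L2_inner g (\<psi> j) = L2_inner g' (\<psi> j)) \<Longrightarrow> diagonal_op E \<psi> lam g = diagonal_op E \<psi> lam g'"
  by (simp add: diagonal_op_def)

section \<open>The frame\<close>

lemma Omega_torus: "Omega \<omega> \<subseteq> torus"
  by (auto simp: Omega_def)

lemma Omega_lebesgue: "(Omega \<omega> :: (real ^ 'n) set) \<in> sets lebesgue"
proof -
  have "closed {\<xi> :: real ^ 'n. laplacian_symbol \<xi> \<le> \<omega>}"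
    unfolding laplacian_symbol_def by (intro closed_Collect_le continuous_intros)
  then have "torus \<inter> {\<xi> :: real ^ 'n. laplacian_symbol \<xi> \<le> \<omega>} \<in> sets lebesgue"
    using torus_lebesgue by (intro sets.Int) auto
  then show ?thesis by (simp add: Omega_def Int_def)
qed

theorem mainTheorem5:
  fixes \<omega> c C :: real
    and P :: "real ^ 'n \<Rightarrow> real ^ 'n"
    and D :: "(real ^ 'n) set"
    and \<U> :: "(real ^ 'n) set set"
    and \<psi> :: "nat \<Rightarrow> real ^ 'n \<Rightarrow> complex"
    and lam :: "nat \<Rightarrow> complex"
    and h0 :: "real ^ 'n \<Rightarrow> complex"
    and S S_inv T :: "(real ^ 'n \<Rightarrow> complex) \<Rightarrow> (real ^ 'n \<Rightarrow> complex)"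
    and f0 :: "int ^ 'n \<Rightarrow> complex"
    and R :: "(int ^ 'n \<Rightarrow> complex) \<Rightarrow> (int ^ 'n \<Rightarrow> complex)"
  assumes "0 \<le> \<omega>" and "\<omega> \<le> 2"
    and "bij_betw P torus torus"
    and "D \<in> sets lebesgue" and "P ` Omega \<omega> = D"
    and "torus_piecewise_C1_on P (Omega \<omega>) \<U>"
    and "0 < c"
    and "\<forall>\<xi>\<in>\<Union>\<U>. c \<le> \<bar>torus_jacobian_det P \<xi>\<bar> \<and> \<bar>torus_jacobian_det P \<xi>\<bar> \<le> C"
    and "L2_orthonormal_basis D \<psi>"
    and "uniformly_separated lam"
    and "h0 \<in> L2 D"
    and "comparable_seq (\<lambda>j. (cmod (L2_inner h0 (\<psi> j)))\<^sup>2) (\<lambda>j. 1 - (cmod (lam j))\<^sup>2)"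
    and "S = transport_op P D"
    and "S_inv = transport_op_inv P (Omega \<omega>) D"
    and "T = diagonal_op D \<psi> lam"
    and "f0 = fourier_inv (S_inv h0)"
    and "R = (\<lambda>f. fourier_inv (S_inv (T (S (restrict_to (Omega \<omega>) (fourier f))))))"
  shows "R ` GPW \<omega> \<subseteq> GPW \<omega> \<and> ell2_frame_for (GPW \<omega>) (\<lambda>k. (R ^^ k) f0)"
proof -
  have PD: "P ` Omega \<omega> \<in> sets lebesgue" using assms(4,5) by simp
  have jac: "c \<le> \<bar>torus_jacobian_det P \<xi>\<bar> \<and> \<bar>torus_jacobian_det P \<xi>\<bar> \<le> C" if "\<xi> \<in> \<Union>\<U>" for \<xi>
    using assms(8) that by blast
  obtain J C' where J: "J \<in> borel_measurable (lebesgue_on (Omega \<omega>))" "\<And>\<xi>. c \<le> J \<xi>" "\<And>\<xi>. J \<xi> \<le> C'"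
    "\<And>f :: real ^ 'n \<Rightarrow> real. integrable (lebesgue_on (P ` Omega \<omega>)) f \<longleftrightarrow> integrable (lebesgue_on (Omega \<omega>)) (\<lambda>\<xi>. J \<xi> * f (P \<xi>))"
    "\<And>f :: real ^ 'n \<Rightarrow> real. integrable (lebesgue_on (P ` Omega \<omega>)) f \<Longrightarrow>
       (LINT y|lebesgue_on (P ` Omega \<omega>). f y) = (LINT \<xi>|lebesgue_on (Omega \<omega>). J \<xi> * f (P \<xi>))"
    by (rule torus_change_of_variables[OF assms(3) Omega_torus Omega_lebesgue PD assms(6)], erule jac, rule that)
  interpret torus_transport P "Omega \<omega>" D J c C'
    by unfold_locales
      (rule assms(3) Omega_torus Omega_lebesgue assms(5)[symmetric] assms(4) J(1) assms(7) J(2,3) J(4,5)[unfolded assms(5)] | assumption)+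
  have C'_pos: "C' > 0" by (rule less_le_trans[OF J_pos J_le])
  have lam: "cmod (lam j) \<le> 1" for j using assms(10) by (auto simp: uniformly_separated_def less_imp_le)
  note basis = assms(9)
  have S_in: "S g \<in> L2 D" if "g \<in> L2 (Omega \<omega>)" for g
    using transport_op_L2(1)[OF that] by (simp add: assms(13))
  have T_in: "T g \<in> L2 D" and T_coeff: "L2_inner (T g) (\<psi> j) = lam j * L2_inner g (\<psi> j)" if "g \<in> L2 D" for g j
    using diagonal_op_spec[OF basis lam that] by (simp_all add: assms(15))
  have T_cong: "T g = T g'" if "L2_eq g g'" "g \<in> L2 D" "g' \<in> L2 D" for g g'
    unfolding assms(15)
    by (rule diagonal_op_cong, rule L2_inner_cong_left[OF that L2_orthonormal_in[OF L2_basis_orthonormal[OF basis]]])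
  have Sinv_in: "S_inv h \<in> L2 (Omega \<omega>)" and S_Sinv: "L2_eq (S (S_inv h)) h" if "h \<in> L2 D" for h
    using transport_op_inv_spec(1,2)[OF that] by (simp_all add: assms(13,14))
  have S_cong: "L2_eq (S g) (S g')" if "g \<in> L2 (Omega \<omega>)" "g' \<in> L2 (Omega \<omega>)" "L2_eq g g'" for g g'
    using transport_op_cong[OF that] by (simp add: assms(13))
  have preimage: "fourier_inv (S_inv h) \<in> ell2" "L2_eq (fourier (fourier_inv (S_inv h))) (S_inv h)"
      "fourier_inv (S_inv h) \<in> GPW \<omega>" if h: "h \<in> L2 D" for h
  proof -
    note F = fourier_inv_spec[OF L2_subset_torus[OF Sinv_in[OF h]]]
    show "fourier_inv (S_inv h) \<in> ell2" "L2_eq (fourier (fourier_inv (S_inv h))) (S_inv h)" by (rule F)+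
    show "fourier_inv (S_inv h) \<in> GPW \<omega>"
      using F L2_support_cong[OF Sinv_in[OF h] F(2) fourier_spec(1)[OF F(1)]] by (simp add: GPW_def)
  qed
  have restr: "restrict_to (Omega \<omega>) F \<in> L2 (Omega \<omega>) \<and> L2_eq (restrict_to (Omega \<omega>) F) F"
    if F: "F \<in> L2 (Omega \<omega>)" for F :: "real ^ 'n \<Rightarrow> complex"
  proof -
    have R: "restrict_to (Omega \<omega>) F \<in> L2 (Omega \<omega>)"
      by (rule restrict_to_L2[OF \<Omega> L2_on_support(1,2)[OF \<Omega> F]])
    moreover have "L2_eq (restrict_to (Omega \<omega>) F) F"
      unfolding L2_eq_on_support[OF \<Omega> R F] by (rule AE_I2) (simp add: restrict_to_def)
    ultimately show ?thesis by blast
  qed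
  have R_GPW: "R f \<in> GPW \<omega>" if "f \<in> GPW \<omega>" for f
  proof -
    have "fourier f \<in> L2 (Omega \<omega>)" using that by (simp add: GPW_def)
    then show ?thesis unfolding assms(17) using restr by (intro preimage T_in S_in) blast
  qed
  \<comment> \<open>The orbit of \<open>T\<close> in \<open>L\<^sup>2(D)\<close>, explicit in the basis \<open>\<psi>\<close>.\<close>
  define w where "w k = (T ^^ k) h0" for k
  have w: "w k \<in> L2 D \<and> (\<forall>j. L2_inner (w k) (\<psi> j) = lam j ^ k * L2_inner h0 (\<psi> j))" for k
    by (induction k) (use assms(11) T_in T_coeff in \<open>auto simp: w_def\<close>)
  define v where "v k = (R ^^ k) f0" for k
  \<comment> \<open>\<open>R\<close> is conjugate to \<open>T\<close>, so the two orbits correspond.\<close>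
  have v: "v k = fourier_inv (S_inv (w k))" for k
  proof (induction k)
    case 0
    then show ?case by (simp add: v_def w_def assms(16))
  next
    case (Suc k)
    have wk: "w k \<in> L2 D" using w by blast
    let ?g = "restrict_to (Omega \<omega>) (fourier (v k))"
    have vk: "v k \<in> GPW \<omega>" "L2_eq (fourier (v k)) (S_inv (w k))"
      unfolding Suc by (rule preimage[OF wk])+
    then have g: "?g \<in> L2 (Omega \<omega>)" "L2_eq ?g (fourier (v k))" using restr by (auto simp: GPW_def)
    have "L2_eq (S ?g) (S (S_inv (w k)))"
      by (rule S_cong[OF g(1) Sinv_in[OF wk] L2_eq_trans[OF g(2) vk(2)]])
    then have "L2_eq (S ?g) (w k)" using S_Sinv[OF wk] by (rule L2_eq_trans)
    then have "T (S ?g) = w (Suc k)"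
      using T_cong[OF _ S_in[OF g(1)] wk] by (simp add: w_def)
    moreover have "v (Suc k) = R (v k)" by (simp add: v_def)
    ultimately show ?case by (simp add: assms(17))
  qed
  from assms(12)[unfolded comparable_seq_def] obtain c0 C0 where c0_pos: "0 < c0" "0 < C0"
    and cmp: "\<forall>j. c0 * (cmod (L2_inner h0 (\<psi> j)))\<^sup>2 \<le> 1 - (cmod (lam j))\<^sup>2 \<and>
      1 - (cmod (lam j))\<^sup>2 \<le> C0 * (cmod (L2_inner h0 (\<psi> j)))\<^sup>2"
    by (elim exE conjE)
  have cmp': "c0 * (cmod (L2_inner h0 (\<psi> j)))\<^sup>2 \<le> 1 - (cmod (lam j))\<^sup>2"
    "1 - (cmod (lam j))\<^sup>2 \<le> C0 * (cmod (L2_inner h0 (\<psi> j)))\<^sup>2" for j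
    using cmp by simp_all
  from Carleson_frame_bounds[where h = "\<lambda>j. L2_inner h0 (\<psi> j)", OF assms(10) c0_pos cmp']
  obtain A B where AB: "A > 0" "B > 0"
    and bounds: "\<forall>G W. summable (\<lambda>j. (cmod (G j))\<^sup>2) \<longrightarrow> (\<forall>k. (\<lambda>j. G j * cnj (lam j ^ k * L2_inner h0 (\<psi> j))) sums W k) \<longrightarrow>
       summable (\<lambda>k. (cmod (W k))\<^sup>2) \<and> A * sqsum G \<le> sqsum W \<and> sqsum W \<le> B * sqsum G"
    by (elim exE conjE)
  have frame: "summable (\<lambda>k. (cmod (ell2_inner f (v k)))\<^sup>2) \<and>
      A / C' * (ell2_norm f)\<^sup>2 \<le> (\<Sum>k. (cmod (ell2_inner f (v k)))\<^sup>2) \<and>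
      (\<Sum>k. (cmod (ell2_inner f (v k)))\<^sup>2) \<le> B / c * (ell2_norm f)\<^sup>2" if f: "f \<in> GPW \<omega>" for f
  proof -
    have fe: "f \<in> ell2" and F: "fourier f \<in> L2 (Omega \<omega>)" using f by (auto simp: GPW_def)
    obtain G where G: "G \<in> L2 D"
      "\<And>h. h \<in> L2 D \<Longrightarrow> L2_inner G h = L2_inner (fourier f) (transport_op_inv P (Omega \<omega>) D h)"
      "(L2_norm (fourier f))\<^sup>2 \<le> C' * (L2_norm G)\<^sup>2" "c * (L2_norm G)\<^sup>2 \<le> (L2_norm (fourier f))\<^sup>2"
      using adjoint_exists[OF F] by blast
    have inner: "ell2_inner f (v k) = L2_inner G (w k)" for k
    proof -
      have wk: "w k \<in> L2 D" using w by blast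
      have "ell2_inner f (v k) = cnj (L2_inner (fourier (v k)) (fourier f))"
        unfolding ell2_inner_fourier[OF fe preimage(1)[OF wk], folded v] by (rule L2_inner_commute)
      also have "L2_inner (fourier (v k)) (fourier f) = L2_inner (S_inv (w k)) (fourier f)"
        unfolding v by (rule L2_inner_cong_left[OF preimage(2)[OF wk] fourier_spec(1)[OF preimage(1)[OF wk]] Sinv_in[OF wk] F])
      also have "cnj \<dots> = L2_inner G (w k)"
        unfolding L2_inner_commute[of "fourier f", symmetric] using G(2)[OF wk] by (simp add: assms(14))
      finally show ?thesis .
    qed
    have "\<forall>k. (\<lambda>j. L2_inner G (\<psi> j) * cnj (lam j ^ k * L2_inner h0 (\<psi> j))) sums ell2_inner f (v k)"
      using L2_basis_inner_sums[OF basis G(1), of "w _"] w by (simp add: inner)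
    from bounds[rule_format, OF L2_basis_Parseval(1)[OF basis G(1)], OF this[rule_format]]
    have *: "summable (\<lambda>k. (cmod (ell2_inner f (v k)))\<^sup>2)"
      "A * (L2_norm G)\<^sup>2 \<le> (\<Sum>k. (cmod (ell2_inner f (v k)))\<^sup>2)"
      "(\<Sum>k. (cmod (ell2_inner f (v k)))\<^sup>2) \<le> B * (L2_norm G)\<^sup>2"
      unfolding L2_basis_Parseval(2)[OF basis G(1)] by (auto simp: sqsum_def)
    have "A / C' * (ell2_norm f)\<^sup>2 \<le> A / C' * (C' * (L2_norm G)\<^sup>2)"
      using G(3) AB(1) C'_pos unfolding ell2_norm_fourier[OF fe] by (intro mult_left_mono) auto
    also have "\<dots> = A * (L2_norm G)\<^sup>2" using C'_pos by simp
    finally have lower: "A / C' * (ell2_norm f)\<^sup>2 \<le> A * (L2_norm G)\<^sup>2" .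
    have "B / c * (c * (L2_norm G)\<^sup>2) \<le> B / c * (ell2_norm f)\<^sup>2"
      using G(4) AB(2) c_pos unfolding ell2_norm_fourier[OF fe] by (intro mult_left_mono) auto
    then have upper: "B * (L2_norm G)\<^sup>2 \<le> B / c * (ell2_norm f)\<^sup>2" using c_pos by simp
    show ?thesis using * lower upper by linarith
  qed
  have "ell2_frame_for (GPW \<omega>) v"
    unfolding ell2_frame_for_def
  proof (rule conjI)
    show "\<forall>k. v k \<in> GPW \<omega>"
    proof
      show "v k \<in> GPW \<omega>" for k unfolding v using w by (intro preimage) blast
    qed
    have "A / C' > 0" "B / c > 0" using AB C'_pos c_pos by auto
    then show "\<exists>A>0. \<exists>B>0. \<forall>f\<in>GPW \<omega>. summable (\<lambda>k. (cmod (ell2_inner f (v k)))\<^sup>2) \<and>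
      A * (ell2_norm f)\<^sup>2 \<le> (\<Sum>k. (cmod (ell2_inner f (v k)))\<^sup>2) \<and>
      (\<Sum>k. (cmod (ell2_inner f (v k)))\<^sup>2) \<le> B * (ell2_norm f)\<^sup>2" using frame by blast
  qed
  then show ?thesis using R_GPW unfolding v_def[abs_def] by auto
qed

end
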